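(* Let $R$ be a Noetherian ring, let $I$ be an ideal of $R$, and let $M$ be an $I$-filtered module with filtration $\{M_n\}_{n\ge 0}$. Then there exists a finite set $\Lambda$ of prime ideals of $R$ such that for every $n$ there exists a prime filtration of $M/M_n$ all of whose prime factors lie in $\Lambda$; moreover, these filtrations can be chosen so that for every $P \in \Lambda$ the multiplicity $\mu_P(M/M_n)$ of $P$ in the chosen prime filtration of $M/M_n$ satisfies $\mu_P(M/M_n) = O(n^{\dim M})$. Furthermore, if $R$ has infinite residue fields, then the prime filtrations can be chosen with stabilizing sets of prime factors, i.e. so that there exists a subset $\Lambda' \subseteq \Lambda$ such that for all sufficiently large $n$ the set of prime factors of the chosen filtration of $M/M_n$ is precisely $\Lambda'$.
   Context: Rings are commutative with identity. Let $R$ be a Noetherian ring and $I$ an ideal of $R$. A finitely generated $R$-module $M$ is called an $I$-filtered module if it is endowed with a descending filtration by submodules $M = M_0 \supseteq M_1 \supseteq \cdots \supseteq M_n \supseteq \cdots$ such that (1) $I M_n \subseteq M_{n+1}$ for all $n$, and (2) $\bigoplus_{n\ge 0} M_n$ is a finitely generated module over the Rees ring $\bigoplus_{n \ge 0} I^n$. A prime filtration of an $R$-module $N$ is a finite filtration by submodules $0 = N_0 \subset N_1 \subset \cdots \subset N_k = N$ such that for each $i$, $N_i/N_{i-1} \cong R/P_i$ for some prime ideal $P_i$ of $R$. The primes $P_i$ are called the primes (prime factors) of the filtration. For a prime $P$, its multiplicity $\mu_P$ in a prime filtration is the number of quotients $N_i/N_{i-1}$ isomorphic to $R/P$ (it depends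 on the filtration). $\dim M$ denotes Krull dimension. "$R$ has infinite residue fields" means that the residue field of $R$ at every prime (equivalently, every maximal) ideal is infinite. *)

theory Defs
  imports
    "HOL-Algebra.Ring_Divisibility"
    "HOL-Algebra.Ideal_Product"
    "HOL-Algebra.UnivPoly"
    "HOL-Library.Landau_Symbols"
    "HOL-Library.Extended_Real"
begin

subsection \<open>Modules\<close>

definition fin_gen_module :: "('a, 'c) ring_scheme \<Rightarrow> ('a, 'b, 'd) module_scheme \<Rightarrow> bool" where
  "fin_gen_module R M \<longleftrightarrow>
     (\<exists>A \<subseteq> carrier M. finite A \<and> \<Inter> {N. submodule N R M \<and> A \<subseteq> N} = carrier M)"

text \<open>
  The fields \<^const>\<open>mult\<close> and \<^const>\<open>one\<close>, which the record of modules inherits from that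
  of rings, play no role in the theory of modules.
\<close>
definition quot_module ::
    "('a, 'b, 'd) module_scheme \<Rightarrow> 'b set \<Rightarrow> ('a, 'b set) module" where
  "quot_module M N =
     \<lparr>carrier = a_rcosets\<^bsub>M\<^esub> N, mult = undefined, one = undefined,
      zero = N, add = set_add M,
      smult = (\<lambda>a X. \<Union>x\<in>X. N +>\<^bsub>M\<^esub> (a \<odot>\<^bsub>M\<^esub> x))\<rparr>"

definition ring_as_module :: "('a, 'c) ring_scheme \<Rightarrow> ('a, 'a) module" where
  "ring_as_module R =
     \<lparr>carrier = carrier R, mult = mult R, one = one R, zero = zero R, add = add R,
      smult = mult R\<rparr>"

definition module_isomorphic ::
    "('a, 'c) ring_scheme \<Rightarrow> ('a, 'b, 'd) module_scheme \<Rightarrow> ('a, 'e, 'f) module_scheme \<Rightarrow> bool" where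
  "module_isomorphic R M N \<longleftrightarrow>
     (\<exists>h. bij_betw h (carrier M) (carrier N) \<and>
          (\<forall>x \<in> carrier M. \<forall>y \<in> carrier M. h (x \<oplus>\<^bsub>M\<^esub> y) = h x \<oplus>\<^bsub>N\<^esub> h y) \<and>
          (\<forall>a \<in> carrier R. \<forall>x \<in> carrier M. h (a \<odot>\<^bsub>M\<^esub> x) = a \<odot>\<^bsub>N\<^esub> h x))"

definition annihilator :: "('a, 'c) ring_scheme \<Rightarrow> ('a, 'b, 'd) module_scheme \<Rightarrow> 'a set" where
  "annihilator R M = {a \<in> carrier R. \<forall>x \<in> carrier M. a \<odot>\<^bsub>M\<^esub> x = \<zero>\<^bsub>M\<^esub>}"


subsection \<open>Krull dimension\<close>

text \<open>
  The values lie in the extended reals because the dimension of a Noetherian ring can be infinite;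
  the zero ring has no primes and gets dimension \<open>- \<infinity>\<close>.
\<close>
definition krull_dim :: "('a, 'c) ring_scheme \<Rightarrow> ereal" where
  "krull_dim R =
     Sup {ereal (real k) | k. \<exists>P :: nat \<Rightarrow> 'a set.
            (\<forall>i \<le> k. primeideal (P i) R) \<and> (\<forall>i < k. P i \<subset> P (Suc i))}"

definition module_dim :: "('a, 'c) ring_scheme \<Rightarrow> ('a, 'b, 'd) module_scheme \<Rightarrow> ereal" where
  "module_dim R M = krull_dim (R Quot annihilator R M)"

text \<open>
  The relation \<open>f(n) = O(n\<^sup>d)\<close>, where for \<open>n \<ge> 2\<close> one reads \<open>n\<close> to the power \<open>\<infinity>\<close> as \<open>\<infinity>\<close>
  and \<open>n\<close> to the power \<open>- \<infinity>\<close> as \<open>0\<close>.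
\<close>
definition bigo_power :: "(nat \<Rightarrow> nat) \<Rightarrow> ereal \<Rightarrow> bool" where
  "bigo_power f d =
     (case d of
        ereal r \<Rightarrow> (\<lambda>n. real (f n)) \<in> O(\<lambda>n. real n powr r)
      | PInfty \<Rightarrow> True
      | MInfty \<Rightarrow> (\<forall>\<^sub>F n in sequentially. f n = 0))"


subsection \<open>Filtered modules\<close>

text \<open>
  The direct sum of the powers of \<open>I\<close> is realised as the subring \<open>R[It]\<close> of \<open>R[t]\<close>.
  The polynomial ring \<^term>\<open>UP R\<close> has as elements the finitely supported coefficient sequences
  \<^term>\<open>up R\<close>, and its product is convolution. \<^term>\<open>ideals_set R\<close> is the multiplicative
  monoid of ideals, with unit \<^term>\<open>carrier R\<close>.
\<close>
definition rees_ring :: "('a, 'c) ring_scheme \<Rightarrow> 'a set \<Rightarrow> ('a, nat \<Rightarrow> 'a) up_ring" where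
  "rees_ring R I =
     (UP R)\<lparr>carrier := {p \<in> up R. \<forall>n. p n \<in> I [^]\<^bsub>ideals_set R\<^esub> n}\<rparr>"

text \<open>
  Similarly the direct sum of the \<open>Mn n\<close> consists of the finitely supported sequences
  with entries in \<open>Mn n\<close>; the Rees ring acts on it by convolution.
\<close>
definition rees_module ::
    "('a, 'b, 'd) module_scheme \<Rightarrow> (nat \<Rightarrow> 'b set) \<Rightarrow> (nat \<Rightarrow> 'a, nat \<Rightarrow> 'b) module" where
  "rees_module M Mn =
     \<lparr>carrier = {f \<in> up M. \<forall>n. f n \<in> Mn n}, mult = undefined, one = undefined,
      zero = (\<lambda>n. \<zero>\<^bsub>M\<^esub>), add = (\<lambda>f g n. f n \<oplus>\<^bsub>M\<^esub> g n),
      smult = (\<lambda>p f n. \<Oplus>\<^bsub>M\<^esub>i \<in> {..n}. p i \<odot>\<^bsub>M\<^esub> f (n - i))\<rparr>"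

definition filtered_module ::
    "('a, 'c) ring_scheme \<Rightarrow> 'a set \<Rightarrow> ('a, 'b, 'd) module_scheme \<Rightarrow> (nat \<Rightarrow> 'b set) \<Rightarrow> bool" where
  "filtered_module R I M Mn \<longleftrightarrow>
     module R M \<and> fin_gen_module R M \<and>
     Mn 0 = carrier M \<and>
     (\<forall>n. submodule (Mn n) R M) \<and>
     (\<forall>n. Mn (Suc n) \<subseteq> Mn n) \<and>
     (\<forall>n. \<forall>a \<in> I. \<forall>x \<in> Mn n. a \<odot>\<^bsub>M\<^esub> x \<in> Mn (Suc n)) \<and>
     fin_gen_module (rees_ring R I) (rees_module M Mn)"


subsection \<open>Prime filtrations\<close>

text \<open>
  A filtration of length \<open>k\<close> is given by the list of its \<open>k + 1\<close> terms. The \<open>i\<close>-th quotient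
  is compared with \<open>R/P\<close> as an \<open>R\<close>-module; \<open>P\<close> is determined by this as the
  annihilator of the quotient.
\<close>
definition quotient_is_prime ::
    "('a, 'c) ring_scheme \<Rightarrow> ('a, 'b, 'd) module_scheme \<Rightarrow> 'b set list \<Rightarrow> nat \<Rightarrow> 'a set \<Rightarrow> bool" where
  "quotient_is_prime R N Ns i P \<longleftrightarrow>
     primeideal P R \<and>
     module_isomorphic R (quot_module (N\<lparr>carrier := Ns ! Suc i\<rparr>) (Ns ! i))
                         (quot_module (ring_as_module R) P)"

definition prime_filtration ::
    "('a, 'c) ring_scheme \<Rightarrow> ('a, 'b, 'd) module_scheme \<Rightarrow> 'b set list \<Rightarrow> bool" where
  "prime_filtration R N Ns \<longleftrightarrow>
     Ns \<noteq> [] \<and> hd Ns = {\<zero>\<^bsub>N\<^esub>} \<and> last Ns = carrier N \<and>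
     (\<forall>L \<in> set Ns. submodule L R N) \<and>
     (\<forall>i. Suc i < length Ns \<longrightarrow>
        Ns ! i \<subset> Ns ! Suc i \<and> (\<exists>P. quotient_is_prime R N Ns i P))"

definition filtration_primes ::
    "('a, 'c) ring_scheme \<Rightarrow> ('a, 'b, 'd) module_scheme \<Rightarrow> 'b set list \<Rightarrow> 'a set set" where
  "filtration_primes R N Ns =
     {P. \<exists>i. Suc i < length Ns \<and> quotient_is_prime R N Ns i P}"

definition filtration_mult ::
    "('a, 'c) ring_scheme \<Rightarrow> ('a, 'b, 'd) module_scheme \<Rightarrow> 'b set list \<Rightarrow> 'a set \<Rightarrow> nat" where
  "filtration_mult R N Ns P =
     card {i. Suc i < length Ns \<and> quotient_is_prime R N Ns i P}"


subsection \<open>Residue fields\<close>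

text \<open>
  The residue field at a maximal ideal \<open>m\<close> is \<open>R/m\<close>. The residue field at a prime contained in
  \<open>m\<close> is infinite as soon as this one is.
\<close>
definition infinite_residue_fields :: "('a, 'c) ring_scheme \<Rightarrow> bool" where
  "infinite_residue_fields R \<longleftrightarrow> (\<forall>m. maximalideal m R \<longrightarrow> infinite (carrier (R Quot m)))"

end

theory Submission
  imports Defs
begin

text \<open>
  All modules that occur are subquotients \<open>B/A\<close> of \<open>M\<close> with the filtration induced by \<open>Mn\<close>. Prime
  filtrations can be spliced, so by a prime filtration of \<open>M\<close> itself it is enough to treat
  \<open>B/A \<cong> R/P\<close>, by Noetherian induction on \<open>P\<close>. Let \<open>F n\<close> be the induced filtration. An element
  \<open>x \<in> I\<^sup>s\<close> with \<open>s \<ge> 1\<close> whose initial form avoids the relevant associated primes of the graded module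
  \<open>\<Oplus> F n/F (n + 1)\<close> satisfies \<open>(F (n + s) : x) \<inter> F n\<^sub>0 = F n\<close> for all \<open>n \<ge> n\<^sub>0\<close>. If \<open>x \<in> P\<close>, the filtration is
  stationary. Otherwise \<open>F n\<^sub>0/F (n + s)\<close> is built from a copy of \<open>F n\<^sub>0/F n\<close> and a quotient of
  \<open>F n\<^sub>0/(A + x F n\<^sub>0)\<close>, whose primes are strictly larger than \<open>P\<close>. The lengths thus grow by
  \<open>O(n\<^sup>d\<^sup>-\<^sup>1)\<close> in each step when \<open>R/P\<close> has dimension \<open>d\<close>, and only finitely many primes occur. Over
  infinite residue fields one can take \<open>s = 1\<close>, and then the sets of primes increase with \<open>n\<close>.
\<close>

section \<open>Ascending chain conditions\<close>

text \<open>The filtration induced on a subquotient is in general not \<open>I\<close>-adic, so the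
  induction needs a finiteness property that passes to subquotients. It is the ascending chain
  condition for families \<open>L n\<close> of submodules with \<open>I\<close> times
  \<open>L n\<close> inside \<open>L (n + 1)\<close>. As the Rees ring is generated in degree one,
  these are its homogeneous submodules. Such conditions descend along order-preserving maps that are
  injective on comparable elements, and they yield the finitely many associated primes to be
  avoided.

  The graded module only controls elements of \<open>F n\<close> in large degrees; the colon
  property for all of \<open>F n\<^sub>0\<close> follows by going up from degree
  \<open>n\<^sub>0\<close>, and this is why the recursion starts at \<open>F n\<^sub>0\<close>.

  The step from \<open>n\<close> to \<open>n + s\<close> compares sets of primes only within a
  residue class modulo \<open>s\<close>. For \<open>s = 1\<close> they form one increasing sequence
  inside a finite set, which becomes constant. Degree one is available over infinite residue fields
  because \<open>I\<close> is then not covered by finitely many ideals that do not contain it, prime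
  or not.\<close>

definition acc :: "'x::order set \<Rightarrow> bool" where
  "acc S \<longleftrightarrow> (\<forall>C :: nat \<Rightarrow> 'x. (\<forall>i. C i \<in> S) \<longrightarrow> mono C \<longrightarrow> (\<exists>i0. \<forall>i\<ge>i0. C i = C i0))"

lemma accD: "acc S \<Longrightarrow> (\<And>i. C i \<in> S) \<Longrightarrow> mono C \<Longrightarrow> \<exists>i0. \<forall>i\<ge>i0. C i = C (i0::nat)"
  unfolding acc_def by blast

lemma acc_mono: "acc S \<Longrightarrow> T \<subseteq> S \<Longrightarrow> acc T"
  unfolding acc_def by blast

lemma acc_wf:
  assumes "acc S"
  shows "wf {(y, x). x \<in> S \<and> y \<in> S \<and> x < y}"
  unfolding wf_iff_no_infinite_down_chain
proof
  assume "\<exists>f. \<forall>i::nat. (f (Suc i), f i) \<in> {(y, x). x \<in> S \<and> y \<in> S \<and> x < y}"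
  then obtain f where f: "\<And>i::nat. f i \<in> S" "\<And>i. f i < f (Suc i)" by blast
  then have "mono f" by (simp add: less_imp_le mono_iff_le_Suc)
  then obtain i0 where "\<forall>i\<ge>i0. f i = f i0" using accD[OF assms, of f] f(1) by blast
  then show False using f(2)[of i0] by (metis le_SucI order_refl less_irrefl)
qed

lemma acc_induct [consumes 2, case_names step]:
  assumes "acc S" and "x \<in> S"
    and "\<And>x. x \<in> S \<Longrightarrow> (\<And>y. y \<in> S \<Longrightarrow> x < y \<Longrightarrow> P y) \<Longrightarrow> P x"
  shows "P x"
  using assms(2)
proof (induction x rule: wf_induct_rule[OF acc_wf[OF assms(1)]])
  case (1 x)
  then show ?case using assms(3)[of x] by simp
qed

lemma acc_maximal:
  assumes "acc S" "T \<subseteq> S" "T \<noteq> {}"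
  obtains m where "m \<in> T" "\<And>t. t \<in> T \<Longrightarrow> m \<le> t \<Longrightarrow> t = m"
proof -
  obtain m where "m \<in> T" "\<And>y. (y, m) \<in> {(y, x). x \<in> S \<and> y \<in> S \<and> x < y} \<Longrightarrow> y \<notin> T"
    using wfE_min'[OF acc_wf[OF assms(1)] assms(3)] by blast
  then show thesis using that assms(2) by (metis (mono_tags, lifting) case_prodI in_mono mem_Collect_eq order.not_eq_order_implies_strict)
qed

text \<open>Injectivity is asked on comparable pairs only: by the modular law, nested submodules
  with the same intersection with \<open>S\<close> and the same sum with \<open>S\<close> are equal,
  while incomparable ones may differ.\<close>

lemma acc_map2:
  assumes S1: "acc S1" and S2: "acc S2"
    and f: "\<And>x. x \<in> T \<Longrightarrow> f x \<in> S1" "\<And>x y. x \<in> T \<Longrightarrow> y \<in> T \<Longrightarrow> x \<le> y \<Longrightarrow> f x \<le> f y"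
    and g: "\<And>x. x \<in> T \<Longrightarrow> g x \<in> S2" "\<And>x y. x \<in> T \<Longrightarrow> y \<in> T \<Longrightarrow> x \<le> y \<Longrightarrow> g x \<le> g y"
    and inj: "\<And>x y. x \<in> T \<Longrightarrow> y \<in> T \<Longrightarrow> x \<le> y \<Longrightarrow> f x = f y \<Longrightarrow> g x = g y \<Longrightarrow> x = y"
  shows "acc T"
  unfolding acc_def
proof (intro allI impI)
  fix C assume C: "\<forall>i::nat. C i \<in> T" "mono C"
  have "mono (\<lambda>i. f (C i))" "mono (\<lambda>i. g (C i))"
    using C f(2) g(2) by (simp_all add: mono_def)
  then have "\<exists>i1. \<forall>i\<ge>i1. f (C i) = f (C i1)" "\<exists>i2. \<forall>i\<ge>i2. g (C i) = g (C i2)"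
    using accD[OF S1, of "\<lambda>i. f (C i)"] accD[OF S2, of "\<lambda>i. g (C i)"] C(1) f(1) g(1) by simp_all
  then obtain i1 i2 where "\<forall>i\<ge>i1. f (C i) = f (C i1)" "\<forall>i\<ge>i2. g (C i) = g (C i2)"
    by blast
  then have "C i = C (max i1 i2)" if "i \<ge> max i1 i2" for i
  proof -
    have "f (C (max i1 i2)) = f (C i)" "g (C (max i1 i2)) = g (C i)"
      using that \<open>\<forall>i\<ge>i1. _ i\<close> \<open>\<forall>i\<ge>i2. _ i\<close> by (metis max.bounded_iff order_refl)+
    then show ?thesis using inj[of "C (max i1 i2)" "C i"] C that monoD[OF C(2) that] by metis
  qed
  then show "\<exists>i0. \<forall>i\<ge>i0. C i = C i0" by blast
qed

lemma acc_map:
  assumes "acc S" "\<And>x. x \<in> T \<Longrightarrow> f x \<in> S"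
    and "\<And>x y. x \<in> T \<Longrightarrow> y \<in> T \<Longrightarrow> x \<le> y \<Longrightarrow> f x \<le> f y"
    and "\<And>x y. x \<in> T \<Longrightarrow> y \<in> T \<Longrightarrow> x \<le> y \<Longrightarrow> f x = f y \<Longrightarrow> x = y"
  shows "acc T"
  by (rule acc_map2[OF assms(1,1,2,3,2,3)]) (auto intro: assms(4))

lemma (in noetherian_ring) acc_ideals: "acc {J. ideal J R}"
  unfolding acc_def
proof (intro allI impI)
  fix C :: "nat \<Rightarrow> 'a set" assume C: "\<forall>i. C i \<in> {J. ideal J R}" "mono C"
  have "subset.chain {J. ideal J R} (range C)"
    unfolding subset_chain_def
  proof (intro conjI ballI)
    fix J K assume "J \<in> range C" "K \<in> range C"
    then obtain i j where "J = C i" "K = C j" by blast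
    then show "J \<subseteq> K \<or> K \<subseteq> J"
      using monoD[OF C(2), of i j] monoD[OF C(2), of j i] nat_le_linear[of i j] by blast
  qed (use C(1) in blast)
  then have "\<Union> (range C) \<in> range C"
    using ideal_chain_is_trivial[of "range C"] by blast
  then obtain i0 where i0: "\<Union> (range C) = C i0" by blast
  then have "C i = C i0" if "i \<ge> i0" for i
    using monoD[OF C(2) that] by blast
  then show "\<exists>i0. \<forall>i\<ge>i0. C i = C i0" by blast
qed

section \<open>Submodules\<close>

context module begin

abbreviation scalar_mult :: "'a \<Rightarrow> 'c \<Rightarrow> 'c" (infixl "\<bullet>" 70) where
  "r \<bullet> v \<equiv> r \<odot>\<^bsub>M\<^esub> v"

abbreviation cyclic :: "'c \<Rightarrow> 'c set" where
  "cyclic u \<equiv> (\<lambda>r. r \<bullet> u) ` carrier R"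

lemma submodule_carr: "submodule N R M \<Longrightarrow> v \<in> N \<Longrightarrow> v \<in> carrier M"
  using submoduleE(1) by blast

lemma submodule_zero: "submodule N R M \<Longrightarrow> \<zero>\<^bsub>M\<^esub> \<in> N"
  using submoduleE(2,4)[of N] smult_l_null submodule_carr by (metis R.zero_closed all_not_in_conv)

lemma submodule_minus: "submodule N R M \<Longrightarrow> v \<in> N \<Longrightarrow> w \<in> N \<Longrightarrow> v \<ominus>\<^bsub>M\<^esub> w \<in> N"
  by (simp add: M.minus_eq submoduleE)

lemma submodule_cancel:
  assumes "submodule N R M" "v \<in> N" "v \<oplus>\<^bsub>M\<^esub> w \<in> N" "w \<in> carrier M"
  shows "w \<in> N"
proof -
  have "w = (v \<oplus>\<^bsub>M\<^esub> w) \<ominus>\<^bsub>M\<^esub> v"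
    using assms submodule_carr[OF assms(1)] by (simp add: M.minus_eq) (metis M.a_comm M.add.inv_closed M.r_neg2 M.add.m_closed)
  then show ?thesis using submodule_minus[OF assms(1,3,2)] by simp
qed

lemma mem_set_add: "v \<in> A <+>\<^bsub>M\<^esub> B \<longleftrightarrow> (\<exists>a\<in>A. \<exists>b\<in>B. v = a \<oplus>\<^bsub>M\<^esub> b)"
  by (auto simp: set_add_def' )

lemma submodule_set_add:
  assumes A: "submodule A R M" and B: "submodule B R M"
  shows "submodule (A <+>\<^bsub>M\<^esub> B) R M"
proof (rule submoduleI)
  note sm = submodule_carr[OF A] submodule_carr[OF B] submoduleE[OF A] submoduleE[OF B]
  show "A <+>\<^bsub>M\<^esub> B \<subseteq> carrier M" using sm by (auto simp: mem_set_add)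
  show "\<zero>\<^bsub>M\<^esub> \<in> A <+>\<^bsub>M\<^esub> B" using A B submodule_zero unfolding mem_set_add by force
  show "\<ominus>\<^bsub>M\<^esub> v \<in> A <+>\<^bsub>M\<^esub> B" if "v \<in> A <+>\<^bsub>M\<^esub> B" for v
  proof -
    obtain a b where "a \<in> A" "b \<in> B" "v = a \<oplus>\<^bsub>M\<^esub> b" using \<open>v \<in> _\<close> unfolding mem_set_add by blast
    moreover from this have "\<ominus>\<^bsub>M\<^esub> v = \<ominus>\<^bsub>M\<^esub> a \<oplus>\<^bsub>M\<^esub> \<ominus>\<^bsub>M\<^esub> b" using sm by (simp add: M.minus_add)
    ultimately show ?thesis using sm(5,11) unfolding mem_set_add by blast
  qed
  show "v \<oplus>\<^bsub>M\<^esub> w \<in> A <+>\<^bsub>M\<^esub> B" if vw: "v \<in> A <+>\<^bsub>M\<^esub> B" "w \<in> A <+>\<^bsub>M\<^esub> B" for v w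
  proof -
    obtain a b a' b' where "a \<in> A" "b \<in> B" "a' \<in> A" "b' \<in> B" "v = a \<oplus>\<^bsub>M\<^esub> b" "w = a' \<oplus>\<^bsub>M\<^esub> b'"
      using vw unfolding mem_set_add by blast
    moreover from this have "v \<oplus>\<^bsub>M\<^esub> w = (a \<oplus>\<^bsub>M\<^esub> a') \<oplus>\<^bsub>M\<^esub> (b \<oplus>\<^bsub>M\<^esub> b')"
      using sm by (simp add: M.a_ac)
    ultimately show ?thesis using sm(7,13) unfolding mem_set_add by metis
  qed
  show "r \<bullet> v \<in> A <+>\<^bsub>M\<^esub> B" if "r \<in> carrier R" "v \<in> A <+>\<^bsub>M\<^esub> B" for r v
  proof -
    obtain a b where "a \<in> A" "b \<in> B" "v = a \<oplus>\<^bsub>M\<^esub> b" using \<open>v \<in> _\<close> unfolding mem_set_add by blast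
    moreover from this have "r \<bullet> v = r \<bullet> a \<oplus>\<^bsub>M\<^esub> r \<bullet> b"
      using sm \<open>r \<in> _\<close> by (simp add: smult_r_distr)
    ultimately show ?thesis using sm(6,12) \<open>r \<in> _\<close> unfolding mem_set_add by blast
  qed
qed

lemma submodule_Int: "submodule A R M \<Longrightarrow> submodule B R M \<Longrightarrow> submodule (A \<inter> B) R M"
  by (rule submoduleI) (auto simp: submodule_zero submoduleE submodule_carr)

lemma subset_set_add:
  assumes "submodule A R M" "submodule B R M"
  shows "A \<subseteq> A <+>\<^bsub>M\<^esub> B" "B \<subseteq> A <+>\<^bsub>M\<^esub> B"
proof -
  note sm = submodule_zero[OF assms(1)] submodule_zero[OF assms(2)]
    submodule_carr[OF assms(1)] submodule_carr[OF assms(2)]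
  show "A \<subseteq> A <+>\<^bsub>M\<^esub> B"
  proof
    fix a assume "a \<in> A"
    then have "a = a \<oplus>\<^bsub>M\<^esub> \<zero>\<^bsub>M\<^esub>" using sm by simp
    then show "a \<in> A <+>\<^bsub>M\<^esub> B" using sm \<open>a \<in> A\<close> unfolding mem_set_add by blast
  qed
  show "B \<subseteq> A <+>\<^bsub>M\<^esub> B"
  proof
    fix b assume "b \<in> B"
    then have "b = \<zero>\<^bsub>M\<^esub> \<oplus>\<^bsub>M\<^esub> b" using sm by simp
    then show "b \<in> A <+>\<^bsub>M\<^esub> B" using sm \<open>b \<in> B\<close> unfolding mem_set_add by blast
  qed
qed

lemma set_add_mono: "A \<subseteq> A' \<Longrightarrow> B \<subseteq> B' \<Longrightarrow> A <+>\<^bsub>M\<^esub> B \<subseteq> A' <+>\<^bsub>M\<^esub> B'"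
  unfolding subset_iff mem_set_add by blast

lemma set_add_least: "submodule C R M \<Longrightarrow> A \<subseteq> C \<Longrightarrow> B \<subseteq> C \<Longrightarrow> A <+>\<^bsub>M\<^esub> B \<subseteq> C"
  using submoduleE(5)[of C] by (auto simp: mem_set_add subset_iff)

lemma submodule_zero_set: "submodule {\<zero>\<^bsub>M\<^esub>} R M"
  by (rule submoduleI) auto

lemma submodule_smult_set:
  assumes A: "submodule A R M" and x: "x \<in> carrier R"
  shows "submodule ((\<bullet>) x ` A) R M"
proof (rule submoduleI)
  note sm = submodule_carr[OF A] submoduleE[OF A] x
  show "(\<bullet>) x ` A \<subseteq> carrier M" using sm by auto
  show "\<zero>\<^bsub>M\<^esub> \<in> (\<bullet>) x ` A" using submodule_zero[OF A] x by (metis image_eqI smult_r_null)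
  show "\<ominus>\<^bsub>M\<^esub> v \<in> (\<bullet>) x ` A" if "v \<in> (\<bullet>) x ` A" for v
    using that sm by (force simp flip: smult_r_minus)
  show "v \<oplus>\<^bsub>M\<^esub> w \<in> (\<bullet>) x ` A" if "v \<in> (\<bullet>) x ` A" "w \<in> (\<bullet>) x ` A" for v w
    using that sm by (force simp flip: smult_r_distr)
  show "r \<bullet> v \<in> (\<bullet>) x ` A" if "r \<in> carrier R" "v \<in> (\<bullet>) x ` A" for r v
  proof -
    obtain w where w: "w \<in> A" "v = x \<bullet> w" using \<open>v \<in> _\<close> by blast
    then have "r \<bullet> v = x \<bullet> (r \<bullet> w)"
      using \<open>r \<in> _\<close> sm by (simp add: R.m_comm flip: smult_assoc1)
    then show ?thesis using w \<open>r \<in> _\<close> sm by blast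
  qed
qed

lemma submodule_vimage:
  assumes A: "submodule A R M" and x: "x \<in> carrier R"
  shows "submodule {v \<in> carrier M. x \<bullet> v \<in> A} R M"
proof (rule submoduleI)
  show "r \<bullet> v \<in> {v \<in> carrier M. x \<bullet> v \<in> A}"
    if "r \<in> carrier R" "v \<in> {v \<in> carrier M. x \<bullet> v \<in> A}" for r v
  proof -
    have "x \<bullet> (r \<bullet> v) = r \<bullet> (x \<bullet> v)"
      using that x by (simp add: R.m_comm flip: smult_assoc1)
    then show ?thesis using that submoduleE(4)[OF A] by simp
  qed
qed (use x submodule_zero[OF A] submoduleE(3,5)[OF A] in \<open>auto simp: smult_r_minus smult_r_distr\<close>)

lemma submodule_cyclic:
  assumes J: "ideal J R" and u: "u \<in> carrier M"
  shows "submodule ((\<lambda>r. r \<bullet> u) ` J) R M"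
proof (rule submoduleI)
  interpret J: ideal J R by fact
  show "(\<lambda>r. r \<bullet> u) ` J \<subseteq> carrier M" using u by auto
  show "\<zero>\<^bsub>M\<^esub> \<in> (\<lambda>r. r \<bullet> u) ` J" using u J.zero_closed by (metis image_eqI smult_l_null)
  show "\<ominus>\<^bsub>M\<^esub> v \<in> (\<lambda>r. r \<bullet> u) ` J" if "v \<in> (\<lambda>r. r \<bullet> u) ` J" for v
    using that u J.a_inv_closed J.Icarr by (force simp flip: smult_l_minus)
  show "v \<oplus>\<^bsub>M\<^esub> w \<in> (\<lambda>r. r \<bullet> u) ` J" if "v \<in> (\<lambda>r. r \<bullet> u) ` J" "w \<in> (\<lambda>r. r \<bullet> u) ` J" for v w
    using that u J.a_closed J.Icarr by (force simp flip: smult_l_distr)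
  show "r \<bullet> v \<in> (\<lambda>r. r \<bullet> u) ` J" if "r \<in> carrier R" "v \<in> (\<lambda>r. r \<bullet> u) ` J" for r v
    using that u J.I_l_closed J.Icarr by (force simp flip: smult_assoc1)
qed

lemma colon_ideal:
  assumes A: "submodule A R M" and u: "u \<in> carrier M"
  shows "ideal {r \<in> carrier R. r \<bullet> u \<in> A} R"
proof (rule idealI)
  show "ring R" by (rule R.ring_axioms)
  show "x \<otimes> a \<in> {r \<in> carrier R. r \<bullet> u \<in> A}"
    if "a \<in> {r \<in> carrier R. r \<bullet> u \<in> A}" "x \<in> carrier R" for a x
    using that u A by (simp add: smult_assoc1 submoduleE)
  then show "a \<otimes> x \<in> {r \<in> carrier R. r \<bullet> u \<in> A}"
    if "a \<in> {r \<in> carrier R. r \<bullet> u \<in> A}" "x \<in> carrier R" for a x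
    using that R.m_comm[of a x] by auto
  show "subgroup {r \<in> carrier R. r \<bullet> u \<in> A} (add_monoid R)"
    unfolding subgroup_def
    using u A by (auto simp: submodule_zero submoduleE smult_l_distr smult_l_minus simp flip: a_inv_def)
qed

end

section \<open>A graded basis theorem\<close>

text \<open>The diagonal is constant from some \<open>d\<close> on. For \<open>k > d\<close> the
  entries \<open>D k i\<close> with \<open>i \<ge> d\<close> are squeezed between
  \<open>D d d\<close> and a later diagonal entry, so only the finitely many rows
  \<open>k \<le> d\<close> need bounds of their own.\<close>

lemma acc_double:
  fixes D :: "nat \<Rightarrow> nat \<Rightarrow> 'x::order"
  assumes S: "acc S" and D: "\<And>k i. D k i \<in> S"
    and mono: "\<And>k k' i i'. k \<le> k' \<Longrightarrow> i \<le> i' \<Longrightarrow> D k i \<le> D k' i'"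
  shows "\<exists>i0. \<forall>k. \<forall>i\<ge>i0. D k i = D k i0"
proof -
  obtain d where d: "\<And>i. i \<ge> d \<Longrightarrow> D i i = D d d"
    using accD[OF S, of "\<lambda>i. D i i"] D mono unfolding mono_def by blast
  have "\<exists>i0. \<forall>i\<ge>i0. D k i = D k i0" for k
    using accD[OF S, of "\<lambda>i. D k i"] D mono unfolding mono_def by blast
  then obtain f where f: "\<And>k i. i \<ge> f k \<Longrightarrow> D k i = D k (f k)" by metis
  define i0 where "i0 = Max (insert d (f ` {..d}))"
  have i0: "d \<le> i0" "\<And>k. k \<le> d \<Longrightarrow> f k \<le> i0" unfolding i0_def
    by (simp, rule Max_ge) auto
  have "D k i = D k i0" if "i \<ge> i0" for k i
  proof (cases "k \<le> d")
    case True
    then show ?thesis using f[of k i] f[of k i0] i0(2)[of k] that by simp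
  next
    case False
    have "D k i' = D d d" if "i' \<ge> d" for i'
    proof (rule order.antisym)
      show "D k i' \<le> D d d" using mono[of k "max k i'" i' "max k i'"] d[of "max k i'"] False by simp
      show "D d d \<le> D k i'" using mono[of d k d i'] that False by simp
    qed
    from this[of i] this[of i0] show ?thesis using i0(1) that by simp
  qed
  then show ?thesis by blast
qed

context module begin

text \<open>Induction on the generators. Below \<open>S + Rx\<close>, a submodule \<open>N\<close>
  is recorded by \<open>N \<inter> S\<close> and by the ideal of all \<open>r\<close> with
  \<open>r \<bullet> x\<close> in \<open>N + S\<close>.\<close>

lemma acc_submodules_fin_gen:
  assumes "noetherian_ring R" and "fin_gen_module R M"
  shows "acc {N. submodule N R M}"
proof -
  interpret noetherian_ring R by fact
  have *: "\<exists>S. submodule S R M \<and> A \<subseteq> S \<and> acc {N. submodule N R M \<and> N \<subseteq> S}"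
    if "finite A" "A \<subseteq> carrier M" for A
    using that
  proof (induction A rule: finite_induct)
    case empty
    have "N = {\<zero>\<^bsub>M\<^esub>}" if "submodule N R M" "N \<subseteq> {\<zero>\<^bsub>M\<^esub>}" for N
      using submodule_zero[OF that(1)] that(2) by blast
    then have "acc {N. submodule N R M \<and> N \<subseteq> {\<zero>\<^bsub>M\<^esub>}}"
      unfolding acc_def by (metis (mono_tags, lifting) mem_Collect_eq)
    then show ?case using submodule_zero_set by blast
  next
    case (insert x A)
    then obtain S where S: "submodule S R M" "A \<subseteq> S" "acc {N. submodule N R M \<and> N \<subseteq> S}" by auto
    have x: "x \<in> carrier M" using insert by simp
    define X where "X = cyclic x"
    have X: "submodule X R M" unfolding X_def by (rule submodule_cyclic[OF R.oneideal x])
    have xX: "x \<in> X" unfolding X_def by (rule image_eqI[of _ _ \<one>]) (use x in simp_all)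
    have "acc {N. submodule N R M \<and> N \<subseteq> S <+>\<^bsub>M\<^esub> X}"
    proof (rule acc_map2[OF S(3) acc_ideals, where f="\<lambda>N. N \<inter> S"
          and g="\<lambda>N. {r \<in> carrier R. r \<bullet> x \<in> N <+>\<^bsub>M\<^esub> S}"])
      fix N N' assume N: "N \<in> {N. submodule N R M \<and> N \<subseteq> S <+>\<^bsub>M\<^esub> X}"
        and N': "N' \<in> {N. submodule N R M \<and> N \<subseteq> S <+>\<^bsub>M\<^esub> X}" and le: "N \<subseteq> N'"
        and f: "N \<inter> S = N' \<inter> S"
        and g: "{r \<in> carrier R. r \<bullet> x \<in> N <+>\<^bsub>M\<^esub> S} = {r \<in> carrier R. r \<bullet> x \<in> N' <+>\<^bsub>M\<^esub> S}"
      have N1: "submodule N R M" and N1': "submodule N' R M" using N N' by auto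
      have "v \<in> N" if v: "v \<in> N'" for v
      proof -
        obtain s r where s: "s \<in> S" and r: "r \<in> carrier R" and vsr: "v = s \<oplus>\<^bsub>M\<^esub> r \<bullet> x"
          using v N' unfolding X_def mem_set_add by (auto simp: subset_iff mem_set_add)
        have c: "s \<in> carrier M" "r \<bullet> x \<in> carrier M" using s r x submodule_carr[OF S(1)] by auto
        have sum': "submodule (N' <+>\<^bsub>M\<^esub> S) R M" by (rule submodule_set_add[OF N1' S(1)])
        have "r \<bullet> x \<in> N' <+>\<^bsub>M\<^esub> S"
          by (rule submodule_cancel[OF sum' _ _ c(2), of s])
            (use subset_set_add[OF N1' S(1)] s v vsr in auto)
        then have "r \<bullet> x \<in> N <+>\<^bsub>M\<^esub> S" using g r by blast
        then obtain n t where n: "n \<in> N" "t \<in> S" "r \<bullet> x = n \<oplus>\<^bsub>M\<^esub> t" unfolding mem_set_add by blast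
        have nt: "n \<in> carrier M" "t \<in> carrier M" using n submodule_carr N1 S(1) by blast+
        \<comment> \<open>Modulo \<open>S\<close> the summand \<open>r \<bullet> x\<close> of
          \<open>v\<close> is the element \<open>n\<close> of \<open>N\<close>. The remainder
          \<open>s + t\<close> lies in \<open>S\<close> and in \<open>N'\<close>, where the two
          intersections agree.\<close>
        have v': "v = n \<oplus>\<^bsub>M\<^esub> (s \<oplus>\<^bsub>M\<^esub> t)" using vsr n(3) c nt by (simp add: M.a_ac)
        have "s \<oplus>\<^bsub>M\<^esub> t \<in> N'"
          by (rule submodule_cancel[OF N1', of n]) (use n le v v' c nt in auto)
        moreover have "s \<oplus>\<^bsub>M\<^esub> t \<in> S" using submoduleE(5)[OF S(1)] s n by blast
        ultimately have "s \<oplus>\<^bsub>M\<^esub> t \<in> N" using f by blast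
        then show ?thesis using v' n(1) submoduleE(5)[OF N1] by blast
      qed
      then show "N = N'" using le by blast
    next
      fix N N' assume "N \<in> {N. submodule N R M \<and> N \<subseteq> S <+>\<^bsub>M\<^esub> X}" "N \<subseteq> N'"
      then show "{r \<in> carrier R. r \<bullet> x \<in> N <+>\<^bsub>M\<^esub> S} \<subseteq> {r \<in> carrier R. r \<bullet> x \<in> N' <+>\<^bsub>M\<^esub> S}"
        by (auto simp: mem_set_add)
    qed (auto intro: submodule_Int colon_ideal submodule_set_add x S(1))
    moreover have "insert x A \<subseteq> S <+>\<^bsub>M\<^esub> X" using subset_set_add[OF S(1) X] S(2) xX by blast
    ultimately show ?case using submodule_set_add[OF S(1) X] by blast
  qed
  obtain A where A: "A \<subseteq> carrier M" "finite A" "\<Inter> {N. submodule N R M \<and> A \<subseteq> N} = carrier M"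
    using assms(2) unfolding fin_gen_module_def by blast
  obtain S where S: "submodule S R M" "A \<subseteq> S" "acc {N. submodule N R M \<and> N \<subseteq> S}"
    using *[OF A(2,1)] by blast
  have "carrier M \<subseteq> S" using A(3) S by blast
  then have "{N. submodule N R M} \<subseteq> {N. submodule N R M \<and> N \<subseteq> S}"
    using submoduleE(1) by blast
  then show ?thesis using acc_mono[OF S(3)] by blast
qed

text \<open>
  The sequence \<open>L\<close> stands for a graded submodule of the direct sum of copies of \<open>M\<close>, on which the
  elements of \<open>X\<close> act with degree one.
\<close>
definition graded :: "'a set \<Rightarrow> (nat \<Rightarrow> 'c set) \<Rightarrow> bool" where
  "graded X L \<longleftrightarrow> (\<forall>n. submodule (L n) R M) \<and> (\<forall>n. \<forall>a\<in>X. \<forall>v\<in>L n. a \<bullet> v \<in> L (Suc n))"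

text \<open>The degree \<open>n\<close> part of the sum of the \<open>y\<^sup>i N\<close> over \<open>i < k\<close>, where \<open>y\<close> has degree one.\<close>
primrec partial_adjoin :: "'a \<Rightarrow> (nat \<Rightarrow> 'c set) \<Rightarrow> nat \<Rightarrow> nat \<Rightarrow> 'c set" where
  "partial_adjoin y N 0 n = {\<zero>\<^bsub>M\<^esub>}"
| "partial_adjoin y N (Suc k) n =
     partial_adjoin y N k n <+>\<^bsub>M\<^esub> (if k \<le> n then (\<bullet>) (y [^] k) ` N (n - k) else {\<zero>\<^bsub>M\<^esub>})"

end

section \<open>Adjoining one operator of degree one\<close>

locale graded_extension = module +
  fixes X :: "'a set" and y :: 'a and N :: "nat \<Rightarrow> 'c set"
  assumes X: "X \<subseteq> carrier R" and y: "y \<in> carrier R" and N: "graded X N"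
begin

abbreviation W where "W \<equiv> partial_adjoin y N"

lemma N_sub: "submodule (N n) R M" using N unfolding graded_def by blast

lemma y_pow: "y [^] (k::nat) \<in> carrier R" using y by simp

lemma W_sub: "submodule (W k n) R M"
  by (induction k) (auto intro: submodule_zero_set submodule_set_add submodule_smult_set N_sub y_pow)

lemma W_Suc: "W k n \<subseteq> W (Suc k) n"
  unfolding partial_adjoin.simps
  by (rule subset_set_add(1)[OF W_sub]) (auto intro: submodule_zero_set submodule_smult_set N_sub y_pow)

lemma W_le: "k \<le> k' \<Longrightarrow> W k n \<subseteq> W k' n"
  using W_Suc lift_Suc_mono_le[of "\<lambda>k. W k n"] by blast

lemma W_SucE:
  assumes "v \<in> W (Suc k) n"
  obtains "v \<in> W k n" | w u where "k \<le> n" "w \<in> W k n" "u \<in> N (n - k)" "v = w \<oplus>\<^bsub>M\<^esub> (y [^] k) \<bullet> u"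
proof (cases "k \<le> n")
  case True
  then show ?thesis using assms that(2) by (auto simp: mem_set_add)
next
  case False
  then show ?thesis using assms that(1) submodule_carr[OF W_sub] by (auto simp: mem_set_add)
qed

lemma W_SucI: "k \<le> n \<Longrightarrow> w \<in> W k n \<Longrightarrow> u \<in> N (n - k) \<Longrightarrow> w \<oplus>\<^bsub>M\<^esub> (y [^] k) \<bullet> u \<in> W (Suc k) n"
  by (auto simp: mem_set_add)

lemma W_X: "a \<in> X \<Longrightarrow> v \<in> W k n \<Longrightarrow> a \<bullet> v \<in> W k (Suc n)"
proof (induction k arbitrary: v)
  case 0
  then show ?case using X by auto
next
  case (Suc k)
  have a: "a \<in> carrier R" using Suc.prems X by blast
  from Suc.prems(2) show ?case
  proof (cases rule: W_SucE)
    case 1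
    then show ?thesis using Suc W_Suc by blast
  next
    case (2 w u)
    have c: "w \<in> carrier M" "u \<in> carrier M" using 2 W_sub N_sub submodule_carr by blast+
    have "a \<bullet> v = a \<bullet> w \<oplus>\<^bsub>M\<^esub> (y [^] k) \<bullet> (a \<bullet> u)"
      using c a y_pow 2(4) by (simp add: smult_r_distr R.m_comm flip: smult_assoc1)
    moreover have "a \<bullet> u \<in> N (Suc n - k)"
      using N 2 Suc.prems(1) unfolding graded_def by (metis Suc_diff_le)
    ultimately show ?thesis using W_SucI[of k "Suc n" "a \<bullet> w"] 2 Suc by auto
  qed
qed

lemma W_y: "v \<in> W k n \<Longrightarrow> y \<bullet> v \<in> W (Suc k) (Suc n)"
proof (induction k arbitrary: v)
  case 0
  then have "y \<bullet> v = \<zero>\<^bsub>M\<^esub>" using y by simp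
  then show ?case using submodule_zero[OF W_sub] by metis
next
  case (Suc k)
  from Suc.prems show ?case
  proof (cases rule: W_SucE)
    case 1
    then show ?thesis using Suc W_Suc by blast
  next
    case (2 w u)
    have c: "w \<in> carrier M" "u \<in> carrier M" using 2 W_sub N_sub submodule_carr by blast+
    have "y \<bullet> v = y \<bullet> w \<oplus>\<^bsub>M\<^esub> (y [^] Suc k) \<bullet> u"
      using c y y_pow 2(4) by (simp add: smult_r_distr R.m_comm flip: smult_assoc1)
    moreover have "y \<bullet> w \<in> W (Suc k) (Suc n)" using Suc.IH 2 by blast
    ultimately show ?thesis using W_SucI[of "Suc k" "Suc n" "y \<bullet> w" u] 2 by simp
  qed
qed

lemma N_subset_W: "N n \<subseteq> W (Suc 0) n"
proof
  fix v assume v: "v \<in> N n"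
  then have "v = \<zero>\<^bsub>M\<^esub> \<oplus>\<^bsub>M\<^esub> (y [^] (0::nat)) \<bullet> v" using submodule_carr[OF N_sub] by simp
  moreover have "\<zero>\<^bsub>M\<^esub> \<oplus>\<^bsub>M\<^esub> (y [^] (0::nat)) \<bullet> v \<in> W (Suc 0) n"
    by (rule W_SucI) (use v in auto)
  ultimately show "v \<in> W (Suc 0) n" by metis
qed

definition adjoin :: "nat \<Rightarrow> 'c set" where "adjoin n = (\<Union>k. W k n)"

lemma adjoin_graded: "graded (insert y X) adjoin"
  unfolding graded_def
proof (intro conjI allI ballI)
  show "submodule (adjoin n) R M" for n
  proof (rule submoduleI)
    fix v w assume "v \<in> adjoin n" "w \<in> adjoin n"
    then obtain k k' where "v \<in> W k n" "w \<in> W k' n" unfolding adjoin_def by blast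
    then have "v \<in> W (max k k') n" "w \<in> W (max k k') n"
      using W_le[of k "max k k'"] W_le[of k' "max k k'"] by auto
    then show "v \<oplus>\<^bsub>M\<^esub> w \<in> adjoin n" using submoduleE(5)[OF W_sub] unfolding adjoin_def by blast
  next
    show "\<zero>\<^bsub>M\<^esub> \<in> adjoin n" using submodule_zero[OF W_sub] unfolding adjoin_def by blast
    show "adjoin n \<subseteq> carrier M" using submodule_carr[OF W_sub] unfolding adjoin_def by blast
    show "\<ominus>\<^bsub>M\<^esub> v \<in> adjoin n" if "v \<in> adjoin n" for v
      using that submoduleE(3)[OF W_sub] unfolding adjoin_def by blast
    show "r \<bullet> v \<in> adjoin n" if "r \<in> carrier R" "v \<in> adjoin n" for r v
      using that submoduleE(4)[OF W_sub] unfolding adjoin_def by blast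
  qed
  show "a \<bullet> v \<in> adjoin (Suc n)" if "a \<in> insert y X" "v \<in> adjoin n" for n a v
  proof -
    obtain k where "v \<in> W k n" using \<open>v \<in> _\<close> unfolding adjoin_def by blast
    then show ?thesis using W_X[of a v k n] W_y[of v k n] \<open>a \<in> _\<close> unfolding adjoin_def by blast
  qed
qed

lemma N_le_adjoin: "N \<le> adjoin"
  using N_subset_W unfolding adjoin_def le_fun_def by blast

text \<open>
  Leading coefficients as in Hilbert's basis theorem. The powers of \<open>y\<close> need not be independent:
  an element of \<open>L\<close> can be reduced by any other one with the same leading coefficient.
\<close>
definition lead :: "nat \<Rightarrow> (nat \<Rightarrow> 'c set) \<Rightarrow> nat \<Rightarrow> 'c set" where
  "lead k L j = {u \<in> N j. (y [^] k) \<bullet> u \<in> L (j + k) <+>\<^bsub>M\<^esub> W k (j + k)}"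

lemma lead_mono: "L \<le> L' \<Longrightarrow> lead k L \<le> lead k L'"
  unfolding lead_def le_fun_def mem_set_add by blast

text \<open>Multiplication by \<open>y\<close> raises the power of \<open>y\<close> and the degree
  by one and keeps the leading coefficient. With \<open>lead_mono\<close> this is the monotonicity
  in both indices that \<open>acc_double\<close> asks for.\<close>

lemma lead_Suc:
  assumes L: "graded (insert y X) L"
  shows "lead k L \<le> lead (Suc k) L"
proof (rule le_funI, rule subsetI)
  fix j u assume "u \<in> lead k L j"
  then obtain l w where u: "u \<in> N j" and l: "l \<in> L (j + k)" and w: "w \<in> W k (j + k)"
    and eq: "(y [^] k) \<bullet> u = l \<oplus>\<^bsub>M\<^esub> w" unfolding lead_def mem_set_add by blast
  have Ls: "submodule (L n) R M" for n using L unfolding graded_def by blast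
  have c: "l \<in> carrier M" "w \<in> carrier M" "u \<in> carrier M"
    using l w u Ls W_sub N_sub submodule_carr by blast+
  have "(y [^] Suc k) \<bullet> u = y \<bullet> ((y [^] k) \<bullet> u)"
    using c y y_pow by (simp add: R.m_comm flip: smult_assoc1)
  also have "\<dots> = y \<bullet> l \<oplus>\<^bsub>M\<^esub> y \<bullet> w" using eq c y by (simp add: smult_r_distr)
  finally have "(y [^] Suc k) \<bullet> u = y \<bullet> l \<oplus>\<^bsub>M\<^esub> y \<bullet> w" .
  moreover have "y \<bullet> l \<in> L (Suc (j + k))" using L l unfolding graded_def by blast
  ultimately show "u \<in> lead (Suc k) L j"
    using u W_y[OF w] unfolding lead_def mem_set_add by auto
qed

lemma lead_graded:
  assumes L: "graded (insert y X) L"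
  shows "graded X (lead k L)" and "lead k L \<le> N"
proof -
  have Ls: "submodule (L n <+>\<^bsub>M\<^esub> W k n) R M" for n
    using L W_sub submodule_set_add unfolding graded_def by blast
  show "graded X (lead k L)" unfolding graded_def
  proof (intro conjI allI ballI)
    show "submodule (lead k L j) R M" for j
    proof -
      have "lead k L j = N j \<inter> {v \<in> carrier M. (y [^] k) \<bullet> v \<in> L (j + k) <+>\<^bsub>M\<^esub> W k (j + k)}"
        using submodule_carr[OF N_sub] unfolding lead_def by blast
      then show ?thesis using submodule_Int[OF N_sub submodule_vimage[OF Ls y_pow]] by simp
    qed
    show "a \<bullet> u \<in> lead k L (Suc j)" if a: "a \<in> X" and u: "u \<in> lead k L j" for j a u
    proof -
      obtain l w where lw: "u \<in> N j" "l \<in> L (j + k)" "w \<in> W k (j + k)"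
        and eq: "(y [^] k) \<bullet> u = l \<oplus>\<^bsub>M\<^esub> w" using u unfolding lead_def mem_set_add by blast
      have c: "l \<in> carrier M" "w \<in> carrier M" "u \<in> carrier M" "a \<in> carrier R"
        using lw L W_sub N_sub submodule_carr a X unfolding graded_def by blast+
      have "(y [^] k) \<bullet> (a \<bullet> u) = a \<bullet> ((y [^] k) \<bullet> u)"
        using c y_pow by (simp add: R.m_comm flip: smult_assoc1)
      also have "\<dots> = a \<bullet> l \<oplus>\<^bsub>M\<^esub> a \<bullet> w" using eq c by (simp add: smult_r_distr)
      finally have "(y [^] k) \<bullet> (a \<bullet> u) = a \<bullet> l \<oplus>\<^bsub>M\<^esub> a \<bullet> w" .
      moreover have "a \<bullet> l \<in> L (Suc (j + k))" "a \<bullet> u \<in> N (Suc j)"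
        using L N lw a unfolding graded_def by blast+
      ultimately show ?thesis
        using W_X[OF a lw(3)] unfolding lead_def mem_set_add by auto
    qed
  qed
  show "lead k L \<le> N" unfolding lead_def le_fun_def by blast
qed

text \<open>Induction on the power of \<open>y\<close>: an element \<open>v\<close> of
  \<open>L'\<close> in \<open>W (Suc k) n\<close> shares its leading coefficient with some
  \<open>l\<close> in \<open>L\<close>, and \<open>v - l\<close> is an element of \<open>L'\<close>
  in \<open>W k n\<close>.\<close>

lemma lead_inj:
  assumes L: "graded (insert y X) L" and L': "graded (insert y X) L'"
    and le: "L \<le> L'" and bound: "L' \<le> adjoin" and eq: "\<And>k. lead k L = lead k L'"
  shows "L = L'"
proof -
  have Ls: "submodule (L n) R M" and Ls': "submodule (L' n) R M" for n
    using L L' unfolding graded_def by blast+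
  have "L' n \<inter> W k n \<subseteq> L n" for k n
  proof (induction k)
    case 0
    then show ?case using submodule_zero[OF Ls] by auto
  next
    case (Suc k)
    have "v \<in> L n" if v: "v \<in> L' n" and vW: "v \<in> W (Suc k) n" for v
      using vW
    proof (cases rule: W_SucE)
      case 1
      then show ?thesis using Suc v by blast
    next
      case (2 w u)
      have c: "w \<in> carrier M" "u \<in> carrier M" "(y [^] k) \<bullet> u \<in> carrier M"
        using 2 W_sub N_sub submodule_carr y_pow by blast+
      \<comment> \<open>Modulo \<open>W k n\<close> the leading term of \<open>v\<close> is
        \<open>v\<close> itself, which makes \<open>u\<close> a leading coefficient of
        \<open>L'\<close>.\<close>
      have "(y [^] k) \<bullet> u = v \<oplus>\<^bsub>M\<^esub> \<ominus>\<^bsub>M\<^esub> w"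
        using 2(4) c by (simp add: M.a_ac M.r_neg M.r_neg2)
      then have "(y [^] k) \<bullet> u \<in> L' n <+>\<^bsub>M\<^esub> W k n"
        using v submoduleE(3)[OF W_sub 2(2)] unfolding mem_set_add by blast
      then have "u \<in> lead k L' (n - k)" unfolding lead_def using 2 by simp
      then have "u \<in> lead k L (n - k)" using eq by simp
      then obtain l w' where lw: "l \<in> L n" "w' \<in> W k n" "(y [^] k) \<bullet> u = l \<oplus>\<^bsub>M\<^esub> w'"
        unfolding lead_def using 2(1) by (auto simp: mem_set_add)
      have c': "l \<in> carrier M" "w' \<in> carrier M" using lw Ls W_sub submodule_carr by blast+
      have veq: "v = l \<oplus>\<^bsub>M\<^esub> (w \<oplus>\<^bsub>M\<^esub> w')" using 2(4) lw(3) c c' by (simp add: M.a_ac)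
      have "w \<oplus>\<^bsub>M\<^esub> w' \<in> L' n"
        by (rule submodule_cancel[OF Ls', of l]) (use lw le v veq c c' in \<open>auto simp: le_fun_def\<close>)
      moreover have "w \<oplus>\<^bsub>M\<^esub> w' \<in> W k n" using submoduleE(5)[OF W_sub] 2 lw by blast
      ultimately have "w \<oplus>\<^bsub>M\<^esub> w' \<in> L n" using Suc by blast
      then show ?thesis using veq lw(1) submoduleE(5)[OF Ls] by blast
    qed
    then show ?case by blast
  qed
  then have "L' n \<subseteq> L n" for n using bound unfolding adjoin_def le_fun_def by blast
  then show ?thesis using le by (intro order.antisym) (auto simp: le_fun_def)
qed

lemma acc_adjoin:
  assumes acc: "acc {L. graded X L \<and> L \<le> N}"
  shows "acc {L. graded (insert y X) L \<and> L \<le> adjoin}"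
  unfolding acc_def
proof (intro allI impI)
  fix C assume C: "\<forall>i::nat. C i \<in> {L. graded (insert y X) L \<and> L \<le> adjoin}" and mono: "mono C"
  have g: "graded (insert y X) (C i)" "C i \<le> adjoin" for i using C by blast+
  have "\<exists>i0. \<forall>k. \<forall>i\<ge>i0. lead k (C i) = lead k (C i0)"
  proof (rule acc_double[OF acc])
    show "lead k (C i) \<in> {L. graded X L \<and> L \<le> N}" for k i using lead_graded[OF g(1)] by blast
    show "lead k (C i) \<le> lead k' (C i')" if "k \<le> k'" "i \<le> i'" for k k' i i'
    proof -
      have "lead k (C i) \<le> lead k' (C i)"
        by (rule lift_Suc_mono_le[of "\<lambda>k. lead k (C i)", OF lead_Suc[OF g(1)] that(1)])
      then show ?thesis using lead_mono[OF monoD[OF mono that(2)]] order_trans by blast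
    qed
  qed
  then obtain i0 where i0: "\<And>k i. i \<ge> i0 \<Longrightarrow> lead k (C i) = lead k (C i0)" by blast
  have "C i = C i0" if "i \<ge> i0" for i
    using lead_inj[OF g(1) g(1) monoD[OF mono that] g(2)] i0[OF that] by metis
  then show "\<exists>i0. \<forall>i\<ge>i0. C i = C i0" by blast
qed

end

section \<open>The chain condition for the filtration\<close>

context module begin

text \<open>The family \<open>E\<close> is generated by copies of \<open>M\<close> in the degrees up
  to \<open>c\<close>. Without operators it is a sum of \<open>c + 1\<close> copies of
  \<open>M\<close>, and then the elements of \<open>X\<close> are adjoined one by one.\<close>

lemma acc_graded_finite:
  assumes acc: "acc {N. submodule N R M}" and X: "finite X" "X \<subseteq> carrier R"
  shows "\<exists>E. graded X E \<and> (\<forall>n\<le>c. carrier M \<subseteq> E n) \<and> acc {L. graded X L \<and> L \<le> E}"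
  using X
proof (induction X rule: finite_induct)
  case empty
  define E where "E n = (if n \<le> c then carrier M else {\<zero>\<^bsub>M\<^esub>})" for n
  have "acc {L. graded {} L \<and> L \<le> E}" unfolding acc_def
  proof (intro allI impI)
    fix C assume C: "\<forall>i::nat. C i \<in> {L. graded {} L \<and> L \<le> E}" and mono: "mono C"
    have Cs: "submodule (C i n) R M" "C i n \<subseteq> E n" for i n using C unfolding graded_def le_fun_def by blast+
    have "\<exists>i0. \<forall>i\<ge>i0. C i n = C i0 n" for n
      using accD[OF acc, of "\<lambda>i. C i n"] Cs mono unfolding mono_def le_fun_def by blast
    then obtain f where f: "\<And>n i. i \<ge> f n \<Longrightarrow> C i n = C (f n) n" by metis
    define i0 where "i0 = Max (f ` {..c})"
    have i0: "f n \<le> i0" if "n \<le> c" for n unfolding i0_def using that by auto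
    have "C i n = C i0 n" if "i \<ge> i0" for i n
    proof (cases "n \<le> c")
      case True
      then show ?thesis using f[of n i] f[of n i0] i0[of n] that by simp
    next
      case False
      then have "C i n = {\<zero>\<^bsub>M\<^esub>}" for i using Cs[of i n] submodule_zero unfolding E_def by auto
      then show ?thesis by simp
    qed
    then show "\<exists>i0. \<forall>i\<ge>i0. C i = C i0" by (metis HOL.ext)
  qed
  moreover have "graded {} E" unfolding graded_def E_def
    using carrier_is_submodule submodule_zero_set by simp
  ultimately show ?case unfolding E_def by force
next
  case (insert y X)
  then obtain E where E: "graded X E" "\<forall>n\<le>c. carrier M \<subseteq> E n" "acc {L. graded X L \<and> L \<le> E}" by auto
  interpret graded_extension R M X y E
    by unfold_locales (use insert E in auto)
  show ?case using adjoin_graded acc_adjoin[OF E(3)] N_le_adjoin E(2) unfolding le_fun_def by blast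
qed

text \<open>The assumption \<open>stable\<close> says that \<open>I\<close> times
  \<open>Mn n\<close> generates \<open>Mn (Suc n)\<close> for \<open>n \<ge> c\<close>; quantifying
  over \<open>K\<close> avoids forming the product. Hence \<open>Mn\<close> lies below the family
  generated in degrees up to \<open>c\<close> by finitely many generators of \<open>I\<close>, and
  inherits its chain condition.\<close>

lemma acc_filtration:
  assumes R: "noetherian_ring R" and acc: "acc {N. submodule N R M}" and I: "ideal I R"
    and Mn: "\<And>n. Mn n \<subseteq> carrier M"
    and stable: "\<And>n K. n \<ge> c \<Longrightarrow> submodule K R M \<Longrightarrow> (\<And>a v. a \<in> I \<Longrightarrow> v \<in> Mn n \<Longrightarrow> a \<bullet> v \<in> K)
      \<Longrightarrow> Mn (Suc n) \<subseteq> K"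
  shows "acc {L. graded I L \<and> L \<le> Mn}"
proof -
  obtain X where X: "X \<subseteq> carrier R" "finite X" "I = Idl X"
    using noetherian_ring.finetely_gen[OF R I] by blast
  have XI: "X \<subseteq> I" using X R.genideal_self by simp
  obtain E where E: "graded X E" "\<And>n. n \<le> c \<Longrightarrow> carrier M \<subseteq> E n" "acc {L. graded X L \<and> L \<le> E}"
    using acc_graded_finite[OF acc X(2,1), of c] by blast
  have Es: "submodule (E n) R M" for n using E(1) unfolding graded_def by blast
  have "Mn n \<subseteq> E n" for n
  proof (induction n)
    case 0
    then show ?case using Mn E(2) by blast
  next
    case (Suc n)
    show ?case
    proof (cases "Suc n \<le> c")
      case True
      then show ?thesis using Mn E(2) by blast
    next
      case False
      show ?thesis
      proof (rule stable[OF _ Es])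
        fix a v assume a: "a \<in> I" and v: "v \<in> Mn n"
        have "ideal {r \<in> carrier R. r \<bullet> v \<in> E (Suc n)} R"
          using colon_ideal[OF Es] v Mn by blast
        moreover have "X \<subseteq> {r \<in> carrier R. r \<bullet> v \<in> E (Suc n)}"
          using E(1) Suc v X(1) unfolding graded_def by blast
        ultimately show "a \<bullet> v \<in> E (Suc n)" using a X(3) R.genideal_minimal by blast
      qed (use False in simp)
    qed
  qed
  then have "Mn \<le> E" by (simp add: le_funI)
  then show ?thesis
    using XI by (intro acc_mono[OF E(3)]) (auto simp: graded_def intro: order_trans)
qed

end

section \<open>Chains with prime quotients\<close>

context module begin

text \<open>A quotient \<open>B/A\<close> isomorphic to \<open>R/P\<close>, expressed through a generator modulo \<open>A\<close>.\<close>
definition prime_step :: "'c set \<Rightarrow> 'c set \<Rightarrow> 'a set \<Rightarrow> bool" where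
  "prime_step A B P \<longleftrightarrow> submodule A R M \<and> primeideal P R \<and>
     (\<exists>u\<in>carrier M. B = A <+>\<^bsub>M\<^esub> cyclic u \<and> P = {r \<in> carrier R. r \<bullet> u \<in> A})"

inductive prime_chain :: "'c set \<Rightarrow> 'c set \<Rightarrow> 'a set list \<Rightarrow> bool" where
  Nil: "submodule A R M \<Longrightarrow> prime_chain A A []"
| Cons: "prime_step A B P \<Longrightarrow> prime_chain B C Ps \<Longrightarrow> prime_chain A C (P # Ps)"

lemma cyclic_generator: "u \<in> carrier M \<Longrightarrow> u \<in> cyclic u"
  by (rule image_eqI[of _ _ \<one>]) simp_all

lemma prime_step_submodule:
  assumes "prime_step A B P"
  shows "submodule A R M" "submodule B R M" "A \<subset> B" "primeideal P R"
proof -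
  obtain u where A: "submodule A R M" and P: "primeideal P R" and u: "u \<in> carrier M"
    and B: "B = A <+>\<^bsub>M\<^esub> cyclic u" and Pu: "P = {r \<in> carrier R. r \<bullet> u \<in> A}"
    using assms unfolding prime_step_def by blast
  have c: "submodule (cyclic u) R M" by (rule submodule_cyclic[OF R.oneideal u])
  show "submodule A R M" "primeideal P R" by fact+
  show "submodule B R M" unfolding B by (rule submodule_set_add[OF A c])
  have "u \<in> B" using subset_set_add(2)[OF A c] cyclic_generator[OF u] unfolding B by blast
  moreover have "u \<notin> A"
  proof
    assume "u \<in> A"
    then have "P = carrier R" using submoduleE(4)[OF A] unfolding Pu by blast
    then show False using primeideal.I_notcarr[OF P] by simp
  qed
  ultimately show "A \<subset> B" using subset_set_add(1)[OF A c] unfolding B by blast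
qed

lemma prime_chain_submodule:
  assumes "prime_chain A B Ps"
  shows "submodule A R M \<and> submodule B R M \<and> A \<subseteq> B"
  using assms by (induction rule: prime_chain.induct) (use prime_step_submodule in blast)+

lemma prime_chain_append:
  "prime_chain A B Ps \<Longrightarrow> prime_chain B C Qs \<Longrightarrow> prime_chain A C (Ps @ Qs)"
  by (induction rule: prime_chain.induct) (auto intro: prime_chain.Cons)

text \<open>Each \<open>R/P\<close> is a subquotient of \<open>B/A\<close>, so a scalar that
  annihilates \<open>B/A\<close> lies in \<open>P\<close>. This makes the primes grow in the main
  induction and bounds them below by the annihilator of \<open>M\<close>.\<close>

lemma prime_chain_primes:
  assumes "prime_chain A B Ps" "P \<in> set Ps"
  shows "primeideal P R \<and> (\<forall>r\<in>carrier R. (\<forall>v\<in>B. r \<bullet> v \<in> A) \<longrightarrow> r \<in> P)"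
  using assms
proof (induction rule: prime_chain.induct)
  case (Cons A B Q C Ps)
  have AB: "A \<subset> B" and BC: "B \<subseteq> C" and B: "submodule B R M"
    using prime_step_submodule[OF Cons.hyps(1)] prime_chain_submodule[OF Cons.hyps(2)] by blast+
  show ?case
  proof (cases "P \<in> set Ps")
    case True
    then show ?thesis using Cons.IH AB by blast
  next
    case False
    then have PQ: "P = Q" using Cons.prems by simp
    obtain u where A: "submodule A R M" and u: "u \<in> carrier M"
      and Bu: "B = A <+>\<^bsub>M\<^esub> cyclic u" and Pu: "Q = {r \<in> carrier R. r \<bullet> u \<in> A}"
      using Cons.hyps(1) unfolding prime_step_def by blast
    have "u \<in> B" unfolding Bu
      using subset_set_add(2)[OF A submodule_cyclic[OF R.oneideal u]] cyclic_generator[OF u] by blast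
    then show ?thesis using BC prime_step_submodule(4)[OF Cons.hyps(1)] unfolding PQ Pu by blast
  qed
qed simp

text \<open>Multiplication by \<open>x\<close> maps \<open>B/A\<close> onto
  \<open>(xB + D)/(xA + D)\<close>, and the last assumption makes this injective. A superficial
  \<open>x\<close> gives the recursion in \<open>n\<close>; \<open>x = \<one>\<close> gives the
  second isomorphism theorem, by which chains are spliced.\<close>

lemma prime_chain_transport:
  assumes "prime_chain A B Ps" and x: "x \<in> carrier R" and D: "submodule D R M"
    and "\<And>v. v \<in> B \<Longrightarrow> x \<bullet> v \<in> D \<Longrightarrow> v \<in> A"
  shows "prime_chain ((\<bullet>) x ` A <+>\<^bsub>M\<^esub> D) ((\<bullet>) x ` B <+>\<^bsub>M\<^esub> D) Ps"
  using assms(1,4)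
proof (induction rule: prime_chain.induct)
  case (Nil A)
  then show ?case using prime_chain.Nil submodule_set_add submodule_smult_set D x by blast
next
  case (Cons A B P C Ps)
  have AB: "A \<subset> B" and B: "submodule B R M" and BC: "B \<subseteq> C"
    using prime_step_submodule[OF Cons.hyps(1)] prime_chain_submodule[OF Cons.hyps(2)] by blast+
  obtain u where A: "submodule A R M" and P: "primeideal P R" and u: "u \<in> carrier M"
    and Bu: "B = A <+>\<^bsub>M\<^esub> cyclic u" and Pu: "P = {r \<in> carrier R. r \<bullet> u \<in> A}"
    using Cons.hyps(1) unfolding prime_step_def by blast
  have uB: "u \<in> B" unfolding Bu
      using subset_set_add(2)[OF A submodule_cyclic[OF R.oneideal u]] cyclic_generator[OF u] by blast
  have xA: "submodule ((\<bullet>) x ` A) R M" by (rule submodule_smult_set[OF A x])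
  have AD: "submodule ((\<bullet>) x ` A <+>\<^bsub>M\<^esub> D) R M" by (rule submodule_set_add[OF xA D])
  have eq: "r \<bullet> (x \<bullet> u) = x \<bullet> (r \<bullet> u)" if "r \<in> carrier R" for r
    using that x u by (simp add: R.m_comm flip: smult_assoc1)
  have "prime_step ((\<bullet>) x ` A <+>\<^bsub>M\<^esub> D) ((\<bullet>) x ` B <+>\<^bsub>M\<^esub> D) P"
    unfolding prime_step_def
  proof (intro conjI bexI)
    show "x \<bullet> u \<in> carrier M" using x u by simp
    show "(\<bullet>) x ` B <+>\<^bsub>M\<^esub> D = ((\<bullet>) x ` A <+>\<^bsub>M\<^esub> D) <+>\<^bsub>M\<^esub> cyclic (x \<bullet> u)"
    proof (rule equalityI; rule subsetI)
      fix v assume "v \<in> (\<bullet>) x ` B <+>\<^bsub>M\<^esub> D"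
      then obtain b d where b: "b \<in> B" "d \<in> D" "v = x \<bullet> b \<oplus>\<^bsub>M\<^esub> d" unfolding mem_set_add by blast
      then obtain a r where a: "a \<in> A" "r \<in> carrier R" "b = a \<oplus>\<^bsub>M\<^esub> r \<bullet> u" unfolding Bu mem_set_add by blast
      have c: "a \<in> carrier M" "d \<in> carrier M" using a b submodule_carr A D by blast+
      have "v = (x \<bullet> a \<oplus>\<^bsub>M\<^esub> d) \<oplus>\<^bsub>M\<^esub> r \<bullet> (x \<bullet> u)"
        using a b c x u by (simp add: eq smult_r_distr M.a_ac)
      moreover have "x \<bullet> a \<oplus>\<^bsub>M\<^esub> d \<in> (\<bullet>) x ` A <+>\<^bsub>M\<^esub> D"
        using a b unfolding mem_set_add by blast
      ultimately show "v \<in> ((\<bullet>) x ` A <+>\<^bsub>M\<^esub> D) <+>\<^bsub>M\<^esub> cyclic (x \<bullet> u)"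
        using a(2) mem_set_add by blast
    next
      fix v assume "v \<in> ((\<bullet>) x ` A <+>\<^bsub>M\<^esub> D) <+>\<^bsub>M\<^esub> cyclic (x \<bullet> u)"
      then obtain a d r where a: "a \<in> A" "d \<in> D" "r \<in> carrier R"
        and v: "v = (x \<bullet> a \<oplus>\<^bsub>M\<^esub> d) \<oplus>\<^bsub>M\<^esub> r \<bullet> (x \<bullet> u)" by (auto simp: mem_set_add)
      have c: "a \<in> carrier M" "d \<in> carrier M" using a submodule_carr A D by blast+
      have "v = x \<bullet> (a \<oplus>\<^bsub>M\<^esub> r \<bullet> u) \<oplus>\<^bsub>M\<^esub> d"
        using a v c x u by (simp add: eq smult_r_distr M.a_ac)
      moreover have "a \<oplus>\<^bsub>M\<^esub> r \<bullet> u \<in> B" unfolding Bu mem_set_add using a by blast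
      ultimately show "v \<in> (\<bullet>) x ` B <+>\<^bsub>M\<^esub> D" using a unfolding mem_set_add by blast
    qed
    show "P = {r \<in> carrier R. r \<bullet> (x \<bullet> u) \<in> (\<bullet>) x ` A <+>\<^bsub>M\<^esub> D}"
    proof (rule equalityI; rule subsetI)
      fix r assume "r \<in> P"
      then show "r \<in> {r \<in> carrier R. r \<bullet> (x \<bullet> u) \<in> (\<bullet>) x ` A <+>\<^bsub>M\<^esub> D}"
        using subset_set_add(1)[OF xA D] unfolding Pu by (auto simp: eq)
    next
      fix r assume "r \<in> {r \<in> carrier R. r \<bullet> (x \<bullet> u) \<in> (\<bullet>) x ` A <+>\<^bsub>M\<^esub> D}"
      then obtain a d where r: "r \<in> carrier R" and a: "a \<in> A" "d \<in> D"
        "x \<bullet> (r \<bullet> u) = x \<bullet> a \<oplus>\<^bsub>M\<^esub> d" using eq unfolding mem_set_add by auto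
      have c: "a \<in> carrier M" "d \<in> carrier M" using a submodule_carr A D by blast+
      \<comment> \<open>The difference of \<open>r \<bullet> u\<close> and \<open>a\<close> is an
        element of \<open>C\<close> that \<open>x\<close> moves into \<open>D\<close>, so
        injectivity puts it into \<open>A\<close>.\<close>
      have "x \<bullet> (\<ominus>\<^bsub>M\<^esub> a \<oplus>\<^bsub>M\<^esub> r \<bullet> u) = d"
        using a c x r u by (simp add: smult_r_distr smult_r_minus M.r_neg1)
      moreover have "\<ominus>\<^bsub>M\<^esub> a \<oplus>\<^bsub>M\<^esub> r \<bullet> u \<in> C"
        using submoduleE(3)[OF B, of a] submoduleE(4)[OF B r uB] submoduleE(5)[OF B] a(1) AB BC by blast
      ultimately have "\<ominus>\<^bsub>M\<^esub> a \<oplus>\<^bsub>M\<^esub> r \<bullet> u \<in> A" using Cons.prems a(2) by blast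
      then have "r \<bullet> u \<in> A"
        using submodule_cancel[OF A submoduleE(3)[OF A a(1)]] r u by blast
      then show "r \<in> P" using r unfolding Pu by blast
    qed
  qed (fact AD P)+
  moreover have "prime_chain ((\<bullet>) x ` B <+>\<^bsub>M\<^esub> D) ((\<bullet>) x ` C <+>\<^bsub>M\<^esub> D) Ps"
    by (rule Cons.IH) (use Cons.prems AB in blast)
  ultimately show ?case by (rule prime_chain.Cons)
qed

text \<open>An annihilator that is maximal among those of nonzero elements of \<open>B/A\<close> is
  prime: if \<open>a \<otimes> b\<close> kills \<open>u\<close> and \<open>b \<bullet> u\<close> is
  nonzero, then the annihilator of \<open>b \<bullet> u\<close> contains \<open>a\<close> and that
  of \<open>u\<close>, hence equals the latter.\<close>

lemma prime_step_exists:
  assumes "noetherian_ring R" and A: "submodule A R M" and B: "submodule B R M" and AB: "A \<subset> B"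
  shows "\<exists>A' P. prime_step A A' P \<and> A' \<subseteq> B"
proof -
  define ann where "ann u = {r \<in> carrier R. r \<bullet> u \<in> A}" for u
  have "ann ` (B - A) \<subseteq> {J. ideal J R}"
    using colon_ideal[OF A] submodule_carr[OF B] unfolding ann_def by blast
  then obtain P where "P \<in> ann ` (B - A)" and max: "\<And>t. t \<in> ann ` (B - A) \<Longrightarrow> P \<subseteq> t \<Longrightarrow> t = P"
    using acc_maximal[OF noetherian_ring.acc_ideals[OF assms(1)], of "ann ` (B - A)"] AB by blast
  then obtain u where u: "u \<in> B" "u \<notin> A" "P = ann u" by blast
  have uM: "u \<in> carrier M" using submodule_carr[OF B] u by blast
  have "primeideal P R"
  proof (rule primeidealI)
    show "ideal P R" using u(3) colon_ideal[OF A uM] unfolding ann_def by simp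
    show "cring R" by (rule R.is_cring)
    have "\<one> \<notin> P" using u uM unfolding ann_def by simp
    then show "carrier R \<noteq> P" by blast
    show "a \<in> P \<or> b \<in> P" if ab: "a \<in> carrier R" "b \<in> carrier R" "a \<otimes> b \<in> P" for a b
    proof (cases "b \<in> P")
      case False
      then have "b \<bullet> u \<in> B - A" using ab submoduleE(4)[OF B] u unfolding ann_def by blast
      moreover have "P \<subseteq> ann (b \<bullet> u)"
      proof
        fix r assume "r \<in> P"
        then have r: "r \<in> carrier R" "r \<bullet> u \<in> A" using u(3) unfolding ann_def by auto
        then have "r \<bullet> (b \<bullet> u) = b \<bullet> (r \<bullet> u)"
          using ab uM by (simp add: R.m_comm flip: smult_assoc1)
        then show "r \<in> ann (b \<bullet> u)" using submoduleE(4)[OF A ab(2) r(2)] r(1) unfolding ann_def by simp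
      qed
      ultimately have "ann (b \<bullet> u) = P" using max by blast
      moreover have "a \<in> ann (b \<bullet> u)" using ab u(3) uM smult_assoc1 unfolding ann_def by simp
      ultimately show ?thesis by simp
    qed simp
  qed
  then have "prime_step A (A <+>\<^bsub>M\<^esub> cyclic u) P"
    unfolding prime_step_def using A uM u(3) unfolding ann_def by blast
  moreover have "A <+>\<^bsub>M\<^esub> cyclic u \<subseteq> B"
    by (rule set_add_least[OF B]) (use AB u submoduleE(4)[OF B] in auto)
  ultimately show ?thesis by blast
qed

lemma prime_chain_exists:
  assumes R: "noetherian_ring R" and acc: "acc {N. submodule N R M}"
    and A: "submodule A R M" and B: "submodule B R M" and AB: "A \<subseteq> B"
  shows "\<exists>Ps. prime_chain A B Ps"
proof -
  have "A \<in> {N. submodule N R M}" using A by blast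
  with acc have "A \<subseteq> B \<longrightarrow> (\<exists>Ps. prime_chain A B Ps)"
  proof (induction A rule: acc_induct)
    case (step A)
    show ?case
    proof (cases "A \<subset> B")
      case True
      then obtain A' P where "prime_step A A' P" "A' \<subseteq> B"
        using prime_step_exists[OF R _ B] step by blast
      then show ?thesis using step.IH[of A'] prime_step_submodule[of A A' P] prime_chain.Cons by blast
    next
      case False
      then show ?thesis using prime_chain.Nil step.hyps by blast
    qed
  qed
  then show ?thesis using AB by blast
qed

end

section \<open>Avoidance of ideals over infinite residue fields\<close>

lemma (in noetherian_ring) maximalideal_exists:
  assumes "ideal J R" "J \<noteq> carrier R"
  shows "\<exists>m. maximalideal m R \<and> J \<subseteq> m"
proof -
  obtain m where m: "m \<in> {K. ideal K R \<and> J \<subseteq> K \<and> K \<noteq> carrier R}"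
    and max: "\<And>K. K \<in> {K. ideal K R \<and> J \<subseteq> K \<and> K \<noteq> carrier R} \<Longrightarrow> m \<subseteq> K \<Longrightarrow> K = m"
    by (rule acc_maximal[OF acc_ideals, of "{K. ideal K R \<and> J \<subseteq> K \<and> K \<noteq> carrier R}"])
      (use assms in auto)
  have "maximalideal m R"
  proof (rule maximalidealI)
    show "K = m \<or> K = carrier R" if "ideal K R" "m \<subseteq> K" "K \<subseteq> carrier R" for K
      using max[of K] m that by blast
  qed (use m in auto)
  then show ?thesis using m by blast
qed

lemma (in cring) maximalideals_separate:
  assumes "finite \<M>" "\<And>m'. m' \<in> \<M> \<Longrightarrow> maximalideal m' R" "maximalideal m R" "m \<notin> \<M>"
  shows "\<exists>e\<in>carrier R. e \<notin> m \<and> (\<forall>m'\<in>\<M>. e \<in> m')"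
  using assms
proof (induction \<M> rule: finite_induct)
  case empty
  interpret m: maximalideal m R by fact
  show ?case using m.I_notcarr m.a_subset by auto
next
  case (insert m' \<M>)
  then obtain e where e: "e \<in> carrier R" "e \<notin> m" "\<forall>m'\<in>\<M>. e \<in> m'" by auto
  interpret m: maximalideal m R by fact
  interpret m': maximalideal m' R using insert by auto
  interpret p: primeideal m R by (rule maximalideal_prime[OF insert.prems(2)])
  have "\<not> m' \<subseteq> m"
    using m'.I_maximal[OF m.is_ideal _ m.a_subset] insert.prems(3) m.I_notcarr by auto
  then obtain f where f: "f \<in> m'" "f \<notin> m" by blast
  have fc: "f \<in> carrier R" using f m'.Icarr by blast
  have "e \<otimes> f \<notin> m" using p.I_prime[OF e(1) fc] e f by blast
  moreover have "e \<otimes> f \<in> m'" using m'.I_l_closed f e by blast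
  moreover have "e \<otimes> f \<in> m''" if "m'' \<in> \<M>" for m''
    using ideal.I_r_closed[of m'' R e f] insert.prems(1)[of m''] that e fc maximalideal.axioms(1) by blast
  ultimately show ?case using e fc by auto
qed

text \<open>One maximal ideal is treated at a time. For \<open>e\<close> outside \<open>m\<close>
  and inside the earlier ideals, \<open>a \<oplus> e \<otimes> r\<close> keeps the earlier residues
  of \<open>a\<close>, while its residue modulo \<open>m\<close> runs through the whole infinite
  field.\<close>

lemma (in cring) avoid_cosets:
  assumes inf: "infinite_residue_fields R" and F: "finite F" "F \<subseteq> carrier R"
    and "finite \<M>" "\<And>m. m \<in> \<M> \<Longrightarrow> maximalideal m R"
  shows "\<exists>a\<in>carrier R. \<forall>m\<in>\<M>. \<forall>f\<in>F. a \<ominus> f \<notin> m"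
  using assms(4,5)
proof (induction \<M> rule: finite_induct)
  case (insert m \<M>)
  then obtain a where a: "a \<in> carrier R" "\<forall>m\<in>\<M>. \<forall>f\<in>F. a \<ominus> f \<notin> m" by auto
  have m: "maximalideal m R" using insert by blast
  interpret m: maximalideal m R by (rule m)
  interpret p: primeideal m R by (rule maximalideal_prime[OF m])
  obtain e where e: "e \<in> carrier R" "e \<notin> m" "\<forall>m'\<in>\<M>. e \<in> m'"
    using maximalideals_separate[of \<M> m] insert m by blast
  have "\<exists>r\<in>carrier R. \<forall>f\<in>F. a \<oplus> e \<otimes> r \<ominus> f \<notin> m"
  proof (rule ccontr)
    assume "\<not> ?thesis"
    then have "\<forall>r\<in>carrier R. \<exists>f\<in>F. a \<oplus> e \<otimes> r \<ominus> f \<in> m" by blast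
    then obtain g where g: "\<And>r. r \<in> carrier R \<Longrightarrow> g r \<in> F" "\<And>r. r \<in> carrier R \<Longrightarrow> a \<oplus> e \<otimes> r \<ominus> g r \<in> m"
      by metis
    have same: "m +> r = m +> s" if rs: "r \<in> carrier R" "s \<in> carrier R" "g r = g s" for r s
    proof -
      have c: "g s \<in> carrier R" using g(1) F rs by blast
      have "(a \<oplus> e \<otimes> r \<ominus> g r) \<ominus> (a \<oplus> e \<otimes> s \<ominus> g s) \<in> m"
        using g(2)[OF rs(1)] g(2)[OF rs(2)] by (simp add: m.a_inv_closed m.a_closed minus_eq)
      moreover have "(a \<oplus> e \<otimes> r \<ominus> g r) \<ominus> (a \<oplus> e \<otimes> s \<ominus> g s) = e \<otimes> (r \<ominus> s)"
        unfolding rs(3) using a e rs c by algebra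
      ultimately have "r \<ominus> s \<in> m" using p.I_prime[of e "r \<ominus> s"] e rs by auto
      then show ?thesis using quotient_eq_iff_same_a_r_cos[OF m.is_ideal rs(1,2)] by simp
    qed
    \<comment> \<open>The map \<open>g\<close> has finitely many values, and equal values force
      equal residues modulo \<open>m\<close>, so \<open>F\<close> would map onto the residue
      field.\<close>
    have "carrier (R Quot m) \<subseteq> (\<lambda>f. m +> (SOME r. r \<in> carrier R \<and> g r = f)) ` F"
    proof
      fix C assume "C \<in> carrier (R Quot m)"
      then obtain r where r: "r \<in> carrier R" "C = m +> r"
        unfolding FactRing_def A_RCOSETS_def' by auto
      define s where "s = (SOME s. s \<in> carrier R \<and> g s = g r)"
      have "s \<in> carrier R \<and> g s = g r" unfolding s_def by (rule someI[of _ r]) (use r in simp)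
      then have "C = m +> s" using same r by metis
      then show "C \<in> (\<lambda>f. m +> (SOME r. r \<in> carrier R \<and> g r = f)) ` F"
        using g(1)[OF r(1)] unfolding s_def by blast
    qed
    then have "finite (carrier (R Quot m))" using F finite_subset by blast
    then show False using inf m unfolding infinite_residue_fields_def by blast
  qed
  then obtain r where r: "r \<in> carrier R" "\<forall>f\<in>F. a \<oplus> e \<otimes> r \<ominus> f \<notin> m" by blast
  have "a \<oplus> e \<otimes> r \<ominus> f \<notin> m'" if m': "m' \<in> \<M>" and f: "f \<in> F" for m' f
  proof
    assume asm: "a \<oplus> e \<otimes> r \<ominus> f \<in> m'"
    interpret m': maximalideal m' R using insert m' by blast
    have er: "e \<otimes> r \<in> m'" using m'.I_r_closed e m' r by blast
    have "(a \<oplus> e \<otimes> r \<ominus> f) \<ominus> e \<otimes> r \<in> m'"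
      using asm er by (simp add: m'.a_inv_closed m'.a_closed minus_eq)
    moreover have "f \<in> carrier R" using f F by blast
    then have "(a \<oplus> e \<otimes> r \<ominus> f) \<ominus> e \<otimes> r = a \<ominus> f" using a e r by algebra
    ultimately show False using a(2) m' f by simp
  qed
  then show ?case using r a e by (intro bexI[of _ "a \<oplus> e \<otimes> r"]) auto
qed auto

text \<open>If \<open>x\<close> avoids the other ideals but lies in \<open>J\<close>, the search
  runs along \<open>z \<oplus> a \<otimes> x\<close> with \<open>z\<close> in \<open>I\<close>
  outside \<open>J\<close>. Modulo \<open>J\<close> this is always \<open>z\<close>; for each other
  \<open>K\<close> the bad \<open>a\<close> lie in a single coset of a maximal ideal.\<close>

lemma (in cring) avoid_ideals:
  assumes noeth: "noetherian_ring R" and inf: "infinite_residue_fields R" and I: "ideal I R"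
    and "finite \<J>" "\<And>J. J \<in> \<J> \<Longrightarrow> ideal J R \<and> \<not> I \<subseteq> J"
  shows "\<exists>x\<in>I. \<forall>J\<in>\<J>. x \<notin> J"
  using assms(4,5)
proof (induction \<J> rule: finite_induct)
  case empty
  then show ?case using additive_subgroup.zero_closed[OF ideal.axioms(1)[OF I]] by blast
next
  case (insert J \<J>)
  then obtain x where x: "x \<in> I" "\<forall>J\<in>\<J>. x \<notin> J" by auto
  interpret I: ideal I R by (rule I)
  interpret J: ideal J R using insert by blast
  show ?case
  proof (cases "x \<in> J")
    case False
    then show ?thesis using x by auto
  next
    case True
    obtain z where z: "z \<in> I" "z \<notin> J" using insert by blast
    have c: "x \<in> carrier R" "z \<in> carrier R" using x z I.Icarr by blast+
    have "\<exists>m. maximalideal m R \<and> (\<forall>a\<in>carrier R. a \<otimes> x \<in> K \<longrightarrow> a \<in> m)" if K: "K \<in> \<J>" for K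
    proof -
      interpret K: ideal K R using insert K by blast
      have "ideal {a \<in> carrier R. a \<otimes> x \<in> K} R"
      proof (rule idealI)
        show "subgroup {a \<in> carrier R. a \<otimes> x \<in> K} (add_monoid R)"
          unfolding subgroup_def using c
          by (auto simp: l_distr K.zero_closed K.a_closed K.a_inv_closed l_minus simp flip: a_inv_def)
        show "b \<otimes> a \<in> {a \<in> carrier R. a \<otimes> x \<in> K}"
          if "a \<in> {a \<in> carrier R. a \<otimes> x \<in> K}" "b \<in> carrier R" for a b
          using that c by (simp add: m_assoc K.I_l_closed)
        then show "a \<otimes> b \<in> {a \<in> carrier R. a \<otimes> x \<in> K}"
          if "a \<in> {a \<in> carrier R. a \<otimes> x \<in> K}" "b \<in> carrier R" for a b
          using that m_comm[of a b] by auto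
      qed (rule ring_axioms)
      moreover have "\<one> \<notin> {a \<in> carrier R. a \<otimes> x \<in> K}" using x K c by auto
      ultimately obtain m where "maximalideal m R" "{a \<in> carrier R. a \<otimes> x \<in> K} \<subseteq> m"
        using noetherian_ring.maximalideal_exists[OF noeth] one_closed by blast
      then show ?thesis by blast
    qed
    then obtain m where m: "\<And>K. K \<in> \<J> \<Longrightarrow> maximalideal (m K) R"
      "\<And>K a. K \<in> \<J> \<Longrightarrow> a \<in> carrier R \<Longrightarrow> a \<otimes> x \<in> K \<Longrightarrow> a \<in> m K" by metis
    \<comment> \<open>If some \<open>z \<oplus> a \<otimes> x\<close> lies in \<open>K\<close>, then
      \<open>rep K\<close> is one such \<open>a\<close>. Any other differs from it by an element of
      the colon ideal of \<open>x\<close> into \<open>K\<close>, which is proper because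
      \<open>x\<close> is not in \<open>K\<close> and so lies in \<open>m K\<close>. If there is
      none, \<open>rep K\<close> is arbitrary.\<close>
    define rep where "rep K = (SOME a. a \<in> carrier R \<and> (z \<oplus> a \<otimes> x \<in> K \<or> (\<forall>b\<in>carrier R. z \<oplus> b \<otimes> x \<notin> K)))" for K
    have rep: "rep K \<in> carrier R \<and> (z \<oplus> rep K \<otimes> x \<in> K \<or> (\<forall>b\<in>carrier R. z \<oplus> b \<otimes> x \<notin> K))" for K
      unfolding rep_def by (rule someI_ex) (use one_closed in blast)
    obtain a where a: "a \<in> carrier R" "\<forall>n\<in>m ` \<J>. \<forall>f\<in>rep ` \<J>. a \<ominus> f \<notin> n"
      using avoid_cosets[OF inf, of "rep ` \<J>" "m ` \<J>"] insert.hyps(1) rep m(1) by auto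
    have "z \<oplus> a \<otimes> x \<notin> K" if K: "K \<in> \<J>" for K
    proof
      assume asm: "z \<oplus> a \<otimes> x \<in> K"
      interpret K: ideal K R using insert K by blast
      have rK: "z \<oplus> rep K \<otimes> x \<in> K" "rep K \<in> carrier R" using rep asm a(1) by blast+
      have "(z \<oplus> a \<otimes> x) \<ominus> (z \<oplus> rep K \<otimes> x) \<in> K"
        using asm rK by (simp add: K.a_inv_closed K.a_closed minus_eq)
      moreover have "(z \<oplus> a \<otimes> x) \<ominus> (z \<oplus> rep K \<otimes> x) = (a \<ominus> rep K) \<otimes> x"
        using c a(1) rK(2) by algebra
      ultimately show False using m(2)[OF K, of "a \<ominus> rep K"] a rK(2) K by auto
    qed
    moreover have "z \<oplus> a \<otimes> x \<notin> J"
    proof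
      assume asm: "z \<oplus> a \<otimes> x \<in> J"
      have ax: "a \<otimes> x \<in> J" using True a(1) J.I_l_closed by blast
      have "(z \<oplus> a \<otimes> x) \<ominus> a \<otimes> x \<in> J"
        using asm ax by (simp add: J.a_inv_closed J.a_closed minus_eq)
      moreover have "(z \<oplus> a \<otimes> x) \<ominus> a \<otimes> x = z" using c a(1) by algebra
      ultimately show False using z by simp
    qed
    moreover have "z \<oplus> a \<otimes> x \<in> I" using z x a(1) I.I_l_closed I.a_closed by blast
    ultimately show ?thesis by blast
  qed
qed

section \<open>Superficial elements\<close>

locale ideal_powers = module + R?: noetherian_ring R +
  fixes I :: "'a set"
  assumes I: "ideal I R"
begin

definition Ip :: "nat \<Rightarrow> 'a set" where "Ip n = I [^]\<^bsub>ideals_set R\<^esub> n"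

lemma Ip_0: "Ip 0 = carrier R"
  by (simp add: Ip_def ideals_set_def)

lemma Ip_Suc: "Ip (Suc n) = Ip n \<cdot>\<^bsub>R\<^esub> I"
  by (simp add: Ip_def ideals_set_def)

lemma Ip_ideal: "ideal (Ip n) R"
proof (induction n)
  case 0
  then show ?case using R.oneideal Ip_0 by simp
next
  case (Suc n)
  then show ?case using R.ideal_prod_is_ideal[OF _ I] Ip_Suc by simp
qed

lemma Ip_carrier: "a \<in> Ip n \<Longrightarrow> a \<in> carrier R"
  using ideal.Icarr[OF Ip_ideal] by blast

lemma Ip_add: "Ip (j + k) = Ip j \<cdot>\<^bsub>R\<^esub> Ip k"
proof (induction k)
  case 0
  then show ?case using R.ideal_prod_one[OF Ip_ideal] Ip_0 by simp
next
  case (Suc k)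
  then show ?case using R.ideal_prod_assoc[OF Ip_ideal Ip_ideal I] Ip_Suc by simp
qed

lemma Ip_1: "Ip (Suc 0) = I"
  using R.ideal_prod_commute[OF R.oneideal I] R.ideal_prod_one[OF I] by (simp add: Ip_Suc Ip_0)

lemma Ip_mult: "a \<in> Ip j \<Longrightarrow> b \<in> Ip k \<Longrightarrow> a \<otimes> b \<in> Ip (j + k)"
  unfolding Ip_add by (rule ideal_prod.prod)

lemma Ip_Suc_subset:
  assumes "ideal K R" "\<And>a b. a \<in> Ip n \<Longrightarrow> b \<in> I \<Longrightarrow> a \<otimes> b \<in> K"
  shows "Ip (Suc n) \<subseteq> K"
proof
  fix s assume "s \<in> Ip (Suc n)"
  then have "s \<in> Ip n \<cdot>\<^bsub>R\<^esub> I" using Ip_Suc by simp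
  then show "s \<in> K"
    by (induction rule: ideal_prod.induct)
      (auto intro: assms(2) additive_subgroup.a_closed[OF ideal.axioms(1)[OF assms(1)]])
qed

lemma graded_sub: "graded X L \<Longrightarrow> submodule (L n) R M"
  unfolding graded_def by blast

lemma graded_Ip:
  assumes L: "graded I L" and a: "a \<in> Ip k" and v: "v \<in> L n"
  shows "a \<bullet> v \<in> L (n + k)"
  using a
proof (induction k arbitrary: a)
  case 0
  then show ?case using v submoduleE(4)[OF graded_sub[OF L]] Ip_carrier by simp
next
  case (Suc k)
  have vM: "v \<in> carrier M" using v submodule_carr[OF graded_sub[OF L]] by blast
  have "Ip (Suc k) \<subseteq> {r \<in> carrier R. r \<bullet> v \<in> L (n + Suc k)}"
  proof (rule Ip_Suc_subset)
    show "ideal {r \<in> carrier R. r \<bullet> v \<in> L (n + Suc k)} R"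
      by (rule colon_ideal[OF graded_sub[OF L] vM])
    fix a b assume ab: "a \<in> Ip k" "b \<in> I"
    have c: "a \<in> carrier R" "b \<in> carrier R" using ab Ip_carrier ideal.Icarr[OF I] by blast+
    have "b \<bullet> (a \<bullet> v) \<in> L (Suc (n + k))"
      using L Suc.IH[OF ab(1)] ab(2) unfolding graded_def by blast
    moreover have "(a \<otimes> b) \<bullet> v = b \<bullet> (a \<bullet> v)"
      using c vM by (simp add: R.m_comm[of a b] smult_assoc1)
    ultimately show "a \<otimes> b \<in> {r \<in> carrier R. r \<bullet> v \<in> L (n + Suc k)}" using c by simp
  qed
  then show ?case using Suc.prems by blast
qed

text \<open>Homogeneous primes of the Rees ring that do not contain its whole part of degree one.\<close>
definition graded_prime :: "(nat \<Rightarrow> 'a set) \<Rightarrow> bool" where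
  "graded_prime Q \<longleftrightarrow> (\<forall>k. ideal (Q k) R \<and> Q k \<subseteq> Ip k) \<and>
     (\<forall>j k. \<forall>a\<in>Ip j. \<forall>b\<in>Q k. a \<otimes> b \<in> Q (j + k)) \<and>
     (\<forall>j k. \<forall>a\<in>Ip j. \<forall>b\<in>Ip k. a \<otimes> b \<in> Q (j + k) \<longrightarrow> a \<in> Q j \<or> b \<in> Q k) \<and>
     \<not> I \<subseteq> Q (Suc 0)"

lemma graded_primeD:
  assumes "graded_prime Q"
  shows "ideal (Q k) R" "Q k \<subseteq> Ip k" "a \<in> Ip j \<Longrightarrow> b \<in> Q k \<Longrightarrow> a \<otimes> b \<in> Q (j + k)"
    "a \<in> Ip j \<Longrightarrow> b \<in> Ip k \<Longrightarrow> a \<otimes> b \<in> Q (j + k) \<Longrightarrow> a \<in> Q j \<or> b \<in> Q k"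
    "\<not> I \<subseteq> Q (Suc 0)"
  using assms unfolding graded_prime_def by blast+

lemma Ip_pow: "x \<in> Ip m \<Longrightarrow> x [^] n \<in> Ip (n * m)"
proof (induction n)
  case (Suc n)
  then show ?case using Ip_mult[of "x [^] n" "n * m" x m] by (simp add: add.commute)
qed (simp add: Ip_0)

lemma graded_prime_pow_notin:
  assumes Q: "graded_prime Q" and x: "x \<in> Ip m" "x \<notin> Q m"
  shows "x [^] Suc n \<notin> Q (Suc n * m)"
proof (induction n)
  case 0
  then show ?case using x Ip_carrier by simp
next
  case (Suc n)
  then show ?case
    using graded_primeD(4)[OF Q Ip_pow[OF x(1), of "Suc n"] x(1)] x(2) by (auto simp: add_ac)
qed

lemma graded_prime_pow_in:
  assumes Q: "graded_prime Q" and x: "x \<in> Q m"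
  shows "x [^] Suc n \<in> Q (Suc n * m)"
  using graded_primeD(3)[OF Q Ip_pow[of x m n] x] graded_primeD(2)[OF Q] x by (auto simp: add_ac)

text \<open>Starting from an element of \<open>I\<close> outside \<open>Q\<close> makes the degree
  positive. Each \<open>P\<close> contributes a homogeneous factor outside \<open>Q\<close>, and
  primality of \<open>Q\<close> keeps the product outside.\<close>

lemma graded_prime_separate:
  assumes Q: "graded_prime Q" and fin: "finite \<P>" and "\<And>P. P \<in> \<P> \<Longrightarrow> graded_prime P \<and> \<not> P \<le> Q"
  shows "\<exists>k y. y \<in> Ip (Suc k) \<and> y \<notin> Q (Suc k) \<and> (\<forall>P\<in>\<P>. y \<in> P (Suc k))"
  using fin assms(3)
proof (induction \<P> rule: finite_induct)
  case empty
  obtain s where "s \<in> I" "s \<notin> Q (Suc 0)" using graded_primeD(5)[OF Q] by blast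
  then show ?case using Ip_1 by blast
next
  case (insert P \<P>)
  then obtain k y where y: "y \<in> Ip (Suc k)" "y \<notin> Q (Suc k)" "\<forall>P\<in>\<P>. y \<in> P (Suc k)" by auto
  have P: "graded_prime P" "\<not> P \<le> Q" using insert by auto
  then obtain j z where z: "z \<in> P j" "z \<notin> Q j" unfolding le_fun_def by blast
  have zI: "z \<in> Ip j" using z graded_primeD(2)[OF P(1)] by blast
  have "y \<otimes> z \<in> Ip (Suc (k + j))" using Ip_mult[OF y(1) zI] by simp
  moreover have "y \<otimes> z \<notin> Q (Suc (k + j))" using graded_primeD(4)[OF Q y(1) zI] y z by auto
  moreover have "y \<otimes> z \<in> P (Suc (k + j))" using graded_primeD(3)[OF P(1) y(1) z(1)] by simp
  moreover have "y \<otimes> z \<in> P' (Suc (k + j))" if P': "P' \<in> \<P>" for P'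
  proof -
    have "graded_prime P'" using insert P' by blast
    then have "z \<otimes> y \<in> P' (j + Suc k)" using graded_primeD(3)[of P' z j y "Suc k"] zI y P' by blast
    moreover have "z \<otimes> y = y \<otimes> z" using R.m_comm Ip_carrier zI y by blast
    ultimately show ?thesis by (simp add: add.commute)
  qed
  ultimately show ?case by (intro exI[of _ "k + j"] exI[of _ "y \<otimes> z"]) blast
qed

text \<open>The sum in the usual proof of prime avoidance must be homogeneous. Elements of degrees
  \<open>Suc m\<close> and \<open>Suc k\<close> are therefore raised to the powers
  \<open>Suc k\<close> and \<open>Suc m\<close> before they are added.\<close>

lemma graded_prime_avoidance:
  assumes "finite \<Q>" "\<And>Q. Q \<in> \<Q> \<Longrightarrow> graded_prime Q"
  shows "\<exists>m x. x \<in> Ip (Suc m) \<and> (\<forall>Q\<in>\<Q>. x \<notin> Q (Suc m))"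
  using assms
proof (induction \<Q> rule: finite_psubset_induct)
  case (psubset \<Q>)
  show ?case
  proof (cases "\<exists>Q\<in>\<Q>. \<exists>Q'\<in>\<Q>. Q \<noteq> Q' \<and> Q \<le> Q'")
    case True
    then obtain Q Q' where Q: "Q \<in> \<Q>" "Q' \<in> \<Q>" "Q \<noteq> Q'" "Q \<le> Q'" by blast
    then obtain m x where "x \<in> Ip (Suc m)" "\<forall>P\<in>\<Q> - {Q}. x \<notin> P (Suc m)"
      using psubset.IH[of "\<Q> - {Q}"] psubset.prems by blast
    moreover from this have "x \<notin> Q (Suc m)" using Q unfolding le_fun_def by blast
    ultimately show ?thesis by blast
  next
    case False
    show ?thesis
    proof (cases "\<Q> = {}")
      case True
      then show ?thesis using additive_subgroup.zero_closed[OF ideal.axioms(1)[OF Ip_ideal]] by blast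
    next
      case ne: False
      then obtain Q where Q: "Q \<in> \<Q>" by blast
      have hQ: "graded_prime Q" using psubset.prems Q by blast
      obtain m x where x: "x \<in> Ip (Suc m)" "\<forall>P\<in>\<Q> - {Q}. x \<notin> P (Suc m)"
        using psubset.IH[of "\<Q> - {Q}"] psubset.prems Q by blast
      show ?thesis
      proof (cases "x \<in> Q (Suc m)")
        case False
        then show ?thesis using x by blast
      next
        case True
        obtain k y where y: "y \<in> Ip (Suc k)" "y \<notin> Q (Suc k)" "\<forall>P\<in>\<Q> - {Q}. y \<in> P (Suc k)"
          using graded_prime_separate[OF hQ, of "\<Q> - {Q}"] psubset.hyps psubset.prems False Q by blast
        define d where "d = Suc k * Suc m"
        define z where "z = x [^] Suc k \<oplus> y [^] Suc m"
        have d': "d = Suc m * Suc k" unfolding d_def by simp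
        have xd: "x [^] Suc k \<in> Ip d" and yd: "y [^] Suc m \<in> Ip d"
          using Ip_pow[OF x(1), of "Suc k"] Ip_pow[OF y(1), of "Suc m"] unfolding d_def d'[unfolded d_def] by auto
        have c: "x [^] Suc k \<in> carrier R" "y [^] Suc m \<in> carrier R" using xd yd Ip_carrier by blast+
        have zI: "z \<in> Ip d" unfolding z_def
          by (rule additive_subgroup.a_closed[OF ideal.axioms(1)[OF Ip_ideal] xd yd])
        \<comment> \<open>Exactly one summand of \<open>z\<close> lies in \<open>P d\<close>: the
          power of \<open>x\<close> if \<open>P = Q\<close>, the power of \<open>y\<close>
          otherwise.\<close>
        have "z \<notin> P d" if P: "P \<in> \<Q>" for P
        proof
          assume asm: "z \<in> P d"
          have hP: "graded_prime P" using psubset.prems P by blast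
          interpret P: ideal "P d" R by (rule graded_primeD(1)[OF hP])
          show False
          proof (cases "P = Q")
            case True
            then have "x [^] Suc k \<in> P d" using graded_prime_pow_in[OF hQ \<open>x \<in> Q (Suc m)\<close>] d_def by blast
            then have "z \<ominus> x [^] Suc k \<in> P d"
              using asm by (simp add: P.a_inv_closed P.a_closed R.minus_eq)
            moreover have "z \<ominus> x [^] Suc k = y [^] Suc m" unfolding z_def using c by algebra
            ultimately show False using graded_prime_pow_notin[OF hQ y(1,2), of m] True d' by simp
          next
            case False
            then have "y [^] Suc m \<in> P d" using graded_prime_pow_in[OF hP, of y "Suc k" m] y P d' by simp
            then have "z \<ominus> y [^] Suc m \<in> P d"
              using asm by (simp add: P.a_inv_closed P.a_closed R.minus_eq)
            moreover have "z \<ominus> y [^] Suc m = x [^] Suc k" unfolding z_def using c by algebra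
            ultimately show False using graded_prime_pow_notin[OF hP x(1), of k] x(2) False P d_def by simp
          qed
        qed
        moreover have "d = Suc (k * Suc m + m)" unfolding d_def by simp
        ultimately show ?thesis using zI by metis
      qed
    qed
  qed
qed

section \<open>Homogeneous annihilators and associated primes\<close>

definition graded_ideal :: "(nat \<Rightarrow> 'a set) \<Rightarrow> bool" where
  "graded_ideal J \<longleftrightarrow> (\<forall>n. ideal (J n) R \<and> J n \<subseteq> Ip n) \<and> (\<forall>n. \<forall>a\<in>I. \<forall>b\<in>J n. a \<otimes> b \<in> J (Suc n))"

lemma graded_idealD:
  assumes "graded_ideal J"
  shows "ideal (J n) R" "J n \<subseteq> Ip n" "a \<in> I \<Longrightarrow> b \<in> J n \<Longrightarrow> a \<otimes> b \<in> J (Suc n)"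
  using assms unfolding graded_ideal_def by blast+

text \<open>The homogeneous submodule \<open>L + J u\<close>, where \<open>u\<close> is placed in
  degree \<open>k\<close>.\<close>

definition add_cyclic :: "(nat \<Rightarrow> 'c set) \<Rightarrow> (nat \<Rightarrow> 'a set) \<Rightarrow> nat \<Rightarrow> 'c \<Rightarrow> nat \<Rightarrow> 'c set" where
  "add_cyclic L J k u n = L n <+>\<^bsub>M\<^esub> (if n < k then {\<zero>\<^bsub>M\<^esub>} else (\<lambda>r. r \<bullet> u) ` J (n - k))"

lemma cyclic_part_sub:
  assumes "graded_ideal J" "u \<in> carrier M"
  shows "submodule (if n < k then {\<zero>\<^bsub>M\<^esub>} else (\<lambda>r. r \<bullet> u) ` J (n - k)) R M"
  using submodule_zero_set submodule_cyclic assms unfolding graded_ideal_def by simp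

lemma add_cyclic_graded:
  assumes L: "graded I L" and J: "graded_ideal J" and u: "u \<in> carrier M"
  shows "graded I (add_cyclic L J k u)" "L n \<subseteq> add_cyclic L J k u n"
proof -
  show "L n \<subseteq> add_cyclic L J k u n"
    unfolding add_cyclic_def by (rule subset_set_add(1)[OF graded_sub[OF L] cyclic_part_sub[OF J u]])
  show "graded I (add_cyclic L J k u)" unfolding graded_def
  proof (intro conjI allI ballI)
    show "submodule (add_cyclic L J k u n) R M" for n
      unfolding add_cyclic_def by (rule submodule_set_add[OF graded_sub[OF L] cyclic_part_sub[OF J u]])
    fix n a v assume a: "a \<in> I" and v: "v \<in> add_cyclic L J k u n"
    have aR: "a \<in> carrier R" using ideal.Icarr[OF I a] .
    obtain l w where lw: "l \<in> L n" "w \<in> (if n < k then {\<zero>\<^bsub>M\<^esub>} else (\<lambda>r. r \<bullet> u) ` J (n - k))"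
      "v = l \<oplus>\<^bsub>M\<^esub> w" using v unfolding add_cyclic_def mem_set_add by blast
    have c: "l \<in> carrier M" "w \<in> carrier M"
      using lw submodule_carr[OF graded_sub[OF L]] submodule_carr[OF cyclic_part_sub[OF J u]] by blast+
    have "a \<bullet> w \<in> (if Suc n < k then {\<zero>\<^bsub>M\<^esub>} else (\<lambda>r. r \<bullet> u) ` J (Suc n - k))"
    proof (cases "n < k")
      case True
      then have "a \<bullet> w = \<zero>\<^bsub>M\<^esub>" using lw aR by simp
      then show ?thesis using submodule_zero[OF cyclic_part_sub[OF J u]] by metis
    next
      case False
      then obtain r where r: "r \<in> J (n - k)" "w = r \<bullet> u" using lw by auto
      have rR: "r \<in> carrier R" using graded_idealD(2)[OF J] r Ip_carrier by blast
      have "a \<otimes> r \<in> J (Suc (n - k))" using graded_idealD(3)[OF J a] r by blast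
      then have "a \<otimes> r \<in> J (Suc n - k)" using False by (simp add: Suc_diff_le)
      moreover have "a \<bullet> w = (a \<otimes> r) \<bullet> u" using r aR rR u smult_assoc1 by simp
      ultimately show ?thesis using False by simp
    qed
    moreover have "a \<bullet> l \<in> L (Suc n)" using L a lw unfolding graded_def by blast
    moreover have "a \<bullet> v = a \<bullet> l \<oplus>\<^bsub>M\<^esub> a \<bullet> w" using lw c aR smult_r_distr by simp
    ultimately show "a \<bullet> v \<in> add_cyclic L J k u (Suc n)" unfolding add_cyclic_def mem_set_add by blast
  qed
qed

lemma add_cyclic_bound:
  assumes F: "graded I F" and L: "L \<le> F" and J: "graded_ideal J" and u: "u \<in> F k"
  shows "add_cyclic L J k u n \<subseteq> F n"
  unfolding add_cyclic_def
proof (rule set_add_least[OF graded_sub[OF F]])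
  show "L n \<subseteq> F n" using L unfolding le_fun_def by blast
  show "(if n < k then {\<zero>\<^bsub>M\<^esub>} else (\<lambda>r. r \<bullet> u) ` J (n - k)) \<subseteq> F n"
  proof (cases "n < k")
    case False
    then have "r \<bullet> u \<in> F n" if "r \<in> J (n - k)" for r
      using graded_Ip[OF F _ u, of r "n - k"] J that unfolding graded_ideal_def by auto
    then show ?thesis using False by auto
  qed (use submodule_zero[OF graded_sub[OF F]] in simp)
qed

text \<open>The degree \<open>j\<close> part of the annihilator of the class of \<open>u\<close>
  modulo \<open>L\<close>, where \<open>u\<close> is placed in degree \<open>k\<close>.\<close>

definition colon :: "(nat \<Rightarrow> 'c set) \<Rightarrow> nat \<Rightarrow> 'c \<Rightarrow> nat \<Rightarrow> 'a set" where
  "colon L k u j = {a \<in> Ip j. a \<bullet> u \<in> L (k + j)}"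

lemma colon_graded_ideal:
  assumes L: "graded I L" and u: "u \<in> carrier M"
  shows "graded_ideal (colon L k u)"
  unfolding graded_ideal_def
proof (intro conjI allI ballI)
  fix n
  have "colon L k u n = Ip n \<inter> {a \<in> carrier R. a \<bullet> u \<in> L (k + n)}"
    unfolding colon_def using Ip_carrier by blast
  then show "ideal (colon L k u n) R"
    using R.i_intersect[OF Ip_ideal colon_ideal[OF graded_sub[OF L] u]] by simp
  show "colon L k u n \<subseteq> Ip n" unfolding colon_def by blast
  fix a b assume a: "a \<in> I" and b: "b \<in> colon L k u n"
  have c: "a \<in> carrier R" "b \<in> carrier R" using a b ideal.Icarr[OF I] Ip_carrier unfolding colon_def by blast+
  have "a \<otimes> b \<in> Ip (Suc n)" using Ip_mult[of a "Suc 0" b n] a b Ip_1 unfolding colon_def by simp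
  moreover have "a \<bullet> (b \<bullet> u) \<in> L (Suc (k + n))" using L a b unfolding colon_def graded_def by blast
  ultimately show "a \<otimes> b \<in> colon L k u (Suc n)" unfolding colon_def using c u smult_assoc1 by simp
qed

text \<open>On homogeneous ideals \<open>J\<close> that contain the annihilator of \<open>u\<close>
  modulo \<open>L\<close>, the map from \<open>J\<close> to \<open>L + J u\<close> is injective. The
  chain condition for these ideals is thus borrowed from the module.\<close>

lemma acc_above_colon:
  assumes F: "graded I F" and L: "graded I L" "L \<le> F" and u: "u \<in> F k"
    and acc: "acc {L'. graded I L' \<and> L \<le> L' \<and> L' \<le> F}"
  shows "acc {J. graded_ideal J \<and> colon L k u \<le> J}"
proof (rule acc_map[OF acc, where f="\<lambda>J. add_cyclic L J k u"])
  have uM: "u \<in> carrier M" using u submodule_carr[OF graded_sub[OF F]] by blast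
  fix J assume "J \<in> {J. graded_ideal J \<and> colon L k u \<le> J}"
  then have J: "graded_ideal J" "colon L k u \<le> J" by auto
  show "add_cyclic L J k u \<in> {L'. graded I L' \<and> L \<le> L' \<and> L' \<le> F}"
    using add_cyclic_graded[OF L(1) J(1) uM] add_cyclic_bound[OF F L(2) J(1) u] by (auto simp: le_fun_def)
  fix J' assume "J' \<in> {J. graded_ideal J \<and> colon L k u \<le> J}" and le: "J \<le> J'"
  then have J': "graded_ideal J'" "colon L k u \<le> J'" by auto
  show "add_cyclic L J k u \<le> add_cyclic L J' k u"
    using le unfolding add_cyclic_def le_fun_def mem_set_add subset_iff by (auto simp: mem_set_add split: if_splits)
  assume eq: "add_cyclic L J k u = add_cyclic L J' k u"
  have "a \<in> J n" if a: "a \<in> J' n" for a n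
  proof -
    have JI: "J n \<subseteq> Ip n" "J' n \<subseteq> Ip n" "ideal (J n) R" using J J' unfolding graded_ideal_def by blast+
    have aR: "a \<in> carrier R" "a \<in> Ip n" using a JI Ip_carrier by blast+
    have "a \<bullet> u \<in> add_cyclic L J' k u (k + n)"
    proof -
      have "a \<bullet> u = \<zero>\<^bsub>M\<^esub> \<oplus>\<^bsub>M\<^esub> a \<bullet> u" using aR uM by simp
      then show ?thesis unfolding add_cyclic_def mem_set_add
        using submodule_zero[OF graded_sub[OF L(1)]] a by auto
    qed
    then have "a \<bullet> u \<in> add_cyclic L J k u (k + n)" using eq by simp
    then obtain l b where l: "l \<in> L (k + n)" and b: "b \<in> J n" and e: "a \<bullet> u = l \<oplus>\<^bsub>M\<^esub> b \<bullet> u"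
      unfolding add_cyclic_def by (auto simp: mem_set_add)
    have c: "l \<in> carrier M" "b \<in> carrier R" using l b JI submodule_carr[OF graded_sub[OF L(1)]] Ip_carrier by blast+
    \<comment> \<open>From \<open>a \<bullet> u\<close> in \<open>L + J u\<close> one gets
      \<open>b\<close> in \<open>J\<close> such that \<open>a \<ominus> b\<close> annihilates
      \<open>u\<close> modulo \<open>L\<close>; then \<open>a \<ominus> b\<close> lies in
      \<open>J\<close> as well.\<close>
    have "(a \<ominus> b) \<bullet> u = l"
      using e c aR uM by (simp add: R.minus_eq smult_l_distr smult_l_minus M.a_assoc M.r_neg)
    moreover have ab: "a \<ominus> b \<in> Ip n"
      using aR b JI additive_subgroup.a_closed[OF ideal.axioms(1)[OF Ip_ideal]]
        additive_subgroup.a_inv_closed[OF ideal.axioms(1)[OF Ip_ideal]] unfolding R.minus_eq by blast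
    ultimately have "a \<ominus> b \<in> colon L k u n" using l unfolding colon_def by simp
    then have "a \<ominus> b \<in> J n" using J unfolding le_fun_def by blast
    then have "(a \<ominus> b) \<oplus> b \<in> J n"
      using b additive_subgroup.a_closed[OF ideal.axioms(1)[OF JI(3)]] by blast
    moreover have "(a \<ominus> b) \<oplus> b = a" using aR c by algebra
    ultimately show ?thesis by simp
  qed
  then show "J = J'" using le by (intro order.antisym) (auto simp: le_fun_def)
qed

text \<open>Only annihilators of multiples of one fixed \<open>u0\<close> are compared, because the
  chain condition at hand concerns ideals above the annihilator of \<open>u0\<close>. A maximal one
  is prime on homogeneous elements, but may contain all of degree one and then is no
  \<open>graded_prime\<close>.\<close>

lemma associated_graded_prime:
  assumes F: "graded I F" and L: "graded I L" "L \<le> F" "L \<noteq> F"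
    and acc: "acc {L'. graded I L' \<and> L \<le> L' \<and> L' \<le> F}"
  obtains k u where "u \<in> F k" "u \<notin> L k"
    "\<And>i l a c. a \<in> Ip i \<Longrightarrow> c \<in> Ip l \<Longrightarrow> a \<otimes> c \<in> colon L k u (i + l) \<Longrightarrow> a \<in> colon L k u i \<or> c \<in> colon L k u l"
proof -
  obtain k0 where "L k0 \<noteq> F k0" using L(3) by blast
  then obtain u0 where u0: "u0 \<in> F k0" "u0 \<notin> L k0" using L(2) unfolding le_fun_def by blast
  have u0M: "u0 \<in> carrier M" using u0 submodule_carr[OF graded_sub[OF F]] by blast
  define G where "G = (\<lambda>(j, b). colon L (k0 + j) (b \<bullet> u0))"
  define B where "B = {(j, b). b \<in> Ip j \<and> b \<bullet> u0 \<notin> L (k0 + j)}"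
  have "G ` B \<subseteq> {J. graded_ideal J \<and> colon L k0 u0 \<le> J}"
  proof
    fix J assume "J \<in> G ` B"
    then obtain j b where b: "b \<in> Ip j" and J: "J = colon L (k0 + j) (b \<bullet> u0)"
      unfolding G_def B_def by auto
    have bR: "b \<in> carrier R" using b Ip_carrier by blast
    have "a \<in> colon L (k0 + j) (b \<bullet> u0) n" if a: "a \<in> colon L k0 u0 n" for a n
    proof -
      have aR: "a \<in> carrier R" "a \<in> Ip n" using a Ip_carrier unfolding colon_def by blast+
      have "b \<bullet> (a \<bullet> u0) \<in> L (k0 + n + j)"
        using graded_Ip[OF L(1) b] a unfolding colon_def by blast
      moreover have "b \<bullet> (a \<bullet> u0) = a \<bullet> (b \<bullet> u0)"
        using aR bR u0M by (simp add: R.m_comm flip: smult_assoc1)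
      ultimately show ?thesis using aR unfolding colon_def by (simp add: add_ac)
    qed
    then show "J \<in> {J. graded_ideal J \<and> colon L k0 u0 \<le> J}"
      using colon_graded_ideal[OF L(1)] bR u0M unfolding J by (auto simp: le_fun_def)
  qed
  moreover have "(0, \<one>) \<in> B" unfolding B_def using u0 u0M Ip_0 by simp
  ultimately obtain Q where "Q \<in> G ` B" and max: "\<And>J. J \<in> G ` B \<Longrightarrow> Q \<le> J \<Longrightarrow> J = Q"
    using acc_maximal[OF acc_above_colon[OF F L(1,2) u0(1) acc], of "G ` B"] by blast
  then obtain j b where b: "b \<in> Ip j" "b \<bullet> u0 \<notin> L (k0 + j)" and Q: "Q = colon L (k0 + j) (b \<bullet> u0)"
    unfolding G_def B_def by auto
  have bR: "b \<in> carrier R" using b Ip_carrier by blast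
  define k u where "k = k0 + j" and "u = b \<bullet> u0"
  have uM: "u \<in> carrier M" unfolding u_def using bR u0M by simp
  have Qku: "Q = colon L k u" unfolding Q k_def u_def ..
  show thesis
  proof (rule that[of u k])
    show "u \<in> F k" unfolding u_def k_def using graded_Ip[OF F b(1) u0(1)] .
    show "u \<notin> L k" unfolding u_def k_def using b(2) .
    fix i l a c assume a: "a \<in> Ip i" and c: "c \<in> Ip l" and ac: "a \<otimes> c \<in> colon L k u (i + l)"
    have R: "a \<in> carrier R" "c \<in> carrier R" using a c Ip_carrier by blast+
    show "a \<in> colon L k u i \<or> c \<in> colon L k u l"
    proof (cases "c \<bullet> u \<in> L (k + l)")
      case True
      then show ?thesis using c unfolding colon_def by blast
    next
      case False
      have cbu: "(c \<otimes> b) \<bullet> u0 = c \<bullet> u" unfolding u_def using R bR u0M by (simp add: smult_assoc1)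
      have "c \<otimes> b \<in> Ip (l + j)" using Ip_mult[OF c b(1)] .
      then have "(l + j, c \<otimes> b) \<in> B" using False unfolding B_def by (simp add: cbu k_def add_ac)
      then have inB: "colon L (k + l) (c \<bullet> u) \<in> G ` B"
        unfolding G_def by (intro rev_image_eqI) (auto simp: cbu k_def add_ac)
      have "r \<in> colon L (k + l) (c \<bullet> u) n" if r: "r \<in> colon L k u n" for r n
      proof -
        have rR: "r \<in> carrier R" "r \<in> Ip n" using r Ip_carrier unfolding colon_def by blast+
        have "c \<bullet> (r \<bullet> u) \<in> L (k + n + l)"
          using graded_Ip[OF L(1) c] r unfolding colon_def by blast
        moreover have "c \<bullet> (r \<bullet> u) = r \<bullet> (c \<bullet> u)"
          using rR R uM by (simp add: R.m_comm flip: smult_assoc1)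
        ultimately show ?thesis using rR unfolding colon_def by (simp add: add_ac)
      qed
      then have "colon L (k + l) (c \<bullet> u) = colon L k u"
        using max[OF inB] unfolding Qku le_fun_def by blast
      moreover have "a \<in> colon L (k + l) (c \<bullet> u) i"
        using ac a R uM unfolding colon_def by (simp add: smult_assoc1 add_ac)
      ultimately show ?thesis by simp
    qed
  qed
qed

text \<open>
  Going down from \<open>F\<close>, each step adds to \<open>L\<close> a cyclic module whose annihilator is an associated
  prime. If that prime contains the whole part of degree one, then the step changes only finitely
  many degrees; otherwise the prime joins the list of those to be avoided.
\<close>
lemma superficial:
  assumes F: "graded I F" and L: "graded I L" "L \<le> F"
    and acc: "acc {L'. graded I L' \<and> L \<le> L' \<and> L' \<le> F}"
  shows "\<exists>\<Q>. finite \<Q> \<and> (\<forall>Q\<in>\<Q>. graded_prime Q) \<and> (\<forall>m x. x \<in> Ip m \<longrightarrow> (\<forall>Q\<in>\<Q>. x \<notin> Q m) \<longrightarrow>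
    (\<exists>n0. \<forall>n\<ge>n0. \<forall>u\<in>F n. x \<bullet> u \<in> L (n + m) \<longrightarrow> u \<in> L n))"
proof -
  have "L \<in> {L'. graded I L' \<and> L \<le> L' \<and> L' \<le> F}" using L by blast
  with acc show ?thesis
  proof (induction L rule: acc_induct)
    case (step K)
    then have K: "graded I K" "L \<le> K" "K \<le> F" by auto
    show ?case
    proof (cases "K = F")
      case True
      then show ?thesis by (intro exI[of _ "{}"]) auto
    next
      case False
      have accK: "acc {L'. graded I L' \<and> K \<le> L' \<and> L' \<le> F}"
        by (rule acc_mono[OF acc]) (use K(2) in auto)
      obtain k u where u: "u \<in> F k" "u \<notin> K k" and prime:
        "\<And>i l a c. a \<in> Ip i \<Longrightarrow> c \<in> Ip l \<Longrightarrow> a \<otimes> c \<in> colon K k u (i + l) \<Longrightarrow> a \<in> colon K k u i \<or> c \<in> colon K k u l"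
        by (rule associated_graded_prime[OF F K(1,3) False accK]) (rule that)
      have uM: "u \<in> carrier M" using u submodule_carr[OF graded_sub[OF F]] by blast
      have hI: "graded_ideal Ip" unfolding graded_ideal_def
        using Ip_ideal Ip_mult[of _ "Suc 0"] Ip_1 by auto
      define K' where "K' = add_cyclic K Ip k u"
      have K': "graded I K'" "K \<le> K'" "K' \<le> F"
        unfolding K'_def using add_cyclic_graded[OF K(1) hI uM] add_cyclic_bound[OF F K(3) hI u(1)] by (auto simp: le_fun_def)
      have "u \<in> K' k"
      proof -
        have "u = \<zero>\<^bsub>M\<^esub> \<oplus>\<^bsub>M\<^esub> \<one> \<bullet> u" using uM by simp
        then show ?thesis unfolding K'_def add_cyclic_def mem_set_add
          using submodule_zero[OF graded_sub[OF K(1)]] Ip_0 by force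
      qed
      then have "K < K'" using K'(2) u(2) by (auto simp: less_le)
      then obtain \<Q> where Q: "finite \<Q>" "\<forall>Q\<in>\<Q>. graded_prime Q"
        "\<And>m x. x \<in> Ip m \<Longrightarrow> (\<forall>Q\<in>\<Q>. x \<notin> Q m) \<Longrightarrow>
          (\<exists>n0. \<forall>n\<ge>n0. \<forall>u\<in>F n. x \<bullet> u \<in> K' (n + m) \<longrightarrow> u \<in> K' n)"
        using step.IH[of K'] K' order_trans[OF K(2) K'(2)] by (simp, blast)
      show ?thesis
      proof (cases "I \<subseteq> colon K k u (Suc 0)")
        case True
        \<comment> \<open>Here \<open>I\<close> kills \<open>u\<close> modulo \<open>K\<close>, so
          the added cyclic module lives in degree \<open>k\<close> only, and raising
          \<open>n0\<close> beyond \<open>k\<close> hides it.\<close>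
        have eq: "K' n \<subseteq> K n" if n: "n > k" for n
        proof -
          obtain i where i: "n - k = Suc i" using n by (metis Suc_diff_Suc)
          have "Ip (Suc i) \<subseteq> {r \<in> carrier R. r \<bullet> u \<in> K n}"
          proof (rule Ip_Suc_subset[OF colon_ideal[OF graded_sub[OF K(1)] uM]])
            fix a b assume ab: "a \<in> Ip i" "b \<in> I"
            have c: "a \<in> carrier R" "b \<in> carrier R" using ab Ip_carrier ideal.Icarr[OF I] by blast+
            have "b \<bullet> u \<in> K (k + Suc 0)" using True ab(2) unfolding colon_def by blast
            then have "a \<bullet> (b \<bullet> u) \<in> K (k + Suc 0 + i)" by (rule graded_Ip[OF K(1) ab(1)])
            moreover have "k + Suc 0 + i = n" using i n by simp
            ultimately show "a \<otimes> b \<in> {r \<in> carrier R. r \<bullet> u \<in> K n}"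
              using c uM by (simp add: smult_assoc1)
          qed
          then show ?thesis unfolding K'_def add_cyclic_def
            by (intro set_add_least[OF graded_sub[OF K(1)]]) (use n i in auto)
        qed
        have "\<exists>n0. \<forall>n\<ge>n0. \<forall>u\<in>F n. x \<bullet> u \<in> K (n + m) \<longrightarrow> u \<in> K n"
          if x: "x \<in> Ip m" "\<forall>Q\<in>\<Q>. x \<notin> Q m" for m x
        proof -
          obtain n0 where n0: "\<forall>n\<ge>n0. \<forall>u\<in>F n. x \<bullet> u \<in> K' (n + m) \<longrightarrow> u \<in> K' n"
            using Q(3)[OF x] by blast
          have "v \<in> K n" if "n \<ge> max n0 (Suc k)" "v \<in> F n" "x \<bullet> v \<in> K (n + m)" for n v
          proof -
            have "x \<bullet> v \<in> K' (n + m)" using K'(2) that(3) unfolding le_fun_def by blast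
            then have "v \<in> K' n" using n0 that by auto
            then show ?thesis using eq[of n] that(1) by auto
          qed
          then show ?thesis by blast
        qed
        then show ?thesis using Q(1,2) by blast
      next
        case notI: False
        define P where "P = colon K k u"
        have hP: "graded_prime P" unfolding graded_prime_def
        proof (intro conjI allI ballI impI)
          show "ideal (P k) R" "P k \<subseteq> Ip k" for k
            using colon_graded_ideal[OF K(1) uM] unfolding P_def graded_ideal_def by blast+
          show "\<not> I \<subseteq> P (Suc 0)" using notI unfolding P_def .
          show "a \<in> P j \<or> b \<in> P l" if "a \<in> Ip j" "b \<in> Ip l" "a \<otimes> b \<in> P (j + l)" for a b j l
            using prime that unfolding P_def by blast
          fix j l a b assume a: "a \<in> Ip j" and b: "b \<in> P l"
          have c: "a \<in> carrier R" "b \<in> carrier R" "b \<in> Ip l" using a b Ip_carrier unfolding P_def colon_def by blast+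
          have "a \<bullet> (b \<bullet> u) \<in> K (k + l + j)"
            using graded_Ip[OF K(1) a] b unfolding P_def colon_def by blast
          then show "a \<otimes> b \<in> P (j + l)"
            using c a uM Ip_mult[OF a c(3)] unfolding P_def colon_def by (simp add: smult_assoc1 add_ac)
        qed
        have "\<exists>n0. \<forall>n\<ge>n0. \<forall>u\<in>F n. x \<bullet> u \<in> K (n + m) \<longrightarrow> u \<in> K n"
          if x: "x \<in> Ip m" "\<forall>Q\<in>insert P \<Q>. x \<notin> Q m" for m x
        proof -
          have xR: "x \<in> carrier R" using x Ip_carrier by blast
          obtain n0 where n0: "\<forall>n\<ge>n0. \<forall>u\<in>F n. x \<bullet> u \<in> K' (n + m) \<longrightarrow> u \<in> K' n"
            using Q(3)[OF x(1)] x(2) by blast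
          have "v \<in> K n" if n: "n \<ge> max n0 k" "v \<in> F n" and xv: "x \<bullet> v \<in> K (n + m)" for n v
          proof -
            have "x \<bullet> v \<in> K' (n + m)" using K'(2) xv unfolding le_fun_def by blast
            then have "v \<in> K' n" using n0 n by auto
            then obtain l r where l: "l \<in> K n" and r: "r \<in> Ip (n - k)" and v: "v = l \<oplus>\<^bsub>M\<^esub> r \<bullet> u"
              unfolding K'_def add_cyclic_def using n by (auto simp: mem_set_add)
            have c: "l \<in> carrier M" "r \<in> carrier R"
              using l r submodule_carr[OF graded_sub[OF K(1)]] Ip_carrier by auto
            have "x \<bullet> v = x \<bullet> l \<oplus>\<^bsub>M\<^esub> x \<bullet> (r \<bullet> u)" using v c xR uM smult_r_distr by simp
            moreover have "x \<bullet> l \<in> K (n + m)" using graded_Ip[OF K(1) x(1) l] .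
            ultimately have "x \<bullet> (r \<bullet> u) \<in> K (n + m)"
              using submodule_cancel[OF graded_sub[OF K(1)], of "x \<bullet> l" "n + m" "x \<bullet> (r \<bullet> u)"]
                xv xR c uM by simp
            moreover have "k + (m + (n - k)) = n + m" using n(1) by simp
            \<comment> \<open>Outside \<open>P\<close>, the element \<open>x\<close> acts
              injectively on the cyclic module generated by \<open>u\<close> modulo
              \<open>K\<close>: if \<open>x \<otimes> r\<close> annihilates \<open>u\<close>, then
              so does \<open>r\<close>.\<close>
            ultimately have "x \<otimes> r \<in> P (m + (n - k))"
              using Ip_mult[OF x(1) r] c xR uM unfolding P_def colon_def by (simp add: smult_assoc1 add.commute)
            then have "r \<in> P (n - k)" using graded_primeD(4)[OF hP x(1) r] x(2) by blast
            then have "r \<bullet> u \<in> K n" unfolding P_def colon_def using n(1) by simp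
            then show ?thesis using v l submoduleE(5)[OF graded_sub[OF K(1)]] by blast
          qed
          then show ?thesis by blast
        qed
        then show ?thesis using Q(1,2) hP by (intro exI[of _ "insert P \<Q>"]) simp
      qed
    qed
  qed
qed

end

section \<open>Chains of controlled length\<close>

lemma eventually_constant_increasing:
  assumes "finite \<Lambda>" "\<And>n. n \<ge> n0 \<Longrightarrow> S n \<subseteq> S (Suc n)" "\<And>n. n \<ge> n0 \<Longrightarrow> S n \<subseteq> \<Lambda>"
  shows "\<exists>\<Lambda>'. \<forall>\<^sub>F n in sequentially. S n = \<Lambda>'"
proof -
  define \<Lambda>' where "\<Lambda>' = (\<Union>n\<in>{n0..}. S n)"
  have mono: "S i \<subseteq> S j" if "n0 \<le> i" "i \<le> j" for i j
    using that(2)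
  proof (induction j rule: dec_induct)
    case (step n)
    then show ?case using assms(2)[of n] that(1) by simp
  qed simp
  have "\<forall>\<^sub>F n in sequentially. \<forall>x\<in>\<Lambda>'. x \<in> S n"
  proof (rule eventually_ball_finite)
    show "finite \<Lambda>'" using assms(1,3) unfolding \<Lambda>'_def by (meson UN_least atLeast_iff finite_subset)
    show "\<forall>x\<in>\<Lambda>'. \<forall>\<^sub>F n in sequentially. x \<in> S n"
    proof
      fix x assume "x \<in> \<Lambda>'"
      then obtain i where "n0 \<le> i" "x \<in> S i" unfolding \<Lambda>'_def by auto
      then show "\<forall>\<^sub>F n in sequentially. x \<in> S n"
        using mono unfolding eventually_sequentially by blast
    qed
  qed
  moreover have "\<forall>\<^sub>F n in sequentially. n \<ge> n0" by (rule eventually_ge_at_top)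
  ultimately have "\<forall>\<^sub>F n in sequentially. S n = \<Lambda>'"
    by eventually_elim (auto simp: \<Lambda>'_def)
  then show ?thesis by blast
qed

text \<open>Splices along \<open>n\<close>, \<open>n - s\<close>, \<open>n - 2 s\<close> and so on,
  where \<open>s = Suc m\<close> is the degree of the superficial element. In the application the
  indices from \<open>n0\<close> to \<open>n0 + m\<close> supply one initial chain for each residue
  class modulo \<open>s\<close>.\<close>

fun iterate_append :: "(nat \<Rightarrow> 'x list) \<Rightarrow> (nat \<Rightarrow> 'x list) \<Rightarrow> nat \<Rightarrow> nat \<Rightarrow> nat \<Rightarrow> 'x list" where
  "iterate_append bs qs n0 m n =
     (if n < n0 + Suc m then bs n else iterate_append bs qs n0 m (n - Suc m) @ qs n)"

declare iterate_append.simps [simp del]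

text \<open>Each appended list lowers the index by at least one, so at most \<open>n\<close> of them
  occur.\<close>

lemma length_iterate_append:
  assumes "\<And>j. j < n0 + Suc m \<Longrightarrow> length (bs j) \<le> K" "\<And>j. j \<le> N \<Longrightarrow> length (qs j) \<le> q" "n \<le> N"
  shows "length (iterate_append bs qs n0 m n) \<le> K + n * q"
  using assms(3)
proof (induction n rule: less_induct)
  case (less n)
  show ?case
  proof (cases "n < n0 + Suc m")
    case True
    then show ?thesis using assms(1)[of n] by (simp add: iterate_append.simps[of _ _ _ _ n])
  next
    case False
    then have "length (iterate_append bs qs n0 m (n - Suc m)) \<le> K + (n - Suc m) * q"
      using less by simp
    moreover have "length (qs n) \<le> q" using assms(2) less by blast
    moreover have "(n - Suc m) * q + q \<le> n * q"
    proof -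
      have "(n - Suc m) * q + q = Suc (n - Suc m) * q" by simp
      also have "\<dots> \<le> n * q" by (rule mult_le_mono1) (use False in simp)
      finally show ?thesis .
    qed
    ultimately show ?thesis using False by (simp add: iterate_append.simps[of _ _ _ _ n])
  qed
qed

lemma set_iterate_append:
  "set (iterate_append bs qs n0 m n) \<subseteq> (\<Union>j<n0 + Suc m. set (bs j)) \<union> (\<Union>j. set (qs j))"
proof (induction n rule: less_induct)
  case (less n)
  show ?case
  proof (cases "n < n0 + Suc m")
    case True
    then show ?thesis by (auto simp: iterate_append.simps[of _ _ _ _ n])
  next
    case False
    then show ?thesis using less[of "n - Suc m"] by (auto simp: iterate_append.simps[of _ _ _ _ n])
  qed
qed

text \<open>The bound \<open>None\<close> stands for infinity.\<close>
definition (in ring) dim_le :: "'a set \<Rightarrow> nat option \<Rightarrow> bool" where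
  "dim_le J b \<longleftrightarrow> (\<forall>d k Q. b = Some d \<longrightarrow> (\<forall>i\<le>k. primeideal (Q i) R) \<longrightarrow>
     (\<forall>i<k. Q i \<subset> Q (Suc i)) \<longrightarrow> J \<subseteq> Q (0::nat) \<longrightarrow> k \<le> d)"

lemma (in ring) dim_le_mono: "dim_le J b \<Longrightarrow> J \<subseteq> J' \<Longrightarrow> dim_le J' b"
  unfolding dim_le_def by blast

text \<open>Prepending \<open>P\<close> lengthens every chain of primes above \<open>Q\<close> by
  one. The chain consisting of \<open>Q\<close> alone already shows that \<open>d\<close> is
  positive.\<close>

lemma (in ring) dim_le_prime:
  assumes J: "dim_le P (Some d)" and P: "primeideal P R" "primeideal Q R" "P \<subset> Q"
  obtains d' where "d = Suc d'" "dim_le Q (Some d')"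
proof -
  have step: "Suc k \<le> d" if "\<forall>i\<le>k. primeideal (S i) R" "\<forall>i<k. S i \<subset> S (Suc i)" "Q \<subseteq> S (0::nat)" for k S
  proof -
    define T where "T i = (case i of 0 \<Rightarrow> P | Suc j \<Rightarrow> S j)" for i
    have "\<forall>i\<le>Suc k. primeideal (T i) R" using that P unfolding T_def by (auto split: nat.split)
    moreover have "\<forall>i<Suc k. T i \<subset> T (Suc i)" using that P unfolding T_def by (auto split: nat.split)
    moreover have "P \<subseteq> T 0" unfolding T_def by simp
    ultimately show ?thesis using J unfolding dim_le_def by blast
  qed
  from step[of 0 "\<lambda>_. Q"] P have "d \<ge> 1" by simp
  then obtain d' where d: "d = Suc d'" by (cases d) auto
  then have "dim_le Q (Some d')" unfolding dim_le_def using step by auto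
  then show thesis using that d by blast
qed

text \<open>The finite generation of \<open>M\<close> and of its Rees module enters through the two
  chain conditions, which also serve all subquotients.\<close>

locale filtration = ideal_powers +
  fixes Mn :: "nat \<Rightarrow> 'c set"
  assumes graded_Mn: "graded I Mn" and Mn_Suc: "Mn (Suc n) \<subseteq> Mn n" and Mn_0: "Mn 0 = carrier M"
    and acc_sub: "acc {N. submodule N R M}" and acc_fil: "acc {L. graded I L \<and> L \<le> Mn}"
begin

text \<open>\<open>B / Fil A B n\<close> is the quotient of \<open>B/A\<close> by the \<open>n\<close>-th term of the induced filtration.\<close>
definition Fil :: "'c set \<Rightarrow> 'c set \<Rightarrow> nat \<Rightarrow> 'c set" where
  "Fil A B n = A <+>\<^bsub>M\<^esub> (B \<inter> Mn n)"

lemma Mn_le: "n \<le> n' \<Longrightarrow> Mn n' \<subseteq> Mn n"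
  using lift_Suc_antimono_le[of Mn] Mn_Suc by blast

lemma Mn_sub: "submodule (Mn n) R M"
  by (rule graded_sub[OF graded_Mn])

lemma Fil_sub: "submodule A R M \<Longrightarrow> submodule B R M \<Longrightarrow> submodule (Fil A B n) R M"
  unfolding Fil_def by (intro submodule_set_add submodule_Int Mn_sub)

lemma Fil_le: "n \<le> n' \<Longrightarrow> Fil A B n' \<subseteq> Fil A B n"
  unfolding Fil_def by (intro set_add_mono order_refl Int_mono Mn_le)

lemma Fil_bounds:
  assumes "submodule A R M" "submodule B R M" "A \<subseteq> B"
  shows "A \<subseteq> Fil A B n" "Fil A B n \<subseteq> B"
  unfolding Fil_def
  using subset_set_add(1)[OF assms(1) submodule_Int[OF assms(2) Mn_sub]] set_add_least[OF assms(2,3)]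
  by auto

lemma Fil_graded:
  assumes A: "submodule A R M" and B: "submodule B R M"
  shows "graded I (Fil A B)"
  unfolding graded_def
proof (intro conjI allI ballI)
  show "submodule (Fil A B n) R M" for n by (rule Fil_sub[OF A B])
  fix n a v assume a: "a \<in> I" and "v \<in> Fil A B n"
  then obtain w b where w: "w \<in> A" "b \<in> B" "b \<in> Mn n" "v = w \<oplus>\<^bsub>M\<^esub> b" unfolding Fil_def mem_set_add by blast
  have aR: "a \<in> carrier R" using ideal.Icarr[OF I a] .
  have "a \<bullet> v = a \<bullet> w \<oplus>\<^bsub>M\<^esub> a \<bullet> b"
    using w aR submodule_carr[OF A] submodule_carr[OF B] smult_r_distr by simp
  moreover have "a \<bullet> b \<in> Mn (Suc n)" using graded_Mn a w(3) unfolding graded_def by blast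
  ultimately show "a \<bullet> v \<in> Fil A B (Suc n)"
    unfolding Fil_def mem_set_add using submoduleE(4)[OF A aR w(1)] submoduleE(4)[OF B aR w(2)] by blast
qed

text \<open>A family in this interval contains \<open>A\<close>, so by the modular law
  \<open>L n\<close> is the sum of \<open>A\<close> and \<open>L n \<inter> Mn n\<close>;
  intersecting with \<open>Mn\<close> loses nothing. The lower bound is the shifted filtration, so
  that the interval describes the associated graded module of \<open>B/A\<close>.\<close>

lemma acc_Fil:
  assumes A: "submodule A R M" and B: "submodule B R M" and AB: "A \<subseteq> B"
  shows "acc {L. graded I L \<and> (\<lambda>n. Fil A B (Suc n)) \<le> L \<and> L \<le> Fil A B}"
proof (rule acc_map[OF acc_fil, where f="\<lambda>L n. L n \<inter> Mn n"])
  fix L assume "L \<in> {L. graded I L \<and> (\<lambda>n. Fil A B (Suc n)) \<le> L \<and> L \<le> Fil A B}"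
  then have L: "graded I L" "\<And>n. Fil A B (Suc n) \<subseteq> L n" "\<And>n. L n \<subseteq> Fil A B n"
    by (auto simp: le_fun_def)
  show "(\<lambda>n. L n \<inter> Mn n) \<in> {L. graded I L \<and> L \<le> Mn}"
    using L(1) graded_Mn submodule_Int unfolding graded_def le_fun_def by simp
  fix L' assume "L' \<in> {L. graded I L \<and> (\<lambda>n. Fil A B (Suc n)) \<le> L \<and> L \<le> Fil A B}"
    and le: "L \<le> L'"
  then have L': "graded I L'" "\<And>n. L' n \<subseteq> Fil A B n" by (auto simp: le_fun_def)
  show "(\<lambda>n. L n \<inter> Mn n) \<le> (\<lambda>n. L' n \<inter> Mn n)" using le unfolding le_fun_def by blast
  assume eq: "(\<lambda>n. L n \<inter> Mn n) = (\<lambda>n. L' n \<inter> Mn n)"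
  have "v \<in> L n" if v: "v \<in> L' n" for v n
  proof -
    obtain a b where ab: "a \<in> A" "b \<in> B" "b \<in> Mn n" "v = a \<oplus>\<^bsub>M\<^esub> b"
    proof -
      have "v \<in> A <+>\<^bsub>M\<^esub> (B \<inter> Mn n)" using v L'(2) unfolding Fil_def by blast
      then show ?thesis using that unfolding mem_set_add by blast
    qed
    have aL: "a \<in> L n" using Fil_bounds(1)[OF A B AB] L(2) ab(1) by blast
    then have "a \<in> L' n" using le unfolding le_fun_def by blast
    then have "b \<in> L' n"
      using submodule_cancel[OF graded_sub[OF L'(1)], of a n b] v ab submodule_carr[OF B] by simp
    then have "b \<in> L n" using fun_cong[OF eq, of n] ab(3) by blast
    then show ?thesis using aL ab(4) submoduleE(5)[OF graded_sub[OF L(1)]] by simp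
  qed
  then show "L = L'" using le by (intro order.antisym) (auto simp: le_fun_def)
qed

text \<open>In the associated graded module, \<open>u\<close> in \<open>F n\<close> with
  \<open>x \<bullet> u\<close> in \<open>F (n + s + 1)\<close> lies in \<open>F (n + 1)\<close>, for
  large \<open>n\<close> and \<open>s = Suc m\<close>. An element of \<open>F n0\<close> is moved
  down by one degree at a time, which replaces \<open>F n\<close> by \<open>F n0\<close> in the
  hypothesis.\<close>

lemma Fil_superficial:
  assumes A: "submodule A R M" and B: "submodule B R M" and AB: "A \<subseteq> B"
  shows "\<exists>m x n0. x \<in> Ip (Suc m) \<and> (infinite_residue_fields R \<longrightarrow> m = 0) \<and>
    (\<forall>n\<ge>n0. \<forall>u\<in>Fil A B n0. x \<bullet> u \<in> Fil A B (n + Suc m) \<longrightarrow> u \<in> Fil A B n)"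
proof -
  let ?L = "\<lambda>n. Fil A B (Suc n)"
  have F: "graded I (Fil A B)" by (rule Fil_graded[OF A B])
  then have L: "graded I ?L" "?L \<le> Fil A B"
    unfolding graded_def using Fil_le by (auto simp: le_fun_def)
  obtain \<Q> where Q: "finite \<Q>" "\<And>Q. Q \<in> \<Q> \<Longrightarrow> graded_prime Q"
    "\<And>m x. x \<in> Ip m \<Longrightarrow> (\<forall>Q\<in>\<Q>. x \<notin> Q m) \<Longrightarrow>
      \<exists>n0. \<forall>n\<ge>n0. \<forall>u\<in>Fil A B n. x \<bullet> u \<in> ?L (n + m) \<longrightarrow> u \<in> ?L n"
    using superficial[OF F L acc_Fil[OF A B AB]] by blast
  \<comment> \<open>The degree one parts of the primes in \<open>\<Q>\<close> are ideals of
    \<open>R\<close> that do not contain \<open>I\<close>, but they need not be prime. Over infinite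
    residue fields they can still be avoided inside \<open>I\<close>; otherwise the degree must be
    allowed to grow.\<close>
  have "\<exists>m x. x \<in> Ip (Suc m) \<and> (infinite_residue_fields R \<longrightarrow> m = 0) \<and> (\<forall>Q\<in>\<Q>. x \<notin> Q (Suc m))"
  proof (cases "infinite_residue_fields R")
    case True
    have "\<exists>x\<in>I. \<forall>J\<in>(\<lambda>Q. Q (Suc 0)) ` \<Q>. x \<notin> J"
      by (rule R.avoid_ideals[OF R.noetherian_ring_axioms True I]) (use Q graded_primeD in auto)
    then show ?thesis using Ip_1 by auto
  next
    case False
    then show ?thesis using graded_prime_avoidance[OF Q(1,2)] by blast
  qed
  then obtain m x where x: "x \<in> Ip (Suc m)" "infinite_residue_fields R \<longrightarrow> m = 0" "\<forall>Q\<in>\<Q>. x \<notin> Q (Suc m)"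
    by blast
  obtain n0 where n0: "\<And>n u. n \<ge> n0 \<Longrightarrow> u \<in> Fil A B n \<Longrightarrow> x \<bullet> u \<in> Fil A B (Suc (n + Suc m)) \<Longrightarrow> u \<in> Fil A B (Suc n)"
    using Q(3)[OF x(1,3)] by blast
  have "u \<in> Fil A B n" if "n \<ge> n0" "u \<in> Fil A B n0" "x \<bullet> u \<in> Fil A B (n + Suc m)" for n u
    using that
  proof (induction n rule: dec_induct)
    case (step n)
    have "x \<bullet> u \<in> Fil A B (n + Suc m)" using step.prems(2) Fil_le[of "n + Suc m" "Suc n + Suc m"] by auto
    then have "u \<in> Fil A B n" using step by blast
    then show ?case using n0[of n u] step by simp
  qed
  then show ?thesis using x(1,2) by blast
qed

text \<open>One sequence \<open>ps\<close> meets all requirements at once, because the stabilizing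
  filtrations must also satisfy the growth bound. The base \<open>Suc n\<close> keeps the bound
  meaningful at \<open>n = 0\<close>.\<close>

definition bounded_chains :: "nat option \<Rightarrow> 'c set \<Rightarrow> 'c set \<Rightarrow> bool" where
  "bounded_chains b A B \<longleftrightarrow> (\<exists>\<Lambda> ps. finite \<Lambda> \<and> (\<forall>n. prime_chain (Fil A B n) B (ps n) \<and> set (ps n) \<subseteq> \<Lambda>) \<and>
     (\<forall>d. b = Some d \<longrightarrow> (\<exists>K. \<forall>n. length (ps n) \<le> K * Suc n ^ d)) \<and>
     (infinite_residue_fields R \<longrightarrow> (\<exists>\<Lambda>'. \<forall>\<^sub>F n in sequentially. set (ps n) = \<Lambda>')))"

lemma Fil_same: "submodule A R M \<Longrightarrow> Fil A A n = A"
  using Fil_bounds[of A A n] by blast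

lemma bounded_chains_refl: "submodule A R M \<Longrightarrow> bounded_chains b A A"
  unfolding bounded_chains_def
  by (intro exI[of _ "{}"] exI[of _ "\<lambda>_. []"]) (auto simp: Fil_same intro: prime_chain.Nil)

lemma bounded_chains_trans:
  assumes A: "submodule A R M" and B: "submodule B R M" and C: "submodule C R M"
    and AB: "A \<subseteq> B" and BC: "B \<subseteq> C" and AB': "bounded_chains b A B" and BC': "bounded_chains b B C"
  shows "bounded_chains b A C"
proof -
  obtain \<Lambda>1 ps where 1: "finite \<Lambda>1" "\<And>n. prime_chain (Fil A B n) B (ps n)" "\<And>n. set (ps n) \<subseteq> \<Lambda>1"
    "\<And>d. b = Some d \<Longrightarrow> \<exists>K. \<forall>n. length (ps n) \<le> K * Suc n ^ d"
    "infinite_residue_fields R \<Longrightarrow> \<exists>\<Lambda>'. \<forall>\<^sub>F n in sequentially. set (ps n) = \<Lambda>'"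
    using AB' unfolding bounded_chains_def by blast
  obtain \<Lambda>2 qs where 2: "finite \<Lambda>2" "\<And>n. prime_chain (Fil B C n) C (qs n)" "\<And>n. set (qs n) \<subseteq> \<Lambda>2"
    "\<And>d. b = Some d \<Longrightarrow> \<exists>K. \<forall>n. length (qs n) \<le> K * Suc n ^ d"
    "infinite_residue_fields R \<Longrightarrow> \<exists>\<Lambda>'. \<forall>\<^sub>F n in sequentially. set (qs n) = \<Lambda>'"
    using BC' unfolding bounded_chains_def by blast
  have "prime_chain (Fil A C n) C (ps n @ qs n)" for n
  proof -
    let ?D = "C \<inter> Mn n"
    have D: "submodule ?D R M" by (rule submodule_Int[OF C Mn_sub])
    have one: "(\<bullet>) \<one> ` S = S" if "submodule S R M" for S
      using submodule_carr[OF that] by force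
    have FAB: "submodule (Fil A B n) R M" by (rule Fil_sub[OF A B])
    \<comment> \<open>By the second isomorphism theorem, \<open>Fil B C n\<close> modulo
      \<open>Fil A C n\<close> is \<open>B\<close> modulo \<open>Fil A B n\<close>: both terms arise
      by adding \<open>C \<inter> Mn n\<close>.\<close>
    have "prime_chain ((\<bullet>) \<one> ` Fil A B n <+>\<^bsub>M\<^esub> ?D) ((\<bullet>) \<one> ` B <+>\<^bsub>M\<^esub> ?D) (ps n)"
    proof (rule prime_chain_transport[OF 1(2) R.one_closed D])
      fix v assume v: "v \<in> B" "\<one> \<bullet> v \<in> ?D"
      then have "v \<in> B \<inter> Mn n" using submodule_carr[OF B] by simp
      then show "v \<in> Fil A B n"
        using subset_set_add(2)[OF A submodule_Int[OF B Mn_sub]] unfolding Fil_def by blast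
    qed
    moreover have "Fil A B n <+>\<^bsub>M\<^esub> ?D = Fil A C n"
    proof (rule equalityI)
      show "Fil A B n <+>\<^bsub>M\<^esub> ?D \<subseteq> Fil A C n"
      proof (rule set_add_least[OF Fil_sub[OF A C]])
        show "Fil A B n \<subseteq> Fil A C n" 
          unfolding Fil_def by (intro set_add_mono order_refl Int_mono BC)
        show "?D \<subseteq> Fil A C n" unfolding Fil_def by (rule subset_set_add(2)[OF A D])
      qed
      show "Fil A C n \<subseteq> Fil A B n <+>\<^bsub>M\<^esub> ?D" unfolding Fil_def[of A C]
      proof (rule set_add_least[OF submodule_set_add[OF FAB D]])
        show "A \<subseteq> Fil A B n <+>\<^bsub>M\<^esub> ?D"
          using Fil_bounds(1)[OF A B AB] subset_set_add(1)[OF FAB D] by blast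
        show "?D \<subseteq> Fil A B n <+>\<^bsub>M\<^esub> ?D" by (rule subset_set_add(2)[OF FAB D])
      qed
    qed
    ultimately have "prime_chain (Fil A C n) (Fil B C n) (ps n)"
      unfolding one[OF FAB] one[OF B] Fil_def[of B C] by simp
    then show ?thesis using prime_chain_append 2(2) by blast
  qed
  moreover have "\<exists>K. \<forall>n. length (ps n @ qs n) \<le> K * Suc n ^ d" if b: "b = Some d" for d
  proof -
    obtain K1 K2 where "\<forall>n. length (ps n) \<le> K1 * Suc n ^ d" "\<forall>n. length (qs n) \<le> K2 * Suc n ^ d"
      using 1(4)[OF b] 2(4)[OF b] by blast
    then have "length (ps n @ qs n) \<le> (K1 + K2) * Suc n ^ d" for n
      unfolding length_append distrib_right by (intro add_mono) auto
    then show ?thesis by blast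
  qed
  moreover have "\<exists>\<Lambda>'. \<forall>\<^sub>F n in sequentially. set (ps n @ qs n) = \<Lambda>'" if inf: "infinite_residue_fields R"
  proof -
    obtain S T where "\<forall>\<^sub>F n in sequentially. set (ps n) = S" "\<forall>\<^sub>F n in sequentially. set (qs n) = T"
      using 1(5)[OF inf] 2(5)[OF inf] by blast
    then have "\<forall>\<^sub>F n in sequentially. set (ps n @ qs n) = S \<union> T" by eventually_elim simp
    then show ?thesis by blast
  qed
  moreover have "set (ps n @ qs n) \<subseteq> \<Lambda>1 \<union> \<Lambda>2" for n using 1(3)[of n] 2(3)[of n] by auto
  ultimately show ?thesis unfolding bounded_chains_def using 1(1) 2(1)
    by (intro exI[of _ "\<Lambda>1 \<union> \<Lambda>2"] exI[of _ "\<lambda>n. ps n @ qs n"]) simp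
qed

lemma bounded_chains_prime_chain:
  assumes "prime_chain A B Ps" "\<And>P A B. P \<in> set Ps \<Longrightarrow> prime_step A B P \<Longrightarrow> bounded_chains b A B"
  shows "bounded_chains b A B"
  using assms
proof (induction rule: prime_chain.induct)
  case (Nil A)
  show ?case using Nil.hyps by (rule bounded_chains_refl)
next
  case (Cons A B P C Ps)
  have "bounded_chains b A B" "bounded_chains b B C" using Cons by auto
  then show ?case
    using bounded_chains_trans prime_step_submodule(1-3)[OF Cons.hyps(1)] prime_chain_submodule[OF Cons.hyps(2)] by blast
qed

text \<open>Finitely many chains serve all \<open>n\<close>, so the lengths are bounded and every
  exponent is allowed.\<close>

lemma bounded_chains_stationary:
  assumes A: "submodule A R M" and B: "submodule B R M" and AB: "A \<subseteq> B"
    and const: "\<And>n. n \<ge> n0 \<Longrightarrow> Fil A B n = Fil A B n0"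
  shows "bounded_chains b A B"
proof -
  have "\<exists>ps. prime_chain (Fil A B n) B ps" for n
    by (rule prime_chain_exists[OF R.noetherian_ring_axioms acc_sub Fil_sub[OF A B] B Fil_bounds(2)[OF A B AB]])
  then obtain c where c: "\<And>n. prime_chain (Fil A B n) B (c n)" by metis
  define ps where "ps n = c (min n n0)" for n
  have "prime_chain (Fil A B n) B (ps n)" for n
    using c[of n] c[of n0] const[of n] unfolding ps_def by (cases "n \<le> n0") (auto simp: min_def)
  moreover have "set (ps n) \<subseteq> (\<Union>i\<le>n0. set (c i))" for n
    unfolding ps_def by (rule UN_upper) simp
  moreover have "\<exists>K. \<forall>n. length (ps n) \<le> K * Suc n ^ d" for d
  proof -
    have "length (ps n) \<le> (\<Sum>i\<le>n0. length (c i)) * Suc n ^ d" for n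
    proof -
      have "length (ps n) \<le> (\<Sum>i\<le>n0. length (c i))"
        unfolding ps_def by (rule member_le_sum[where f="\<lambda>i. length (c i)"]) auto
      also have "\<dots> \<le> (\<Sum>i\<le>n0. length (c i)) * Suc n ^ d" by simp
      finally show ?thesis .
    qed
    then show ?thesis by blast
  qed
  moreover have "\<forall>\<^sub>F n in sequentially. set (ps n) = set (c n0)"
    using eventually_ge_at_top[of n0] by eventually_elim (simp add: ps_def min_def)
  ultimately show ?thesis unfolding bounded_chains_def
    by (intro exI[of _ "\<Union>i\<le>n0. set (c i)"] exI[of _ ps]) auto
qed

text \<open>
  Multiplication by the superficial element \<open>x\<close> identifies \<open>F\<^sub>0/F n\<close>, where \<open>F\<^sub>0 = F n0\<close>, with
  \<open>(x F\<^sub>0 + F (n + m + 1)) / F (n + m + 1)\<close>, so chains for \<open>n + m + 1\<close> arise from those for \<open>n\<close> by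
  appending chains for \<open>F\<^sub>0/A'\<close>. If \<open>m = 0\<close>, then the set of primes increases with \<open>n\<close>.
\<close>
lemma bounded_chains_superficial:
  assumes A: "submodule A R M" and B: "submodule B R M" and AB: "A \<subseteq> B"
    and x: "x \<in> Ip (Suc m)" and m: "infinite_residue_fields R \<longrightarrow> m = 0"
    and sup: "\<And>n u. n \<ge> n0 \<Longrightarrow> u \<in> Fil A B n0 \<Longrightarrow> x \<bullet> u \<in> Fil A B (n + Suc m) \<Longrightarrow> u \<in> Fil A B n"
    and A': "A' = A <+>\<^bsub>M\<^esub> (\<bullet>) x ` Fil A B n0"
    and \<Lambda>: "finite \<Lambda>" and qs: "\<And>n. prime_chain (Fil A' (Fil A B n0) n) (Fil A B n0) (qs n)" "\<And>n. set (qs n) \<subseteq> \<Lambda>"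
    and len: "\<And>d. b = Some d \<Longrightarrow> \<exists>K. \<forall>N. \<forall>j\<le>N. Suc N * length (qs j) \<le> K * Suc N ^ d"
  shows "bounded_chains b A B"
proof -
  let ?F = "Fil A B"
  have xR: "x \<in> carrier R" using x Ip_carrier by blast
  have Fs: "submodule (?F n) R M" for n by (rule Fil_sub[OF A B])
  have FB: "?F n \<subseteq> B" and AF: "A \<subseteq> ?F n" for n using Fil_bounds[OF A B AB] by blast+
  have xF: "submodule ((\<bullet>) x ` ?F n) R M" for n by (rule submodule_smult_set[OF Fs xR])
  have xFn: "(\<bullet>) x ` ?F n \<subseteq> ?F (n + Suc m)" for n
    using graded_Ip[OF Fil_graded[OF A B] x] by blast
  have "\<exists>ps. prime_chain (?F n) B ps" for n
    by (rule prime_chain_exists[OF R.noetherian_ring_axioms acc_sub Fs B FB])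
  then obtain c where c: "\<And>n. prime_chain (?F n) B (c n)" by metis
  have "\<exists>ps. n \<ge> n0 \<longrightarrow> prime_chain (?F n) (?F n0) ps" for n
    using prime_chain_exists[OF R.noetherian_ring_axioms acc_sub Fs Fs Fil_le[of n0 n]] by blast
  then obtain bs where bs: "\<And>n. n \<ge> n0 \<Longrightarrow> prime_chain (?F n) (?F n0) (bs n)" by metis
  \<comment> \<open>The quotient of \<open>F n0\<close> by \<open>A' = A + x F n0\<close> carries
    its own induced filtration, to which the induction hypothesis applies. In degree
    \<open>n + Suc m\<close> it is the upper end of the transported chain, because
    \<open>F (n + Suc m)\<close> lies inside \<open>F n0\<close>.\<close>
  have eq: "Fil A' (?F n0) (n + Suc m) = (\<bullet>) x ` ?F n0 <+>\<^bsub>M\<^esub> ?F (n + Suc m)" if n: "n \<ge> n0" for n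
  proof -
    have A's: "submodule A' R M" unfolding A' by (rule submodule_set_add[OF A xF])
    let ?N = "n + Suc m"
    let ?S = "(\<bullet>) x ` ?F n0 <+>\<^bsub>M\<^esub> ?F ?N"
    have S: "submodule ?S R M" by (rule submodule_set_add[OF xF Fs])
    have FN: "submodule (Fil A' (?F n0) ?N) R M" by (rule Fil_sub[OF A's Fs])
    have xS: "(\<bullet>) x ` ?F n0 \<subseteq> ?S" and FS: "?F ?N \<subseteq> ?S" by (rule subset_set_add[OF xF Fs])+
    have AA': "A \<subseteq> A'" and xA': "(\<bullet>) x ` ?F n0 \<subseteq> A'"
      unfolding A' by (rule subset_set_add[OF A xF])+
    have A'N: "A' \<subseteq> Fil A' (?F n0) ?N" and MN: "?F n0 \<inter> Mn ?N \<subseteq> Fil A' (?F n0) ?N"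
      unfolding Fil_def[of A'] by (rule subset_set_add[OF A's submodule_Int[OF Fs Mn_sub]])+
    have BN: "B \<inter> Mn ?N \<subseteq> ?F ?N"
      unfolding Fil_def by (rule subset_set_add(2)[OF A submodule_Int[OF B Mn_sub]])
    have "?F ?N \<subseteq> ?F n0" by (rule Fil_le) (use n in simp)
    then have "A <+>\<^bsub>M\<^esub> (B \<inter> Mn ?N) \<subseteq> Fil A' (?F n0) ?N"
      by (intro set_add_least[OF FN] order_trans[OF AA' A'N]) (use BN MN in blast)
    then have F': "?F ?N \<subseteq> Fil A' (?F n0) ?N" unfolding Fil_def[of A B ?N] .
    have "A' \<subseteq> ?S"
      unfolding A' by (rule set_add_least[OF S order_trans[OF AF FS] xS])
    moreover have "?F n0 \<inter> Mn ?N \<subseteq> ?S" using FB[of n0] BN FS by blast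
    ultimately have "Fil A' (?F n0) ?N \<subseteq> ?S"
      unfolding Fil_def[of A'] by (rule set_add_least[OF S])
    moreover have "?S \<subseteq> Fil A' (?F n0) ?N"
      by (rule set_add_least[OF FN order_trans[OF xA' A'N] F'])
    ultimately show ?thesis by blast
  qed
  have step: "prime_chain (?F (n + Suc m)) (?F n0) (ps @ qs (n + Suc m))"
    if n: "n \<ge> n0" and ps: "prime_chain (?F n) (?F n0) ps" for n ps
  proof -
    have "prime_chain ((\<bullet>) x ` ?F n <+>\<^bsub>M\<^esub> ?F (n + Suc m)) ((\<bullet>) x ` ?F n0 <+>\<^bsub>M\<^esub> ?F (n + Suc m)) ps"
      by (rule prime_chain_transport[OF ps xR Fs]) (use sup[OF n] in blast)
    \<comment> \<open>Since \<open>x\<close> has degree \<open>Suc m\<close>, the lower end of the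
      transported chain is already \<open>F (n + Suc m)\<close>.\<close>
    moreover have "(\<bullet>) x ` ?F n <+>\<^bsub>M\<^esub> ?F (n + Suc m) = ?F (n + Suc m)"
      using set_add_least[OF Fs xFn order_refl] subset_set_add(2)[OF xF Fs] by blast
    ultimately have "prime_chain (?F (n + Suc m)) (Fil A' (?F n0) (n + Suc m)) ps" using eq[OF n] by simp
    then show ?thesis using prime_chain_append qs(1) by blast
  qed
  define g where "g = iterate_append bs qs n0 m"
  have g: "prime_chain (?F n) (?F n0) (g n)" if "n \<ge> n0" for n
    using that
  proof (induction n rule: less_induct)
    case (less n)
    show ?case
    proof (cases "n < n0 + Suc m")
      case True
      then show ?thesis using bs[OF less.prems] by (simp add: g_def iterate_append.simps[of _ _ _ _ n])
    next
      case False
      then have "prime_chain (?F (n - Suc m)) (?F n0) (g (n - Suc m))" using less.IH[of "n - Suc m"] by simp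
      from step[OF _ this] False show ?thesis by (simp add: g_def iterate_append.simps[of _ _ _ _ n])
    qed
  qed
  \<comment> \<open>A fixed chain from \<open>F n0\<close> up to \<open>B\<close> completes
    \<open>g n\<close>; the finitely many indices below \<open>n0\<close> get arbitrary
    chains.\<close>
  define ps where "ps n = (if n < n0 then c n else g n @ c n0)" for n
  define \<Lambda>' where "\<Lambda>' = \<Lambda> \<union> (\<Union>j<n0 + Suc m. set (bs j)) \<union> (\<Union>j\<le>n0. set (c j))"
  have "finite \<Lambda>'" unfolding \<Lambda>'_def using \<Lambda> by simp
  moreover have "prime_chain (?F n) B (ps n)" for n
    unfolding ps_def using c[of n] prime_chain_append[OF g c, of n] by auto
  moreover have gset: "set (g n) \<subseteq> \<Lambda>'" for n
    using set_iterate_append[of bs qs n0 m n] qs(2) unfolding g_def \<Lambda>'_def by blast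
  moreover have psset: "set (ps n) \<subseteq> \<Lambda>'" for n
    using gset[of n] unfolding ps_def \<Lambda>'_def by auto
  moreover have "\<exists>K. \<forall>n. length (ps n) \<le> K * Suc n ^ d" if b: "b = Some d" for d
  proof -
    obtain K where K: "\<And>N j. j \<le> N \<Longrightarrow> Suc N * length (qs j) \<le> K * Suc N ^ d" using len[OF b] by blast
    define K0 where "K0 = (\<Sum>j<n0 + Suc m. length (bs j))"
    define K1 where "K1 = (\<Sum>j\<le>n0. length (c j))"
    have "length (ps N) \<le> (K0 + K + K1) * Suc N ^ d" for N
    proof -
      \<comment> \<open>The recursion ending at \<open>N\<close> uses \<open>qs\<close> only at
        indices up to \<open>N\<close>. With at most \<open>N\<close> appended lists of length at
        most \<open>q\<close>, one factor \<open>Suc N\<close> in the assumption \<open>len\<close>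
        pays for their number.\<close>
      define q where "q = Max ((\<lambda>j. length (qs j)) ` {..N})"
      have "q \<in> (\<lambda>j. length (qs j)) ` {..N}" unfolding q_def by (rule Max_in) auto
      then have q1: "Suc N * q \<le> K * Suc N ^ d" using K by auto
      have "length (g N) \<le> K0 + N * q"
        unfolding g_def
      proof (rule length_iterate_append[where N = N])
        show "length (bs j) \<le> K0" if "j < n0 + Suc m" for j
          unfolding K0_def by (rule member_le_sum[where f="\<lambda>j. length (bs j)"]) (use that in auto)
        show "length (qs j) \<le> q" if "j \<le> N" for j unfolding q_def using that by simp
      qed simp
      then have gN: "length (g N) \<le> K0 + K * Suc N ^ d" using q1 by simp
      have cN: "length (c j) \<le> K1" if "j \<le> n0" for j
        unfolding K1_def by (rule member_le_sum[where f="\<lambda>j. length (c j)"]) (use that in auto)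
      have "length (ps N) \<le> K0 + K * Suc N ^ d + K1"
        unfolding ps_def using gN cN[of N] cN[of n0] by auto
      also have "\<dots> \<le> K0 * Suc N ^ d + K * Suc N ^ d + K1 * Suc N ^ d"
        by (intro add_mono) simp_all
      finally show ?thesis by (simp add: distrib_right)
    qed
    then show ?thesis by blast
  qed
  moreover have "\<exists>\<Lambda>''. \<forall>\<^sub>F n in sequentially. set (ps n) = \<Lambda>''" if "infinite_residue_fields R"
  proof (rule eventually_constant_increasing[of \<Lambda>' n0])
    have m0: "m = 0" using m that by blast
    \<comment> \<open>For \<open>m = 0\<close> the chain at \<open>Suc n\<close> extends the one at
      \<open>n\<close> by \<open>qs (Suc n)\<close>, so no prime is lost.\<close>
    show "set (ps n) \<subseteq> set (ps (Suc n))" if "n \<ge> n0" for n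
      using that unfolding ps_def g_def m0 by (auto simp: iterate_append.simps[of _ _ _ _ "Suc n"])
  qed (use \<open>finite \<Lambda>'\<close> psset in auto)
  ultimately show ?thesis unfolding bounded_chains_def by blast
qed

text \<open>The bound \<open>b\<close> is generalized in the induction, because the strictly larger
  primes are used with an exponent smaller by one.\<close>

lemma bounded_chains_prime_step:
  "prime_step A B P \<Longrightarrow> R.dim_le P b \<Longrightarrow> bounded_chains b A B"
proof -
  have "\<forall>A B b. prime_step A B P \<longrightarrow> R.dim_le P b \<longrightarrow> bounded_chains b A B" if "P \<in> {J. ideal J R}" for P
    using R.acc_ideals that
  proof (induction P rule: acc_induct)
    case (step P)
    show ?case
    proof (intro allI impI)
      fix A B b assume AB: "prime_step A B P" and dim: "R.dim_le P b"
      have A: "submodule A R M" and B: "submodule B R M" and sub: "A \<subseteq> B" and P: "primeideal P R"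
        using prime_step_submodule[OF AB] by auto
      let ?F = "Fil A B"
      have PB: "r \<bullet> v \<in> A" if r: "r \<in> P" and v: "v \<in> B" for r v
      proof -
        obtain u where u: "u \<in> carrier M" and Bu: "B = A <+>\<^bsub>M\<^esub> cyclic u"
          and Pu: "P = {r \<in> carrier R. r \<bullet> u \<in> A}" using AB unfolding prime_step_def by blast
        obtain a s where a: "a \<in> A" "s \<in> carrier R" "v = a \<oplus>\<^bsub>M\<^esub> s \<bullet> u"
          using v unfolding Bu mem_set_add by blast
        have rR: "r \<in> carrier R" "r \<bullet> u \<in> A" using r Pu by auto
        have "r \<bullet> v = r \<bullet> a \<oplus>\<^bsub>M\<^esub> s \<bullet> (r \<bullet> u)"
          using a rR u submodule_carr[OF A a(1)] by (simp add: smult_r_distr R.m_comm flip: smult_assoc1)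
        then show ?thesis using submoduleE(4,5)[OF A] a rR by simp
      qed
      obtain m x n0 where x: "x \<in> Ip (Suc m)" and m: "infinite_residue_fields R \<longrightarrow> m = 0"
        and sup: "\<And>n u. n \<ge> n0 \<Longrightarrow> u \<in> ?F n0 \<Longrightarrow> x \<bullet> u \<in> ?F (n + Suc m) \<Longrightarrow> u \<in> ?F n"
        using Fil_superficial[OF A B sub] by blast
      have xR: "x \<in> carrier R" using x Ip_carrier by blast
      have Fs: "submodule (?F n0) R M" by (rule Fil_sub[OF A B])
      have FB: "?F n \<subseteq> B" and AF: "A \<subseteq> ?F n" for n using Fil_bounds[OF A B sub] by blast+
      show "bounded_chains b A B"
      proof (cases "x \<in> P")
        case True
        \<comment> \<open>Here \<open>x\<close> kills \<open>B/A\<close>, so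
          \<open>x \<bullet> u\<close> lies in \<open>A\<close> and hence in every term of the
          filtration; superficiality then puts all of \<open>F n0\<close> into
          \<open>F n\<close>.\<close>
        have "?F n = ?F n0" if n: "n \<ge> n0" for n
        proof (rule equalityI)
          show "?F n \<subseteq> ?F n0" by (rule Fil_le[OF n])
          show "?F n0 \<subseteq> ?F n" using sup[OF n] PB[OF True] FB AF by blast
        qed
        then show ?thesis by (rule bounded_chains_stationary[OF A B sub])
      next
        case False
        define A' where "A' = A <+>\<^bsub>M\<^esub> (\<bullet>) x ` ?F n0"
        have xF: "submodule ((\<bullet>) x ` ?F n0) R M" by (rule submodule_smult_set[OF Fs xR])
        have A': "submodule A' R M" unfolding A'_def by (rule submodule_set_add[OF A xF])
        have A'F: "A' \<subseteq> ?F n0" unfolding A'_def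
          by (rule set_add_least[OF Fs AF]) (use submoduleE(4)[OF Fs xR] in blast)
        obtain Ps where Ps: "prime_chain A' (?F n0) Ps"
          using prime_chain_exists[OF R.noetherian_ring_axioms acc_sub A' Fs A'F] by blast
        \<comment> \<open>Both \<open>P\<close> and \<open>x\<close> annihilate \<open>F n0\<close>
          modulo \<open>A'\<close>, and \<open>x\<close> is not in \<open>P\<close>.\<close>
        have larger: "primeideal Q R \<and> P \<subset> Q" if Q: "Q \<in> set Ps" for Q
        proof -
          note pc = prime_chain_primes[OF Ps Q]
          have "P \<subseteq> Q"
          proof
            fix r assume r: "r \<in> P"
            have "\<forall>v\<in>?F n0. r \<bullet> v \<in> A'"
              using PB[OF r] FB subset_set_add(1)[OF A xF] unfolding A'_def by blast
            then show "r \<in> Q" using pc ideal.Icarr[OF primeideal.axioms(1)[OF P] r] by blast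
          qed
          moreover have "\<forall>v\<in>?F n0. x \<bullet> v \<in> A'"
            using subset_set_add(2)[OF A xF] unfolding A'_def by blast
          then have "x \<in> Q" using pc xR by blast
          ultimately show ?thesis using pc False by blast
        qed
        have IH: "bounded_chains b' A' (?F n0)" if b': "\<And>Q. Q \<in> set Ps \<Longrightarrow> R.dim_le Q b'" for b'
        proof (rule bounded_chains_prime_chain[OF Ps])
          fix Q A1 B1 assume Q: "Q \<in> set Ps" and s: "prime_step A1 B1 Q"
          have "Q \<in> {J. ideal J R}" using larger[OF Q] primeideal.axioms(1) by blast
          then show "bounded_chains b' A1 B1" using step.IH larger[OF Q] s b'[OF Q] by blast
        qed
        \<comment> \<open>Lengths of order \<open>N\<close> to the power \<open>d - 1\<close> are
          expressed by multiplying with \<open>Suc N\<close>, which avoids a subtraction in the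
          exponent.\<close>
        have "\<exists>\<Lambda> qs. finite \<Lambda> \<and> (\<forall>n. prime_chain (Fil A' (?F n0) n) (?F n0) (qs n) \<and> set (qs n) \<subseteq> \<Lambda>) \<and>
          (\<forall>d. b = Some d \<longrightarrow> (\<exists>K. \<forall>N. \<forall>j\<le>N. Suc N * length (qs j) \<le> K * Suc N ^ d))"
        \<comment> \<open>If \<open>Ps\<close> is empty, no prime above \<open>P\<close> is at hand
          to show that \<open>d\<close> is positive, and \<open>d = 0\<close> is possible; but then
          \<open>A' = F n0\<close> and nothing has to be appended.\<close>
        proof (cases "Ps = []")
          case True
          then have "A' = ?F n0" using Ps prime_chain.cases[of A' "?F n0" "[]"] by blast
          then show ?thesis using Fil_same[OF A'] prime_chain.Nil[OF A']
            by (intro exI[of _ "{}"] exI[of _ "\<lambda>_. []"]) auto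
        next
          case False
          show ?thesis
          proof (cases b)
            case None
            then have "bounded_chains None A' (?F n0)" using IH R.dim_le_def by simp
            then show ?thesis unfolding bounded_chains_def None by auto
          next
            case (Some d)
            obtain Q0 where Q0: "Q0 \<in> set Ps" using False by (cases Ps) auto
            obtain d' where d': "d = Suc d'"
              using R.dim_le_prime[OF _ P, of d Q0] dim Some larger[OF Q0] by blast
            have "R.dim_le Q (Some d')" if "Q \<in> set Ps" for Q
              using R.dim_le_prime[OF _ P, of d Q] dim Some larger[OF that] d' by blast
            then have "bounded_chains (Some d') A' (?F n0)" by (rule IH)
            then obtain \<Lambda> qs K where qs: "finite \<Lambda>"
              "\<forall>n. prime_chain (Fil A' (?F n0) n) (?F n0) (qs n) \<and> set (qs n) \<subseteq> \<Lambda>"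
              and K: "\<forall>n. length (qs n) \<le> K * Suc n ^ d'" unfolding bounded_chains_def by auto
            have "Suc N * length (qs j) \<le> K * Suc N ^ d" if "j \<le> N" for j N
            proof -
              have "length (qs j) \<le> K * Suc j ^ d'" using K by blast
              also have "\<dots> \<le> K * Suc N ^ d'" using that by (intro mult_le_mono2 power_mono) auto
              finally have "Suc N * length (qs j) \<le> Suc N * (K * Suc N ^ d')" by (rule mult_le_mono2)
              then show ?thesis unfolding d' by (simp only: power_Suc mult.left_commute)
            qed
            then show ?thesis using qs Some by (intro exI[of _ \<Lambda>] exI[of _ qs]) auto
          qed
        qed
        then obtain \<Lambda> qs where "finite \<Lambda>" "\<And>n. prime_chain (Fil A' (?F n0) n) (?F n0) (qs n)"
          "\<And>n. set (qs n) \<subseteq> \<Lambda>"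
          "\<And>d. b = Some d \<Longrightarrow> \<exists>K. \<forall>N. \<forall>j\<le>N. Suc N * length (qs j) \<le> K * Suc N ^ d" by blast
        then show ?thesis
          by (intro bounded_chains_superficial[OF A B sub x m sup A'_def]) auto
      qed
    qed
  qed
  moreover assume AB: "prime_step A B P" and "R.dim_le P b"
  ultimately show ?thesis using primeideal.axioms(1)[OF prime_step_submodule(4)[OF AB]] by blast
qed

theorem bounded_chains_zero:
  assumes "R.dim_le (annihilator R M) b"
  shows "bounded_chains b {\<zero>\<^bsub>M\<^esub>} (carrier M)"
proof -
  obtain Ps where Ps: "prime_chain {\<zero>\<^bsub>M\<^esub>} (carrier M) Ps"
    using prime_chain_exists[OF R.noetherian_ring_axioms acc_sub submodule_zero_set carrier_is_submodule]
    by auto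
  show ?thesis
  proof (rule bounded_chains_prime_chain[OF Ps])
    fix P A B assume P: "P \<in> set Ps" and s: "prime_step A B P"
    have "annihilator R M \<subseteq> P" using prime_chain_primes[OF Ps P] unfolding annihilator_def by blast
    then show "bounded_chains b A B" using bounded_chains_prime_step[OF s] R.dim_le_mono[OF assms] by blast
  qed
qed

lemma Fil_zero_carrier: "Fil {\<zero>\<^bsub>M\<^esub>} (carrier M) n = Mn n"
  using submodule_carr[OF Mn_sub] unfolding Fil_def by (auto simp: mem_set_add)

end

section \<open>From chains in a module to filtrations of quotients\<close>

context module begin

lemma finsum_in_submodule:
  assumes K: "submodule K R M" and "finite S" and "\<And>i. i \<in> S \<Longrightarrow> g i \<in> K"
  shows "(\<Oplus>\<^bsub>M\<^esub>i\<in>S. g i) \<in> K"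
  using assms(2,3)
proof (induction S rule: finite_induct)
  case empty
  then show ?case using submodule_zero[OF K] by simp
next
  case (insert i S)
  then have "g \<in> S \<rightarrow> carrier M" "g i \<in> carrier M" using submodule_carr[OF K] by auto
  then show ?case using insert submoduleE(5)[OF K] by simp
qed

section \<open>Quotient modules and their prime filtrations\<close>

lemma submodule_abelian_subgroup: "submodule A R M \<Longrightarrow> abelian_subgroup A M"
  by (intro abelian_subgroupI3 additive_subgroup.intro submodule.axioms(1)) (auto intro: M.abelian_group_axioms)

lemma coset_eq:
  assumes A: "submodule A R M" and c: "x \<in> carrier M" "y \<in> carrier M"
  shows "A +>\<^bsub>M\<^esub> x = A +>\<^bsub>M\<^esub> y \<longleftrightarrow> x \<ominus>\<^bsub>M\<^esub> y \<in> A"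
proof -
  interpret A: abelian_subgroup A M by (rule submodule_abelian_subgroup[OF A])
  have "A +>\<^bsub>M\<^esub> x = A +>\<^bsub>M\<^esub> y \<longleftrightarrow> x \<in> A +>\<^bsub>M\<^esub> y"
    using A.a_repr_independence'[of x y] A.a_rcos_self[OF c(1)] c by auto
  then show ?thesis using A.a_rcos_module[OF c(2,1)] by (simp add: M.minus_eq)
qed

lemma coset_add:
  assumes "submodule A R M" "x \<in> carrier M" "y \<in> carrier M"
  shows "(A +>\<^bsub>M\<^esub> x) <+>\<^bsub>M\<^esub> (A +>\<^bsub>M\<^esub> y) = A +>\<^bsub>M\<^esub> (x \<oplus>\<^bsub>M\<^esub> y)"
  by (rule abelian_subgroup.a_rcos_sum[OF submodule_abelian_subgroup]) fact+

lemma coset_smult: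
  assumes A: "submodule A R M" and a: "a \<in> carrier R" and x: "x \<in> carrier M"
  shows "(\<Union>v\<in>A +>\<^bsub>M\<^esub> x. A +>\<^bsub>M\<^esub> (a \<bullet> v)) = A +>\<^bsub>M\<^esub> (a \<bullet> x)"
proof -
  interpret A: abelian_subgroup A M by (rule submodule_abelian_subgroup[OF A])
  have "A +>\<^bsub>M\<^esub> (a \<bullet> v) = A +>\<^bsub>M\<^esub> (a \<bullet> x)" if v: "v \<in> A +>\<^bsub>M\<^esub> x" for v
  proof -
    have vM: "v \<in> carrier M" using v A.a_elemrcos_carrier[OF x] by blast
    have "v \<ominus>\<^bsub>M\<^esub> x \<in> A" using A.a_rcos_module[OF x vM] v by (simp add: M.minus_eq)
    then have "a \<bullet> (v \<ominus>\<^bsub>M\<^esub> x) \<in> A" using submoduleE(4)[OF A a] by blast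
    then show ?thesis using coset_eq[OF A] a vM x by (simp add: M.minus_eq smult_r_distr smult_r_minus)
  qed
  moreover have "x \<in> A +>\<^bsub>M\<^esub> x" by (rule A.a_rcos_self[OF x])
  ultimately show ?thesis by blast
qed

lemma quot_module_simps:
  "carrier (quot_module M A) = (\<lambda>x. A +>\<^bsub>M\<^esub> x) ` carrier M"
  "\<zero>\<^bsub>quot_module M A\<^esub> = A"
  "X \<oplus>\<^bsub>quot_module M A\<^esub> Y = X <+>\<^bsub>M\<^esub> Y"
  "a \<odot>\<^bsub>quot_module M A\<^esub> X = (\<Union>x\<in>X. A +>\<^bsub>M\<^esub> (a \<bullet> x))"
  unfolding quot_module_def A_RCOSETS_def' by auto

lemma quot_module_add:
  assumes "submodule A R M" "x \<in> carrier M" "y \<in> carrier M"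
  shows "(A +>\<^bsub>M\<^esub> x) \<oplus>\<^bsub>quot_module M A\<^esub> (A +>\<^bsub>M\<^esub> y) = A +>\<^bsub>M\<^esub> (x \<oplus>\<^bsub>M\<^esub> y)"
  using coset_add[OF assms] by (simp add: quot_module_simps)

lemma quot_module_smult:
  assumes "submodule A R M" "a \<in> carrier R" "x \<in> carrier M"
  shows "a \<odot>\<^bsub>quot_module M A\<^esub> (A +>\<^bsub>M\<^esub> x) = A +>\<^bsub>M\<^esub> (a \<bullet> x)"
  using coset_smult[OF assms] by (simp add: quot_module_simps)

lemma quot_module_is_module:
  assumes A: "submodule A R M"
  shows "module R (quot_module M A)"
proof (rule moduleI)
  interpret A: abelian_subgroup A M by (rule submodule_abelian_subgroup[OF A])
  have zero: "A = A +>\<^bsub>M\<^esub> \<zero>\<^bsub>M\<^esub>" using submoduleE(1)[OF A] by simp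
  show "abelian_group (quot_module M A)"
  proof (rule abelian_groupI)
    show "\<zero>\<^bsub>quot_module M A\<^esub> \<in> carrier (quot_module M A)"
      using zero by (auto simp: quot_module_simps)
    show "\<zero>\<^bsub>quot_module M A\<^esub> \<oplus>\<^bsub>quot_module M A\<^esub> X = X" if X: "X \<in> carrier (quot_module M A)" for X
    proof -
      obtain x where x: "x \<in> carrier M" "X = A +>\<^bsub>M\<^esub> x" using X by (auto simp: quot_module_simps)
      then have "(A +>\<^bsub>M\<^esub> \<zero>\<^bsub>M\<^esub>) <+>\<^bsub>M\<^esub> X = X" using coset_add[OF A, of "\<zero>\<^bsub>M\<^esub>" x] by simp
      then show ?thesis using zero by (simp add: quot_module_simps)
    qed
    show "\<exists>Y\<in>carrier (quot_module M A). Y \<oplus>\<^bsub>quot_module M A\<^esub> X = \<zero>\<^bsub>quot_module M A\<^esub>"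
      if X: "X \<in> carrier (quot_module M A)" for X
    proof -
      obtain x where x: "x \<in> carrier M" "X = A +>\<^bsub>M\<^esub> x" using X by (auto simp: quot_module_simps)
      then have "(A +>\<^bsub>M\<^esub> (\<ominus>\<^bsub>M\<^esub> x)) <+>\<^bsub>M\<^esub> X = A"
        using coset_add[OF A, of "\<ominus>\<^bsub>M\<^esub> x" x] zero by (simp add: M.l_neg)
      then show ?thesis using x(1) by (auto simp: quot_module_simps)
    qed
  qed (auto simp: quot_module_simps coset_add[OF A] M.a_ac)
  show "cring R" by (rule R.is_cring)
qed (auto simp: quot_module_simps(1) quot_module_add[OF A] quot_module_smult[OF A]
      smult_l_distr smult_r_distr smult_assoc1)

lemma quot_submodule_simps:
  "carrier (quot_module (M\<lparr>carrier := B\<rparr>) A) = (\<lambda>x. A +>\<^bsub>M\<^esub> x) ` B"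
  "X \<oplus>\<^bsub>quot_module (M\<lparr>carrier := B\<rparr>) A\<^esub> Y = X <+>\<^bsub>M\<^esub> Y"
  "a \<odot>\<^bsub>quot_module (M\<lparr>carrier := B\<rparr>) A\<^esub> X = (\<Union>x\<in>X. A +>\<^bsub>M\<^esub> (a \<bullet> x))"
  unfolding quot_module_def A_RCOSETS_def' a_r_coset_def' set_add_def' by auto

lemma submodule_coset_image:
  assumes A: "submodule A R M" and B: "submodule B R M"
  shows "submodule ((\<lambda>x. A +>\<^bsub>M\<^esub> x) ` B) R (quot_module M A)"
proof -
  interpret Q: module R "quot_module M A" by (rule quot_module_is_module[OF A])
  have neg: "\<ominus>\<^bsub>quot_module M A\<^esub> (A +>\<^bsub>M\<^esub> x) = A +>\<^bsub>M\<^esub> (\<ominus>\<^bsub>M\<^esub> x)" if x: "x \<in> carrier M" for x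
  proof (rule Q.M.minus_equality)
    show "(A +>\<^bsub>M\<^esub> (\<ominus>\<^bsub>M\<^esub> x)) \<oplus>\<^bsub>quot_module M A\<^esub> (A +>\<^bsub>M\<^esub> x) = \<zero>\<^bsub>quot_module M A\<^esub>"
      using x submoduleE(1)[OF A] by (simp add: quot_module_simps coset_add[OF A] M.l_neg)
  qed (use x in \<open>auto simp: quot_module_simps\<close>)
  note c = submodule_carr[OF B]
  show ?thesis
  proof (rule Q.submoduleI)
    have "A +>\<^bsub>M\<^esub> \<zero>\<^bsub>M\<^esub> = A" using submoduleE(1)[OF A] by simp
    then show "\<zero>\<^bsub>quot_module M A\<^esub> \<in> (\<lambda>x. A +>\<^bsub>M\<^esub> x) ` B"
      using submodule_zero[OF B] by (auto simp: quot_module_simps)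
  qed (use c neg submoduleE[OF B] in \<open>auto simp: quot_module_simps coset_add[OF A] coset_smult[OF A]\<close>)
qed

text \<open>Since \<open>A\<close> lies inside \<open>B\<close>, membership in \<open>B\<close> can
  be read off from the coset modulo \<open>A\<close>. The coset of the generator \<open>u\<close>
  therefore has the same annihilator \<open>P\<close>.\<close>

lemma prime_step_quot:
  assumes A: "submodule A R M" and step: "prime_step B C P" and AB: "A \<subseteq> B"
  shows "module.prime_step R (quot_module M A) ((\<lambda>x. A +>\<^bsub>M\<^esub> x) ` B) ((\<lambda>x. A +>\<^bsub>M\<^esub> x) ` C) P"
proof -
  interpret Q: module R "quot_module M A" by (rule quot_module_is_module[OF A])
  obtain u where B: "submodule B R M" and P: "primeideal P R" and u: "u \<in> carrier M"
    and C: "C = B <+>\<^bsub>M\<^esub> cyclic u" and Pu: "P = {r \<in> carrier R. r \<bullet> u \<in> B}"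
    using step unfolding prime_step_def by blast
  note c = submodule_carr[OF B]
  have mem: "A +>\<^bsub>M\<^esub> v \<in> (\<lambda>x. A +>\<^bsub>M\<^esub> x) ` B \<longleftrightarrow> v \<in> B" if v: "v \<in> carrier M" for v
  proof
    assume "A +>\<^bsub>M\<^esub> v \<in> (\<lambda>x. A +>\<^bsub>M\<^esub> x) ` B"
    then obtain b where b: "b \<in> B" "A +>\<^bsub>M\<^esub> v = A +>\<^bsub>M\<^esub> b" by blast
    then have "v \<ominus>\<^bsub>M\<^esub> b \<in> B" using coset_eq[OF A v c] AB by blast
    then have "b \<oplus>\<^bsub>M\<^esub> (v \<ominus>\<^bsub>M\<^esub> b) \<in> B" using submoduleE(5)[OF B] b by blast
    moreover have "b \<oplus>\<^bsub>M\<^esub> (v \<ominus>\<^bsub>M\<^esub> b) = v" using c[OF b(1)] v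
      by (simp add: M.minus_eq M.a_lcomm[of b v] M.r_neg)
    ultimately show "v \<in> B" by simp
  qed blast
  have P_iff: "r \<odot>\<^bsub>quot_module M A\<^esub> (A +>\<^bsub>M\<^esub> u) \<in> (\<lambda>x. A +>\<^bsub>M\<^esub> x) ` B \<longleftrightarrow> r \<bullet> u \<in> B"
    if r: "r \<in> carrier R" for r
    using mem[of "r \<bullet> u"] r u by (simp only: quot_module_simps coset_smult[OF A] smult_closed)
  show ?thesis unfolding Q.prime_step_def
  proof (intro conjI bexI)
    show "A +>\<^bsub>M\<^esub> u \<in> carrier (quot_module M A)" using u by (simp add: quot_module_simps)
    show "(\<lambda>x. A +>\<^bsub>M\<^esub> x) ` C = (\<lambda>x. A +>\<^bsub>M\<^esub> x) ` B <+>\<^bsub>quot_module M A\<^esub>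
      (\<lambda>r. r \<odot>\<^bsub>quot_module M A\<^esub> (A +>\<^bsub>M\<^esub> u)) ` carrier R"
    proof (rule equalityI; rule subsetI)
      fix X assume "X \<in> (\<lambda>x. A +>\<^bsub>M\<^esub> x) ` C"
      then obtain b r where "b \<in> B" "r \<in> carrier R" "X = A +>\<^bsub>M\<^esub> (b \<oplus>\<^bsub>M\<^esub> r \<bullet> u)"
        unfolding C by (auto simp: mem_set_add)
      then show "X \<in> (\<lambda>x. A +>\<^bsub>M\<^esub> x) ` B <+>\<^bsub>quot_module M A\<^esub>
          (\<lambda>r. r \<odot>\<^bsub>quot_module M A\<^esub> (A +>\<^bsub>M\<^esub> u)) ` carrier R"
        unfolding Q.mem_set_add using c u
        by (auto simp: quot_module_simps coset_smult[OF A] coset_add[OF A] intro!: bexI[of _ b] bexI[of _ r])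
    next
      fix X assume "X \<in> (\<lambda>x. A +>\<^bsub>M\<^esub> x) ` B <+>\<^bsub>quot_module M A\<^esub>
          (\<lambda>r. r \<odot>\<^bsub>quot_module M A\<^esub> (A +>\<^bsub>M\<^esub> u)) ` carrier R"
      then obtain b r where br: "b \<in> B" "r \<in> carrier R"
        "X = (A +>\<^bsub>M\<^esub> b) \<oplus>\<^bsub>quot_module M A\<^esub> (r \<odot>\<^bsub>quot_module M A\<^esub> (A +>\<^bsub>M\<^esub> u))"
        unfolding Q.mem_set_add by blast
      then have "X = A +>\<^bsub>M\<^esub> (b \<oplus>\<^bsub>M\<^esub> r \<bullet> u)"
        using c u by (simp add: quot_module_simps coset_smult[OF A] coset_add[OF A])
      moreover have "b \<oplus>\<^bsub>M\<^esub> r \<bullet> u \<in> C" unfolding C mem_set_add using br by blast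
      ultimately show "X \<in> (\<lambda>x. A +>\<^bsub>M\<^esub> x) ` C" by blast
    qed
    show "P = {r \<in> carrier R. r \<odot>\<^bsub>quot_module M A\<^esub> (A +>\<^bsub>M\<^esub> u) \<in> (\<lambda>x. A +>\<^bsub>M\<^esub> x) ` B}"
      unfolding Pu using P_iff by blast
  qed (fact P submodule_coset_image[OF A B])+
qed

lemma prime_chain_list:
  assumes "prime_chain A B Ps"
  shows "\<exists>Ns. length Ns = Suc (length Ps) \<and> Ns ! 0 = A \<and> last Ns = B \<and>
    (\<forall>i<length Ps. prime_step (Ns ! i) (Ns ! Suc i) (Ps ! i))"
  using assms
proof (induction rule: prime_chain.induct)
  case (Nil A)
  then show ?case by (intro exI[of _ "[A]"]) simp
next
  case (Cons A B P C Ps)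
  then obtain Ns where Ns: "length Ns = Suc (length Ps)" "Ns ! 0 = B" "last Ns = C"
    "\<forall>i<length Ps. prime_step (Ns ! i) (Ns ! Suc i) (Ps ! i)" by blast
  have "prime_step ((A # Ns) ! i) ((A # Ns) ! Suc i) ((P # Ps) ! i)" if "i < length (P # Ps)" for i
    using that Ns Cons.hyps(1) by (cases i) auto
  then show ?case using Ns by (intro exI[of _ "A # Ns"]) auto
qed

lemma ring_as_module_is_module: "module R (ring_as_module R)"
proof (rule moduleI)
  show "abelian_group (ring_as_module R)"
    by (rule abelian_groupI) (auto simp: ring_as_module_def R.a_ac intro: R.l_neg bexI[of _ "\<ominus> x" for x])
qed (auto simp: ring_as_module_def R.is_cring R.l_distr R.r_distr R.m_assoc)

lemma ring_as_module_simps: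
  "carrier (ring_as_module R) = carrier R" "add (ring_as_module R) = add R"
  "zero (ring_as_module R) = zero R" "smult (ring_as_module R) = mult R"
  unfolding ring_as_module_def by simp_all

lemma ring_as_module_minus:
  assumes "r \<in> carrier R"
  shows "\<ominus>\<^bsub>ring_as_module R\<^esub> r = \<ominus> r"
proof -
  interpret S: module R "ring_as_module R" by (rule ring_as_module_is_module)
  show ?thesis
    by (rule S.M.minus_equality) (use assms in \<open>auto simp: ring_as_module_simps R.l_neg\<close>)
qed

lemma ideal_submodule:
  assumes P: "ideal P R"
  shows "submodule P R (ring_as_module R)"
proof -
  interpret P: ideal P R by fact
  interpret S: module R "ring_as_module R" by (rule ring_as_module_is_module)
  show ?thesis
    by (rule S.submoduleI)
      (use P.Icarr P.I_l_closed in \<open>auto simp: ring_as_module_simps ring_as_module_minus\<close>)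
qed

text \<open>The isomorphism from \<open>B/A\<close> to \<open>R/P\<close> sends a coset
  \<open>X\<close> to the set of all scalars that carry \<open>u\<close> into \<open>X\<close>. This
  is a coset of \<open>P\<close> and involves no choice of representatives.\<close>

lemma prime_step_iso:
  assumes "prime_step A B P"
  shows "module_isomorphic R (quot_module (M\<lparr>carrier := B\<rparr>) A) (quot_module (ring_as_module R) P)"
proof -
  obtain u where A: "submodule A R M" and P: "primeideal P R" and u: "u \<in> carrier M"
    and B: "B = A <+>\<^bsub>M\<^esub> cyclic u" and Pu: "P = {r \<in> carrier R. r \<bullet> u \<in> A}"
    using assms unfolding prime_step_def by blast
  interpret S: module R "ring_as_module R" by (rule ring_as_module_is_module)
  have PS: "submodule P R (ring_as_module R)" by (rule ideal_submodule[OF primeideal.axioms(1)[OF P]])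
  interpret A: abelian_subgroup A M by (rule submodule_abelian_subgroup[OF A])
  interpret P: abelian_subgroup P "ring_as_module R" by (rule S.submodule_abelian_subgroup[OF PS])
  define a where "a s = A +>\<^bsub>M\<^esub> (s \<bullet> u)" for s
  define p where "p s = P +>\<^bsub>ring_as_module R\<^esub> s" for s
  define h where "h X = {r \<in> carrier R. r \<bullet> u \<in> X}" for X
  have diff: "r \<bullet> u \<ominus>\<^bsub>M\<^esub> s \<bullet> u = (r \<ominus> s) \<bullet> u" if "r \<in> carrier R" "s \<in> carrier R" for r s
    using that u by (simp add: M.minus_eq R.minus_eq smult_l_distr smult_l_minus)
  have mem_p: "r \<in> p s \<longleftrightarrow> r \<ominus> s \<in> P" if "r \<in> carrier R" "s \<in> carrier R" for r s
  proof -
    have "r \<ominus>\<^bsub>ring_as_module R\<^esub> s = r \<ominus> s"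
      using that by (simp add: a_minus_def ring_as_module_simps ring_as_module_minus)
    then show ?thesis
      unfolding p_def using P.a_rcos_module[of s r] that by (simp add: ring_as_module_simps S.M.minus_eq)
  qed
  have p_sub: "p s \<subseteq> carrier R" if "s \<in> carrier R" for s
    unfolding p_def using P.a_elemrcos_carrier[of s] that by (auto simp: ring_as_module_simps)
  have h: "h (a s) = p s" if s: "s \<in> carrier R" for s
  proof -
    have "r \<in> h (a s) \<longleftrightarrow> r \<in> p s" if r: "r \<in> carrier R" for r
    proof -
      have "r \<in> h (a s) \<longleftrightarrow> r \<bullet> u \<ominus>\<^bsub>M\<^esub> s \<bullet> u \<in> A"
        unfolding h_def a_def using A.a_rcos_module[of "s \<bullet> u" "r \<bullet> u"] u r s by (simp add: M.minus_eq)
      then show ?thesis unfolding diff[OF r s] mem_p[OF r s] Pu using r s by simp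
    qed
    then show ?thesis using p_sub[OF s] unfolding h_def by blast
  qed
  have L: "carrier (quot_module (M\<lparr>carrier := B\<rparr>) A) = a ` carrier R"
  proof (rule equalityI; rule subsetI)
    fix X assume "X \<in> carrier (quot_module (M\<lparr>carrier := B\<rparr>) A)"
    then obtain b r where br: "b \<in> A" "r \<in> carrier R" "X = A +>\<^bsub>M\<^esub> (b \<oplus>\<^bsub>M\<^esub> r \<bullet> u)"
      unfolding quot_submodule_simps B by (auto simp: mem_set_add)
    have bM: "b \<in> carrier M" using submodule_carr[OF A br(1)] .
    have "(b \<oplus>\<^bsub>M\<^esub> r \<bullet> u) \<ominus>\<^bsub>M\<^esub> r \<bullet> u = b"
      using bM br(2) u by (simp add: M.minus_eq M.a_assoc M.r_neg)
    then have "X = a r" unfolding a_def br(3) using coset_eq[OF A] bM br u by simp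
    then show "X \<in> a ` carrier R" using br by blast
  next
    fix X assume "X \<in> a ` carrier R"
    then obtain r where r: "r \<in> carrier R" "X = A +>\<^bsub>M\<^esub> (r \<bullet> u)" unfolding a_def by blast
    moreover have "r \<bullet> u \<in> B" unfolding B
      using subset_set_add(2)[OF A submodule_cyclic[OF R.oneideal u]] r by blast
    ultimately show "X \<in> carrier (quot_module (M\<lparr>carrier := B\<rparr>) A)" unfolding quot_submodule_simps by blast
  qed
  have Rc: "carrier (quot_module (ring_as_module R) P) = p ` carrier R"
    unfolding S.quot_module_simps p_def ring_as_module_simps ..
  have inj: "a r = a s" if "r \<in> carrier R" "s \<in> carrier R" "p r = p s" for r s
  proof -
    have "r \<in> p r" unfolding p_def using P.a_rcos_self[of r] that by (simp add: ring_as_module_simps)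
    then have "r \<ominus> s \<in> P" using mem_p that by simp
    then show ?thesis unfolding a_def using coset_eq[OF A] that(1,2) u diff Pu by simp
  qed
  have add_a: "a r <+>\<^bsub>M\<^esub> a s = a (r \<oplus> s)" if "r \<in> carrier R" "s \<in> carrier R" for r s
    unfolding a_def using coset_add[OF A] that u by (simp add: smult_l_distr)
  have add_p: "p r <+>\<^bsub>ring_as_module R\<^esub> p s = p (r \<oplus> s)" if "r \<in> carrier R" "s \<in> carrier R" for r s
    unfolding p_def using S.coset_add[OF PS] that by (simp add: ring_as_module_simps)
  have smult_a: "(\<Union>v\<in>a s. A +>\<^bsub>M\<^esub> (r \<bullet> v)) = a (r \<otimes> s)" if "r \<in> carrier R" "s \<in> carrier R" for r s
    unfolding a_def using coset_smult[OF A] that u by (simp add: smult_assoc1)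
  have smult_p: "(\<Union>v\<in>p s. P +>\<^bsub>ring_as_module R\<^esub> (r \<odot>\<^bsub>ring_as_module R\<^esub> v)) = p (r \<otimes> s)"
    if "r \<in> carrier R" "s \<in> carrier R" for r s
    unfolding p_def using S.coset_smult[OF PS] that by (simp add: ring_as_module_simps)
  show ?thesis unfolding module_isomorphic_def
  proof (intro exI[of _ h] conjI ballI)
    show "bij_betw h (carrier (quot_module (M\<lparr>carrier := B\<rparr>) A)) (carrier (quot_module (ring_as_module R) P))"
      unfolding L Rc
    proof (rule bij_betw_imageI)
      show "inj_on h (a ` carrier R)"
      proof (rule inj_onI)
        fix x y assume xy: "x \<in> a ` carrier R" "y \<in> a ` carrier R" "h x = h y"
        then obtain r s where "r \<in> carrier R" "s \<in> carrier R" "x = a r" "y = a s" by blast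
        then show "x = y" using inj[of r s] xy(3) by (simp add: h)
      qed
      show "h ` a ` carrier R = p ` carrier R"
        unfolding image_image by (rule image_cong) (simp_all add: h)
    qed
    show "h (x \<oplus>\<^bsub>quot_module (M\<lparr>carrier := B\<rparr>) A\<^esub> y) = h x \<oplus>\<^bsub>quot_module (ring_as_module R) P\<^esub> h y"
      if "x \<in> carrier (quot_module (M\<lparr>carrier := B\<rparr>) A)" "y \<in> carrier (quot_module (M\<lparr>carrier := B\<rparr>) A)" for x y
      using that unfolding L by (auto simp: quot_submodule_simps S.quot_module_simps add_a add_p h)
    show "h (r \<odot>\<^bsub>quot_module (M\<lparr>carrier := B\<rparr>) A\<^esub> x) = r \<odot>\<^bsub>quot_module (ring_as_module R) P\<^esub> h x"
      if rx: "r \<in> carrier R" "x \<in> carrier (quot_module (M\<lparr>carrier := B\<rparr>) A)" for r x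
    proof -
      obtain s where s: "s \<in> carrier R" "x = a s" using rx(2) unfolding L by blast
      show ?thesis
        unfolding quot_submodule_simps(3) S.quot_module_simps(4) s(2) h[OF s(1)] smult_a[OF rx(1) s(1)]
          smult_p[OF rx(1) s(1)] by (rule h) (use rx(1) s(1) in simp)
    qed
  qed
qed

lemma isomorphic_quotient_prime:
  assumes P: "ideal P R" and cl: "\<And>r x. r \<in> carrier R \<Longrightarrow> x \<in> carrier X \<Longrightarrow> r \<odot>\<^bsub>X\<^esub> x \<in> carrier X"
    and iso: "module_isomorphic R X (quot_module (ring_as_module R) P)"
  shows "P = {r \<in> carrier R. \<forall>x\<in>carrier X. r \<odot>\<^bsub>X\<^esub> x = \<zero> \<odot>\<^bsub>X\<^esub> x}"
proof -
  interpret S: module R "ring_as_module R" by (rule ring_as_module_is_module)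
  have PS: "submodule P R (ring_as_module R)" by (rule ideal_submodule[OF P])
  let ?Q = "quot_module (ring_as_module R) P"
  obtain h where bij: "bij_betw h (carrier X) (carrier ?Q)"
    and lin: "\<And>a x. a \<in> carrier R \<Longrightarrow> x \<in> carrier X \<Longrightarrow> h (a \<odot>\<^bsub>X\<^esub> x) = a \<odot>\<^bsub>?Q\<^esub> h x"
    using iso unfolding module_isomorphic_def by blast
  have Qc: "carrier ?Q = (\<lambda>s. P +>\<^bsub>ring_as_module R\<^esub> s) ` carrier R"
    unfolding S.quot_module_simps ring_as_module_simps ..
  have sm: "r \<odot>\<^bsub>?Q\<^esub> (P +>\<^bsub>ring_as_module R\<^esub> s) = P +>\<^bsub>ring_as_module R\<^esub> (r \<otimes> s)"
    if "r \<in> carrier R" "s \<in> carrier R" for r s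
    using S.coset_smult[OF PS] that by (simp add: S.quot_module_simps ring_as_module_simps)
  have ceq: "P +>\<^bsub>ring_as_module R\<^esub> r = P +>\<^bsub>ring_as_module R\<^esub> \<zero> \<longleftrightarrow> r \<in> P" if r: "r \<in> carrier R" for r
  proof -
    have "r \<ominus>\<^bsub>ring_as_module R\<^esub> \<zero> = r"
      using r by (simp add: a_minus_def ring_as_module_simps ring_as_module_minus)
    then show ?thesis using S.coset_eq[OF PS, of r \<zero>] r by (simp add: ring_as_module_simps)
  qed
  have "r \<in> P \<longleftrightarrow> (\<forall>x\<in>carrier X. r \<odot>\<^bsub>X\<^esub> x = \<zero> \<odot>\<^bsub>X\<^esub> x)" if r: "r \<in> carrier R" for r
  proof -
    have "(\<forall>x\<in>carrier X. r \<odot>\<^bsub>X\<^esub> x = \<zero> \<odot>\<^bsub>X\<^esub> x) \<longleftrightarrow> (\<forall>x\<in>carrier X. h (r \<odot>\<^bsub>X\<^esub> x) = h (\<zero> \<odot>\<^bsub>X\<^esub> x))"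
      using inj_on_eq_iff[OF bij_betw_imp_inj_on[OF bij] cl[OF r] cl[OF R.zero_closed]] by simp
    also have "\<dots> \<longleftrightarrow> (\<forall>y\<in>carrier ?Q. r \<odot>\<^bsub>?Q\<^esub> y = \<zero> \<odot>\<^bsub>?Q\<^esub> y)"
      using lin[OF r] lin[OF R.zero_closed] bij_betw_imp_surj_on[OF bij, symmetric] by simp
    also have "\<dots> \<longleftrightarrow> r \<in> P"
    proof
      assume "\<forall>y\<in>carrier ?Q. r \<odot>\<^bsub>?Q\<^esub> y = \<zero> \<odot>\<^bsub>?Q\<^esub> y"
      then have "r \<odot>\<^bsub>?Q\<^esub> (P +>\<^bsub>ring_as_module R\<^esub> \<one>) = \<zero> \<odot>\<^bsub>?Q\<^esub> (P +>\<^bsub>ring_as_module R\<^esub> \<one>)"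
        unfolding Qc by blast
      then show "r \<in> P" using sm r ceq by simp
    next
      assume rP: "r \<in> P"
      then have "r \<otimes> s \<in> P" if "s \<in> carrier R" for s using ideal.I_r_closed[OF P] that by blast
      then show "\<forall>y\<in>carrier ?Q. r \<odot>\<^bsub>?Q\<^esub> y = \<zero> \<odot>\<^bsub>?Q\<^esub> y"
        unfolding Qc using sm r ceq by auto
    qed
    finally show ?thesis by simp
  qed
  then show ?thesis using ideal.Icarr[OF P] by blast
qed

lemma quotient_is_prime_unique:
  assumes B: "submodule (Ns ! Suc i) R M" and A: "submodule (Ns ! i) R M"
    and "quotient_is_prime R M Ns i P" "quotient_is_prime R M Ns i P'"
  shows "P = P'"
proof -
  let ?X = "quot_module (M\<lparr>carrier := Ns ! Suc i\<rparr>) (Ns ! i)"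
  have cl: "r \<odot>\<^bsub>?X\<^esub> x \<in> carrier ?X" if "r \<in> carrier R" "x \<in> carrier ?X" for r x
    using that submoduleE(4)[OF B] submodule_carr[OF B]
    unfolding quot_submodule_simps by (auto simp: coset_smult[OF A])
  have "S = {r \<in> carrier R. \<forall>x\<in>carrier ?X. r \<odot>\<^bsub>?X\<^esub> x = \<zero> \<odot>\<^bsub>?X\<^esub> x}"
    if "quotient_is_prime R M Ns i S" for S
    by (rule isomorphic_quotient_prime[OF primeideal.axioms(1) cl])
      (use that in \<open>simp_all add: quotient_is_prime_def\<close>)
  from this[OF assms(3)] this[OF assms(4)] show ?thesis by (rule trans[OF _ sym])
qed

text \<open>Uniqueness of the prime of each quotient gives equality with \<open>set Ps\<close>.
  Multiplicities are bounded by the total length, which is the quantity controlled before.\<close>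

theorem prime_chain_filtration:
  assumes A: "submodule A R M" and chain: "prime_chain A (carrier M) Ps"
  shows "\<exists>Ns. prime_filtration R (quot_module M A) Ns \<and>
    filtration_primes R (quot_module M A) Ns = set Ps \<and>
    (\<forall>P. filtration_mult R (quot_module M A) Ns P \<le> length Ps)"
proof -
  let ?Q = "quot_module M A"
  let ?p = "\<lambda>N. (\<lambda>x. A +>\<^bsub>M\<^esub> x) ` N"
  interpret Q: module R ?Q by (rule quot_module_is_module[OF A])
  obtain Ls where Ls: "length Ls = Suc (length Ps)" "Ls ! 0 = A" "last Ls = carrier M"
    and steps: "\<And>i. i < length Ps \<Longrightarrow> prime_step (Ls ! i) (Ls ! Suc i) (Ps ! i)"
    using prime_chain_list[OF chain] by blast
  have AL: "A \<subseteq> Ls ! i \<and> submodule (Ls ! i) R M" if "i \<le> length Ps" for i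
    using that
  proof (induction i)
    case 0
    then show ?case using A Ls by simp
  next
    case (Suc i)
    then show ?case using prime_step_submodule[OF steps[of i]] by auto
  qed
  define Ns where "Ns = map ?p Ls"
  have len: "length Ns = Suc (length Ps)" unfolding Ns_def using Ls by simp
  have nth: "Ns ! i = ?p (Ls ! i)" if "i \<le> length Ps" for i unfolding Ns_def using that Ls by simp
  have sub: "submodule (Ns ! i) R ?Q" if "i \<le> length Ps" for i
    unfolding nth[OF that] using submodule_coset_image[OF A] AL[OF that] by blast
  have step: "Q.prime_step (Ns ! i) (Ns ! Suc i) (Ps ! i)" if "i < length Ps" for i
    using prime_step_quot[OF A steps[OF that]] AL[of i] nth[of i] nth[of "Suc i"] that by simp
  have qp: "quotient_is_prime R ?Q Ns i (Ps ! i)" if "i < length Ps" for i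
    unfolding quotient_is_prime_def
    using Q.prime_step_iso[OF step[OF that]] Q.prime_step_submodule(4)[OF step[OF that]] by blast
  have qp_iff: "quotient_is_prime R ?Q Ns i P \<longleftrightarrow> P = Ps ! i" if "i < length Ps" for i P
  proof
    assume P: "quotient_is_prime R ?Q Ns i P"
    show "P = Ps ! i"
      by (rule Q.quotient_is_prime_unique[OF sub[of "Suc i"] sub[of i] P qp[OF that]]) (use that in auto)
  qed (use qp[OF that] in simp)
  have "prime_filtration R ?Q Ns" unfolding prime_filtration_def
  proof (intro conjI)
    show "Ns \<noteq> []" using len by auto
    have "A +>\<^bsub>M\<^esub> x = A" if "x \<in> A" for x
      by (rule M.a_coset_join2[OF submodule_carr[OF A that] submodule.axioms(1)[OF A] that])
    then have "?p A = {A}" using submodule_zero[OF A] by auto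
    then show "hd Ns = {\<zero>\<^bsub>?Q\<^esub>}"
      using \<open>Ns \<noteq> []\<close> nth[of 0] Ls by (simp add: hd_conv_nth quot_module_simps)
    show "last Ns = carrier ?Q"
      using Ls unfolding Ns_def by (subst last_map) (auto simp: quot_module_simps)
    show "\<forall>L\<in>set Ns. submodule L R ?Q"
      using sub len by (auto simp: in_set_conv_nth less_Suc_eq_le)
    show "\<forall>i. Suc i < length Ns \<longrightarrow> Ns ! i \<subset> Ns ! Suc i \<and> (\<exists>P. quotient_is_prime R ?Q Ns i P)"
      using qp Q.prime_step_submodule(3)[OF step] len by auto
  qed
  moreover have "filtration_primes R ?Q Ns = set Ps"
    unfolding filtration_primes_def len
  proof (rule equalityI)
    show "{P. \<exists>i. Suc i < Suc (length Ps) \<and> quotient_is_prime R ?Q Ns i P} \<subseteq> set Ps" using qp_iff by auto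
    show "set Ps \<subseteq> {P. \<exists>i. Suc i < Suc (length Ps) \<and> quotient_is_prime R ?Q Ns i P}"
      using qp by (fastforce simp: in_set_conv_nth)
  qed
  moreover have "filtration_mult R ?Q Ns P \<le> length Ps" for P
  proof -
    have "card {i. Suc i < length Ns \<and> quotient_is_prime R ?Q Ns i P} \<le> card {..<length Ps}"
      by (rule card_mono) (auto simp: len)
    then show ?thesis unfolding filtration_mult_def by simp
  qed
  ultimately show ?thesis by blast
qed

end

section \<open>Generation of the Rees module in bounded degrees\<close>

context ideal_powers begin

lemma rees_module_simps:
  "carrier (rees_module M Mn) = {f. f \<in> up M \<and> (\<forall>n. f n \<in> Mn n)}"
  "f \<oplus>\<^bsub>rees_module M Mn\<^esub> g = (\<lambda>n. f n \<oplus>\<^bsub>M\<^esub> g n)"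
  "\<zero>\<^bsub>rees_module M Mn\<^esub> = (\<lambda>n. \<zero>\<^bsub>M\<^esub>)"
  "p \<odot>\<^bsub>rees_module M Mn\<^esub> f = (\<lambda>n. \<Oplus>\<^bsub>M\<^esub>i\<in>{..n}. p i \<bullet> f (n - i))"
  unfolding rees_module_def by auto

lemma mem_rees_module:
  assumes "\<And>n. Mn n \<subseteq> carrier M"
  shows "f \<in> carrier (rees_module M Mn) \<longleftrightarrow> (\<forall>n. f n \<in> Mn n) \<and> (\<exists>c. \<forall>n>c. f n = \<zero>\<^bsub>M\<^esub>)"
  unfolding rees_module_simps up_def bound_def using assms by auto

text \<open>
  Avoids the module generated by \<open>I Mn n\<close>: a finite set of generators of degree at most \<open>c\<close>
  produces in degree \<open>n + 1\<close> only elements of \<open>I Mn n\<close>.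
\<close>
lemma rees_stable:
  assumes G: "graded I Mn" and fg: "fin_gen_module (rees_ring R I) (rees_module M Mn)"
  shows "\<exists>c. \<forall>n\<ge>c. \<forall>K. submodule K R M \<longrightarrow> (\<forall>a\<in>I. \<forall>v\<in>Mn n. a \<bullet> v \<in> K) \<longrightarrow> Mn (Suc n) \<subseteq> K"
proof -
  let ?N = "rees_module M Mn"
  note Ms = graded_sub[OF G]
  have Mc: "Mn n \<subseteq> carrier M" for n using submoduleE(1)[OF Ms] .
  have mem: "f \<in> carrier ?N \<longleftrightarrow> (\<forall>n. f n \<in> Mn n) \<and> (\<exists>c. \<forall>n>c. f n = \<zero>\<^bsub>M\<^esub>)" for f
    by (rule mem_rees_module) (rule Mc)
  have memM: "f n \<in> carrier M" if "f \<in> carrier ?N" for f n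
    using that mem[of f] Mc[of n] by blast
  obtain A where A: "A \<subseteq> carrier ?N" "finite A" "\<Inter> {N. submodule N (rees_ring R I) ?N \<and> A \<subseteq> N} = carrier ?N"
    using fg unfolding fin_gen_module_def by blast
  have "\<forall>f\<in>A. \<exists>c. \<forall>n>c. f n = \<zero>\<^bsub>M\<^esub>" 
  proof
    fix f assume "f \<in> A"
    then show "\<exists>c. \<forall>n>c. f n = \<zero>\<^bsub>M\<^esub>" using A(1) mem[of f] by blast
  qed
  from bchoice[OF this] obtain b where b: "\<forall>f\<in>A. \<forall>n>b f. f n = \<zero>\<^bsub>M\<^esub>" ..
  define c where "c = (\<Sum>f\<in>A. b f)"
  have c: "f n = \<zero>\<^bsub>M\<^esub>" if "f \<in> A" "n > c" for f n
    using b that(1) member_le_sum[of f A b] that A(2) unfolding c_def by simp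
  have "Mn (Suc n) \<subseteq> K" if n: "n \<ge> c" and K: "submodule K R M"
    and IK: "\<And>a v. a \<in> I \<Longrightarrow> v \<in> Mn n \<Longrightarrow> a \<bullet> v \<in> K" for n K
  proof -
    \<comment> \<open>The generators vanish in degree \<open>n + 1\<close>, so they lie in
      \<open>T\<close>. Once \<open>T\<close> is a submodule it is everything, and \<open>K\<close>
      contains all components of degree \<open>n + 1\<close>.\<close>
    define T where "T = {f \<in> carrier ?N. f (Suc n) \<in> K}"
    have neg: "(\<lambda>n. \<ominus>\<^bsub>M\<^esub> f n) \<in> carrier ?N" if f: "f \<in> carrier ?N" for f
    proof -
      obtain b where "\<forall>n>b. f n = \<zero>\<^bsub>M\<^esub>" "\<forall>n. f n \<in> Mn n" using f mem[of f] by blast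
      then show ?thesis unfolding mem using submoduleE(3)[OF Ms] by (auto intro: exI[of _ b])
    qed
    \<comment> \<open>The predicate \<open>submodule\<close> speaks of a subgroup of the additive
      monoid, whose inverses are identified through the group axioms.\<close>
    have N: "group (add_monoid ?N)"
    proof (rule groupI)
      fix f g h assume f: "f \<in> carrier (add_monoid ?N)" and g: "g \<in> carrier (add_monoid ?N)" and h: "h \<in> carrier (add_monoid ?N)"
      then have c: "f n \<in> carrier M" "g n \<in> carrier M" "h n \<in> carrier M" for n using memM by simp_all
      show "f \<otimes>\<^bsub>add_monoid ?N\<^esub> g \<otimes>\<^bsub>add_monoid ?N\<^esub> h = f \<otimes>\<^bsub>add_monoid ?N\<^esub> (g \<otimes>\<^bsub>add_monoid ?N\<^esub> h)"
        using c by (simp add: rees_module_simps M.a_assoc)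
    next
      fix f g assume f: "f \<in> carrier (add_monoid ?N)" and g: "g \<in> carrier (add_monoid ?N)"
      obtain a b where "\<forall>n>a. f n = \<zero>\<^bsub>M\<^esub>" "\<forall>n>b. g n = \<zero>\<^bsub>M\<^esub>"
        using f g mem[of f] mem[of g] by auto
      then have "\<forall>n>max a b. f n \<oplus>\<^bsub>M\<^esub> g n = \<zero>\<^bsub>M\<^esub>" by simp
      moreover have "f n \<oplus>\<^bsub>M\<^esub> g n \<in> Mn n" for n
        using f g mem[of f] mem[of g] submoduleE(5)[OF Ms] by simp
      ultimately show "f \<otimes>\<^bsub>add_monoid ?N\<^esub> g \<in> carrier (add_monoid ?N)"
        unfolding monoid.simps partial_object.simps mem rees_module_simps(2) by blast
    next
      show "\<one>\<^bsub>add_monoid ?N\<^esub> \<in> carrier (add_monoid ?N)"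
        using submodule_zero[OF Ms] mem[of "\<zero>\<^bsub>?N\<^esub>"] by (simp add: rees_module_simps(3))
    next
      fix f assume f: "f \<in> carrier (add_monoid ?N)"
      have c: "f n \<in> carrier M" for n using f memM by simp
      show "\<one>\<^bsub>add_monoid ?N\<^esub> \<otimes>\<^bsub>add_monoid ?N\<^esub> f = f" using c by (simp add: rees_module_simps)
      have "(\<lambda>n. \<ominus>\<^bsub>M\<^esub> f n) \<in> carrier ?N"
        using f neg by simp
      moreover have "(\<lambda>n. \<ominus>\<^bsub>M\<^esub> f n) \<oplus>\<^bsub>?N\<^esub> f = \<zero>\<^bsub>?N\<^esub>"
        using c by (simp add: rees_module_simps M.l_neg)
      ultimately show "\<exists>g\<in>carrier (add_monoid ?N). g \<otimes>\<^bsub>add_monoid ?N\<^esub> f = \<one>\<^bsub>add_monoid ?N\<^esub>" by auto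
    qed
    have Tsub: "subgroup T (add_monoid ?N)"
    proof (rule group.subgroupI[OF N])
      show "T \<subseteq> carrier (add_monoid ?N)" unfolding T_def by auto
      have "\<zero>\<^bsub>?N\<^esub> \<in> T" unfolding T_def
        using submodule_zero[OF Ms] submodule_zero[OF K] mem[of "\<zero>\<^bsub>?N\<^esub>"] by (simp add: rees_module_simps(3))
      then show "T \<noteq> {}" by blast
      fix f assume f: "f \<in> T"
      have fc: "f n \<in> carrier M" for n using f memM unfolding T_def by simp
      have nf: "(\<lambda>n. \<ominus>\<^bsub>M\<^esub> f n) \<in> carrier ?N"
        using f neg unfolding T_def by simp
      moreover have "(\<lambda>n. \<ominus>\<^bsub>M\<^esub> f n) \<oplus>\<^bsub>?N\<^esub> f = \<zero>\<^bsub>?N\<^esub>"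
        using fc by (simp add: rees_module_simps M.l_neg)
      ultimately have "inv\<^bsub>add_monoid ?N\<^esub> f = (\<lambda>n. \<ominus>\<^bsub>M\<^esub> f n)"
        by (intro group.inv_equality[OF N]) (use f in \<open>auto simp: T_def\<close>)
      then show "inv\<^bsub>add_monoid ?N\<^esub> f \<in> T" using nf f submoduleE(3)[OF K] unfolding T_def by simp
      fix g assume g: "g \<in> T"
      have "f \<otimes>\<^bsub>add_monoid ?N\<^esub> g \<in> carrier (add_monoid ?N)"
        using monoid.m_closed[OF group.is_monoid[OF N]] f g unfolding T_def by auto
      then show "f \<otimes>\<^bsub>add_monoid ?N\<^esub> g \<in> T"
        using f g submoduleE(5)[OF K] unfolding T_def by (simp add: rees_module_simps)
    qed
    have "submodule T (rees_ring R I) ?N"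
    proof (rule submodule.intro[OF Tsub submodule_axioms.intro])
      fix p f assume p: "p \<in> carrier (rees_ring R I)" and f: "f \<in> T"
      have pI: "p i \<in> Ip i" for i using p unfolding rees_ring_def Ip_def by simp
      have pR: "p i \<in> carrier R" for i using Ip_carrier[OF pI] .
      obtain a where a: "\<And>i. i > a \<Longrightarrow> p i = \<zero>" using p unfolding rees_ring_def up_def bound_def by auto
      have fN: "f \<in> carrier ?N" using f unfolding T_def by simp
      then obtain b where b: "\<And>i. i > b \<Longrightarrow> f i = \<zero>\<^bsub>M\<^esub>" using mem[of f] by blast
      have fM: "f i \<in> Mn i" for i using fN mem[of f] by blast
      have "p i \<bullet> f (k - i) = \<zero>\<^bsub>M\<^esub>" if "k > a + b" "i \<le> k" for i k
        using a[of i] b[of "k - i"] that pR memM[OF fN] by (cases "i > a") auto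
      then have "(\<Oplus>\<^bsub>M\<^esub>i\<in>{..k}. p i \<bullet> f (k - i)) = \<zero>\<^bsub>M\<^esub>" if "k > a + b" for k
        using finsum_in_submodule[OF submodule_zero_set, of "{..k}" "\<lambda>i. p i \<bullet> f (k - i)"] that by auto
      moreover have "(\<Oplus>\<^bsub>M\<^esub>i\<in>{..k}. p i \<bullet> f (k - i)) \<in> Mn k" for k
      proof (rule finsum_in_submodule[OF Ms])
        fix i assume "i \<in> {..k}"
        then show "p i \<bullet> f (k - i) \<in> Mn k" using graded_Ip[OF G pI[of i] fM[of "k - i"]] by simp
      qed simp
      ultimately have "p \<odot>\<^bsub>?N\<^esub> f \<in> carrier ?N" unfolding mem rees_module_simps(4) by blast
      moreover have "(\<Oplus>\<^bsub>M\<^esub>i\<in>{..Suc n}. p i \<bullet> f (Suc n - i)) \<in> K"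
      proof (rule finsum_in_submodule[OF K])
        fix i assume i: "i \<in> {..Suc n}"
        show "p i \<bullet> f (Suc n - i) \<in> K"
        proof (cases i)
          case 0
          then show ?thesis using f submoduleE(4)[OF K pR] unfolding T_def by simp
        next
          case (Suc j)
          define v where "v = f (n - j)"
          have v: "v \<in> Mn (n - j)" "v \<in> carrier M" unfolding v_def using fM Mc by blast+
          \<comment> \<open>Here \<open>I\<close> to the power \<open>j\<close> carries
            \<open>v\<close> into \<open>Mn n\<close>, and one further factor from \<open>I\<close>
            leads into \<open>K\<close>. Only the coefficient of degree zero multiplies the
            component of degree \<open>n + 1\<close> itself.\<close>
          have "Ip (Suc j) \<subseteq> {r \<in> carrier R. r \<bullet> v \<in> K}"
          proof (rule Ip_Suc_subset[OF colon_ideal[OF K v(2)]])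
            fix a b assume ab: "a \<in> Ip j" "b \<in> I"
            have cc: "a \<in> carrier R" "b \<in> carrier R" using ab Ip_carrier ideal.Icarr[OF I] by blast+
            have "a \<bullet> v \<in> Mn (n - j + j)" by (rule graded_Ip[OF G ab(1) v(1)])
            then have "b \<bullet> (a \<bullet> v) \<in> K" using IK[OF ab(2)] i Suc by simp
            moreover have "b \<bullet> (a \<bullet> v) = (a \<otimes> b) \<bullet> v"
              using cc v by (simp add: R.m_comm[of a b] smult_assoc1)
            ultimately show "a \<otimes> b \<in> {r \<in> carrier R. r \<bullet> v \<in> K}" using cc by simp
          qed
          then show ?thesis using pI[of i] unfolding Suc v_def by auto
        qed
      qed simp
      ultimately show "p \<odot>\<^bsub>?N\<^esub> f \<in> T" unfolding T_def by (simp add: rees_module_simps(4))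
    qed
    moreover have "A \<subseteq> T" 
      unfolding T_def using A(1) c[of _ "Suc n"] n submodule_zero[OF K] by auto
    ultimately have NT: "carrier ?N \<subseteq> T" using A(3) by blast
    show "Mn (Suc n) \<subseteq> K"
    proof
      fix v assume v: "v \<in> Mn (Suc n)"
      have "(\<lambda>i. if i = Suc n then v else \<zero>\<^bsub>M\<^esub>) \<in> carrier ?N"
        unfolding mem using v submodule_zero[OF Ms] by (auto intro: exI[of _ "Suc n"])
      then show "v \<in> K" using NT unfolding T_def by auto
    qed
  qed
  then show ?thesis by blast
qed

end

section \<open>Krull dimension\<close>

lemma (in cring) primeideal_image_quot:
  assumes J: "ideal J R" and Q: "primeideal Q R" and JQ: "J \<subseteq> Q"
  shows "primeideal ((+>) J ` Q) (R Quot J)"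
    and "x \<in> carrier R \<Longrightarrow> J +> x \<in> (+>) J ` Q \<longleftrightarrow> x \<in> Q"
proof -
  interpret Q: primeideal Q R by (rule Q)
  have hom: "(+>) J \<in> ring_hom R (R Quot J)" by (rule ideal.rcos_ring_hom[OF J])
  have mem: "J +> x \<in> (+>) J ` Q \<longleftrightarrow> x \<in> Q" if x: "x \<in> carrier R" for x
  proof
    assume "J +> x \<in> (+>) J ` Q"
    then obtain q where q: "q \<in> Q" "J +> x = J +> q" by blast
    have qR: "q \<in> carrier R" using q Q.Icarr by blast
    have "x \<ominus> q \<in> Q" using quotient_eq_iff_same_a_r_cos[OF J x qR] q JQ by blast
    then have "(x \<ominus> q) \<oplus> q \<in> Q" using q Q.a_closed by blast
    moreover have "(x \<ominus> q) \<oplus> q = x" using x qR by algebra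
    ultimately show "x \<in> Q" by simp
  qed blast
  then show "x \<in> carrier R \<Longrightarrow> J +> x \<in> (+>) J ` Q \<longleftrightarrow> x \<in> Q" .
  have carr: "carrier (R Quot J) = (+>) J ` carrier R"
    unfolding FactRing_def A_RCOSETS_def' by auto
  show "primeideal ((+>) J ` Q) (R Quot J)"
  proof (rule primeidealI)
    show "ideal ((+>) J ` Q) (R Quot J)" by (rule ring_ideal_imp_quot_ideal[OF J Q.is_ideal])
    show "cring (R Quot J)" by (rule ideal.quotient_is_cring[OF J is_cring])
    have "\<one> \<notin> Q" using Q.I_notcarr Q.one_imp_carrier by blast
    then have "J +> \<one> \<notin> (+>) J ` Q" using mem[OF one_closed] by simp
    then show "carrier (R Quot J) \<noteq> (+>) J ` Q" unfolding carr by blast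
    fix X Y assume XY: "X \<in> carrier (R Quot J)" "Y \<in> carrier (R Quot J)"
      and prod: "X \<otimes>\<^bsub>R Quot J\<^esub> Y \<in> (+>) J ` Q"
    obtain a b where ab: "a \<in> carrier R" "b \<in> carrier R" "X = J +> a" "Y = J +> b"
      using XY unfolding carr by blast
    then have "J +> (a \<otimes> b) \<in> (+>) J ` Q" using prod ring_hom_mult[OF hom] by simp
    then have "a \<otimes> b \<in> Q" using mem ab by simp
    then have "a \<in> Q \<or> b \<in> Q" using Q.I_prime ab by blast
    then show "X \<in> (+>) J ` Q \<or> Y \<in> (+>) J ` Q" using ab by blast
  qed
qed

text \<open>Strict inclusions survive in the quotient, because membership in a prime that contains
  \<open>J\<close> depends only on the coset modulo \<open>J\<close>.\<close>

lemma (in cring) krull_dim_quot_ge: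
  assumes J: "ideal J R" and Q: "\<forall>i\<le>k. primeideal (Q i) R" "\<forall>i<k. Q i \<subset> Q (Suc i)" "J \<subseteq> Q (0::nat)"
  shows "ereal (real k) \<le> krull_dim (R Quot J)"
proof -
  have JQ: "J \<subseteq> Q i" if "i \<le> k" for i
    using that
  proof (induction i)
    case (Suc i)
    then have "Q i \<subset> Q (Suc i)" using Q(2) by simp
    then show ?case using Suc by auto
  qed (rule Q(3))
  define S where "S i = (+>) J ` Q i" for i
  have "primeideal (S i) (R Quot J)" if "i \<le> k" for i
    unfolding S_def using primeideal_image_quot(1)[OF J] Q(1) JQ that by blast
  moreover have "S i \<subset> S (Suc i)" if i: "i < k" for i
  proof -
    have s: "Q i \<subset> Q (Suc i)" and p: "primeideal (Q i) R" "primeideal (Q (Suc i)) R" using Q i by auto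
    obtain x where x: "x \<in> Q (Suc i)" "x \<notin> Q i" using s by blast
    have xR: "x \<in> carrier R" using ideal.Icarr[OF primeideal.axioms(1)[OF p(2)]] x by blast
    have "J +> x \<notin> S i" unfolding S_def using primeideal_image_quot(2)[OF J p(1) JQ xR] i x by simp
    moreover have "J +> x \<in> S (Suc i)" unfolding S_def using x by blast
    moreover have "S i \<subseteq> S (Suc i)" unfolding S_def using s by blast
    ultimately show ?thesis by blast
  qed
  ultimately show ?thesis unfolding krull_dim_def by (intro Sup_upper) blast
qed

lemma (in module) annihilator_ideal: "ideal (annihilator R M) R"
proof (rule idealI)
  show "ring R" by (rule R.ring_axioms)
  show "subgroup (annihilator R M) (add_monoid R)"
    unfolding subgroup_def annihilator_def
    by (auto simp: smult_l_distr smult_l_minus simp flip: a_inv_def)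
  show "x \<otimes> a \<in> annihilator R M" if "a \<in> annihilator R M" "x \<in> carrier R" for a x
    using that unfolding annihilator_def by (simp add: smult_assoc1)
  then show "a \<otimes> x \<in> annihilator R M" if "a \<in> annihilator R M" "x \<in> carrier R" for a x
    using that R.m_comm[of a x] unfolding annihilator_def by auto
qed

lemma bigo_power_ereal:
  assumes "\<And>n. f n \<le> K * Suc n ^ d" and "real d \<le> r"
  shows "bigo_power f (ereal r)"
proof -
  have "(\<lambda>n. real (f n)) \<in> O(\<lambda>n. real n powr r)"
  \<comment> \<open>The factor \<open>2 ^ d\<close> absorbs \<open>Suc n \<le> 2 * n\<close>, valid
    from \<open>n = 1\<close> on.\<close>
  proof (rule bigoI[where c = "real K * 2 ^ d"])
    show "\<forall>\<^sub>F n in sequentially. norm (real (f n)) \<le> real K * 2 ^ d * norm (real n powr r)"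
      using eventually_ge_at_top[of 1]
    proof eventually_elim
      case (elim n)
      have "real (f n) \<le> real (K * Suc n ^ d)" using assms(1) of_nat_le_iff by blast
      also have "\<dots> = real K * real (Suc n) ^ d" by simp
      also have "\<dots> \<le> real K * (2 * real n) ^ d"
        using elim by (intro mult_left_mono power_mono) auto
      also have "\<dots> = real K * 2 ^ d * real n powr real d"
        using elim by (simp add: power_mult_distrib powr_realpow)
      also have "\<dots> \<le> real K * 2 ^ d * real n powr r"
        using elim assms(2) by (intro mult_left_mono powr_mono) auto
      finally show ?case by simp
    qed
  qed
  then show ?thesis unfolding bigo_power_def by simp
qed

text \<open>The floor produces a natural exponent without a proof that a finite supremum is an
  integer. For dimension minus infinity the value is a placeholder, as no prime contains the
  annihilator.\<close>

definition (in module) dim_bound :: "nat option" where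
  "dim_bound = (case module_dim R M of ereal r \<Rightarrow> Some (nat \<lfloor>r\<rfloor>) | PInfty \<Rightarrow> None | MInfty \<Rightarrow> Some 0)"

context module begin

lemma chain_le_module_dim:
  assumes "\<forall>i\<le>k. primeideal (Q i) R" "\<forall>i<k. Q i \<subset> Q (Suc i)" "annihilator R M \<subseteq> Q (0::nat)"
  shows "ereal (real k) \<le> module_dim R M"
  unfolding module_dim_def by (rule R.krull_dim_quot_ge[OF annihilator_ideal assms])

lemma dim_le_dim_bound: "R.dim_le (annihilator R M) dim_bound"
  unfolding R.dim_le_def
proof (intro allI impI)
  fix d k Q assume b: "dim_bound = Some d" and Q: "\<forall>i\<le>k. primeideal (Q i) R"
    "\<forall>i<k. Q i \<subset> Q (Suc i)" "annihilator R M \<subseteq> Q (0::nat)"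
  have le: "ereal (real k) \<le> module_dim R M" by (rule chain_le_module_dim[OF Q])
  show "k \<le> d"
  proof (cases "module_dim R M")
    case (real r)
    then have "real k \<le> r" "d = nat \<lfloor>r\<rfloor>" using le b unfolding dim_bound_def by auto
    then show ?thesis by linarith
  qed (use le b dim_bound_def in auto)
qed

lemma bigo_power_module_dim:
  assumes bound: "\<And>d. dim_bound = Some d \<Longrightarrow> \<exists>K. \<forall>n. f n \<le> K * Suc n ^ d"
    and zero: "\<And>n. f n > 0 \<Longrightarrow> \<exists>Q. primeideal Q R \<and> annihilator R M \<subseteq> Q"
  shows "bigo_power f (module_dim R M)"
proof (cases "module_dim R M")
  case (real r)
  have r: "0 \<le> r"
  proof (rule ccontr)
    assume neg: "\<not> 0 \<le> r"
    \<comment> \<open>A supremum above \<open>r - 1\<close> has a member above \<open>r - 1\<close>,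
      so some chain exists; its length is nonnegative and at most \<open>r\<close>.\<close>
    have "ereal (r - 1) < module_dim R M" using real by simp
    then obtain x where "x \<in> {ereal (real k) |k. \<exists>P :: nat \<Rightarrow> 'a set set. (\<forall>i\<le>k. primeideal (P i) (R Quot annihilator R M)) \<and>
        (\<forall>i<k. P i \<subset> P (Suc i))}" unfolding module_dim_def krull_dim_def less_Sup_iff by blast
    then have "0 \<le> x" "x \<le> ereal r"
      unfolding real[symmetric] module_dim_def krull_dim_def by (auto intro: Sup_upper)
    then show False using neg by (metis ereal_less_eq(3) order_trans zero_ereal_def)
  qed
  obtain K where "\<forall>n. f n \<le> K * Suc n ^ nat \<lfloor>r\<rfloor>" using bound real unfolding dim_bound_def by auto
  moreover have "real (nat \<lfloor>r\<rfloor>) \<le> r" using r by linarith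
  ultimately show ?thesis unfolding real by (intro bigo_power_ereal) auto
next
  case PInf
  then show ?thesis unfolding bigo_power_def by simp
next
  case MInf
  have "f n = 0" for n
  proof (rule ccontr)
    assume "f n \<noteq> 0"
    then obtain Q where "primeideal Q R" "annihilator R M \<subseteq> Q" using zero by blast
    then have "ereal (real 0) \<le> module_dim R M" by (intro chain_le_module_dim[of 0 "\<lambda>_. Q"]) auto
    then show False using MInf by simp
  qed
  then show ?thesis unfolding MInf bigo_power_def by simp
qed

end

section \<open>Assembling the filtrations of the quotients of \<open>M\<close>\<close>

context filtration begin

lemma prime_filtrations:
  obtains \<Lambda> F where "finite \<Lambda>" "\<And>P. P \<in> \<Lambda> \<Longrightarrow> primeideal P R"
    "\<And>n. prime_filtration R (quot_module M (Mn n)) (F n)"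
    "\<And>n. filtration_primes R (quot_module M (Mn n)) (F n) \<subseteq> \<Lambda>"
    "\<And>P. bigo_power (\<lambda>n. filtration_mult R (quot_module M (Mn n)) (F n) P) (module_dim R M)"
    "infinite_residue_fields R \<Longrightarrow>
      \<exists>\<Lambda>'. \<forall>\<^sub>F n in sequentially. filtration_primes R (quot_module M (Mn n)) (F n) = \<Lambda>'"
proof -
  obtain \<Lambda> ps where \<Lambda>: "finite \<Lambda>" and ps: "\<And>n. prime_chain (Mn n) (carrier M) (ps n)" "\<And>n. set (ps n) \<subseteq> \<Lambda>"
    and len: "\<And>d. dim_bound = Some d \<Longrightarrow> \<exists>K. \<forall>n. length (ps n) \<le> K * Suc n ^ d"
    and const: "infinite_residue_fields R \<Longrightarrow> \<exists>\<Lambda>'. \<forall>\<^sub>F n in sequentially. set (ps n) = \<Lambda>'"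
    using bounded_chains_zero[OF dim_le_dim_bound] unfolding bounded_chains_def Fil_zero_carrier by blast
  have "\<forall>n. \<exists>Ns. prime_filtration R (quot_module M (Mn n)) Ns \<and>
    filtration_primes R (quot_module M (Mn n)) Ns = set (ps n) \<and>
    (\<forall>P. filtration_mult R (quot_module M (Mn n)) Ns P \<le> length (ps n))"
    using prime_chain_filtration[OF Mn_sub ps(1)] by blast
  then obtain F where F: "\<And>n. prime_filtration R (quot_module M (Mn n)) (F n)"
    "\<And>n. filtration_primes R (quot_module M (Mn n)) (F n) = set (ps n)"
    "\<And>n P. filtration_mult R (quot_module M (Mn n)) (F n) P \<le> length (ps n)" by metis
  have primes: "primeideal P R" "annihilator R M \<subseteq> P" if "P \<in> set (ps n)" for P n
    using prime_chain_primes[OF ps(1) that] submodule_zero[OF Mn_sub] unfolding annihilator_def by auto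
  show thesis
  \<comment> \<open>The finite set from \<open>bounded_chains\<close> only contains the occurring
    primes, so other members that are not prime are removed.\<close>
  proof (rule that[of "{P \<in> \<Lambda>. primeideal P R}" F])
    show "filtration_primes R (quot_module M (Mn n)) (F n) \<subseteq> {P \<in> \<Lambda>. primeideal P R}" for n
      unfolding F(2) using ps(2) primes(1) by blast
    show "bigo_power (\<lambda>n. filtration_mult R (quot_module M (Mn n)) (F n) P) (module_dim R M)" for P
    proof (rule bigo_power_module_dim)
      show "\<exists>K. \<forall>n. filtration_mult R (quot_module M (Mn n)) (F n) P \<le> K * Suc n ^ d"
        if "dim_bound = Some d" for d
        using len[OF that] F(3) order_trans by blast
      show "\<exists>Q. primeideal Q R \<and> annihilator R M \<subseteq> Q"
        if "0 < filtration_mult R (quot_module M (Mn n)) (F n) P" for n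
      proof -
        have "ps n \<noteq> []" using that F(3)[of n P] by auto
        then show ?thesis using primes[of "hd (ps n)" n] by auto
      qed
    qed
    show "\<exists>\<Lambda>'. \<forall>\<^sub>F n in sequentially. filtration_primes R (quot_module M (Mn n)) (F n) = \<Lambda>'"
      if "infinite_residue_fields R"
      unfolding F(2) by (rule const[OF that])
  qed (use \<Lambda> F(1) in auto)
qed

end

text \<open>Finite generation over the Rees ring makes \<open>I\<close> times \<open>Mn n\<close>
  generate \<open>Mn (n + 1)\<close> for large \<open>n\<close>, which gives the chain condition of
  the locale.\<close>

lemma filtration_of_filtered_module:
  assumes R: "noetherian_ring R" and I: "ideal I R" and fil: "filtered_module R I M Mn"
  shows "filtration R M I Mn"
proof -
  have M: "module R M" and fg: "fin_gen_module R M" and Mn0: "Mn 0 = carrier M"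
    and Suc: "\<And>n. Mn (Suc n) \<subseteq> Mn n"
    and rees: "fin_gen_module (rees_ring R I) (rees_module M Mn)"
    using fil unfolding filtered_module_def by blast+
  interpret ideal_powers R M I
    by (intro ideal_powers.intro ideal_powers_axioms.intro M R I)
  have G: "graded I Mn" unfolding graded_def using fil unfolding filtered_module_def by blast
  have acc: "acc {N. submodule N R M}" by (rule acc_submodules_fin_gen[OF R fg])
  obtain c where c: "\<forall>n\<ge>c. \<forall>K. submodule K R M \<longrightarrow> (\<forall>a\<in>I. \<forall>v\<in>Mn n. a \<odot>\<^bsub>M\<^esub> v \<in> K) \<longrightarrow> Mn (Suc n) \<subseteq> K"
    using rees_stable[OF G rees] by blast
  have "acc {L. graded I L \<and> L \<le> Mn}"
    by (rule acc_filtration[OF R acc I, of Mn c])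
      (use c submoduleE(1)[OF graded_sub[OF G]] in auto)
  then show ?thesis
    by unfold_locales (use G Suc Mn0 acc in auto)
qed

theorem theorem5:
  fixes R :: "('a, 'c) ring_scheme" and M :: "('a, 'b, 'd) module_scheme"
    and I :: "'a set" and Mn :: "nat \<Rightarrow> 'b set"
  assumes "cring R" and "noetherian_ring R" and "ideal I R"
    and "filtered_module R I M Mn"
  shows "\<exists>\<Lambda>. finite \<Lambda> \<and> (\<forall>P \<in> \<Lambda>. primeideal P R) \<and>
    (\<exists>F. (\<forall>n. prime_filtration R (quot_module M (Mn n)) (F n) \<and>
               filtration_primes R (quot_module M (Mn n)) (F n) \<subseteq> \<Lambda>) \<and>
         (\<forall>P \<in> \<Lambda>. bigo_power
            (\<lambda>n. filtration_mult R (quot_module M (Mn n)) (F n) P) (module_dim R M))) \<and>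
    (infinite_residue_fields R \<longrightarrow>
      (\<exists>F. (\<forall>n. prime_filtration R (quot_module M (Mn n)) (F n) \<and>
                 filtration_primes R (quot_module M (Mn n)) (F n) \<subseteq> \<Lambda>) \<and>
           (\<forall>P \<in> \<Lambda>. bigo_power
              (\<lambda>n. filtration_mult R (quot_module M (Mn n)) (F n) P) (module_dim R M)) \<and>
           (\<exists>\<Lambda>' \<subseteq> \<Lambda>. \<forall>\<^sub>F n in sequentially.
              filtration_primes R (quot_module M (Mn n)) (F n) = \<Lambda>')))"
proof -
  interpret filtration R M I Mn by (rule filtration_of_filtered_module[OF assms(2-4)])
  obtain \<Lambda> F where \<Lambda>: "finite \<Lambda>" "\<And>P. P \<in> \<Lambda> \<Longrightarrow> primeideal P R"
    and F: "\<And>n. prime_filtration R (quot_module M (Mn n)) (F n)"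
      "\<And>n. filtration_primes R (quot_module M (Mn n)) (F n) \<subseteq> \<Lambda>"
      "\<And>P. bigo_power (\<lambda>n. filtration_mult R (quot_module M (Mn n)) (F n) P) (module_dim R M)"
    and const: "infinite_residue_fields R \<Longrightarrow>
      \<exists>\<Lambda>'. \<forall>\<^sub>F n in sequentially. filtration_primes R (quot_module M (Mn n)) (F n) = \<Lambda>'"
    by (rule prime_filtrations) (rule that)
  have "\<exists>\<Lambda>' \<subseteq> \<Lambda>. \<forall>\<^sub>F n in sequentially. filtration_primes R (quot_module M (Mn n)) (F n) = \<Lambda>'"
    if inf: "infinite_residue_fields R"
  proof -
    obtain \<Lambda>' where ev: "\<forall>\<^sub>F n in sequentially. filtration_primes R (quot_module M (Mn n)) (F n) = \<Lambda>'"
      using const[OF inf] by blast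
    then obtain n where "filtration_primes R (quot_module M (Mn n)) (F n) = \<Lambda>'"
      unfolding eventually_sequentially by blast
    then have "\<Lambda>' \<subseteq> \<Lambda>" using F(2) by blast
    then show ?thesis using ev by blast
  qed
  \<comment> \<open>The same \<open>F\<close> serves both existential claims, since its sets of
    primes stabilize as soon as the residue fields are infinite.\<close>
  then show ?thesis 
    using \<Lambda> F by - (rule exI[of _ \<Lambda>], intro conjI impI exI[of _ F], auto)
qed

end
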